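(* Let $\mathcal{G}$ be the hereditary class of finite simple graphs defined in the context, and let $$\mathcal{G}'=\{G\in\mathcal{G} : C_n\text{ is not an induced subgraph of }G\text{ for any } n\equiv 2 \ (\mathrm{mod}\ 3)\}.$$ If $G\in\mathcal{G}'$, then $I(G)$ is strand connected.
   Context: For a graph $G$ on $\{x_1,\ldots,x_n\}$ and a field $\mathbb{K}$, $I(G)=(x_ix_j:\{x_i,x_j\}\in E(G))\subset R=\mathbb{K}[x_1,\ldots,x_n]$ is its edge ideal. For a homogeneous ideal $I\subset R$, the $j$-strand of $I$ is the set $\{i:\beta_{i,i+j}^R(R/I)\neq 0\}$ (graded Betti numbers of $R/I$ over the standard graded ring $R$). A non-empty $j$-strand is connected if it equals the integer interval $[q_j(I),p_j(I)]$, where $q_j(I)$ and $p_j(I)$ are its minimum and maximum. $I$ is strand connected if every non-empty strand is connected. $N_G(v)$ is the set of neighbours of $v$, $N_G[v]=N_G(v)\cup\{v\}$; for an edge $e$, $G\setminus e$ is the graph with vertex set $V(G)$ and edge set $E(G)\setminus\{e\}$; $C_n$ is the cycle on $n$ vertices. The class $\mathcal{G}$ (closed under taking induced subgraphs) is defined recursively on the number of edges: (0) graphs without edges belong to $\mathcal{G}$, and a disconnected graph belongs to $\mathcal{G}$ if and only if each of its connected components does; a connected graph $G$ with at least one edge belongs to $\mathcal{G}$ if and only if (1) $G=C_n$ for some $n\ge 3$, or (2) $G$ is not a cycle and there exists an edge $e=\{x,y\}\in E(G)$ such that $N_G(x)\subseteq N_G[y]$ and $G\setminus e\in\mathcal{G}$.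 *)

theory Defs
  imports "HOL-Library.Poly_Mapping" "Jordan_Normal_Form.Matrix"
begin

section \<open>Graphs\<close>

text \<open>A graph is given by its vertex set \<open>V\<close> and its set \<open>E\<close> of edges, each edge being a
  two-element subset of \<open>V\<close>.\<close>

definition simple_graph :: "'v set \<Rightarrow> 'v set set \<Rightarrow> bool" where
  "simple_graph V E \<longleftrightarrow> finite V \<and> (\<forall>e\<in>E. e \<subseteq> V \<and> card e = 2)"

definition neighbours :: "'v set set \<Rightarrow> 'v \<Rightarrow> 'v set" where
  "neighbours E v = {u. {u, v} \<in> E}"

definition closed_neighbours :: "'v set set \<Rightarrow> 'v \<Rightarrow> 'v set" where
  "closed_neighbours E v = insert v (neighbours E v)"

definition induced_edges :: "'v set set \<Rightarrow> 'v set \<Rightarrow> 'v set set" where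
  "induced_edges E W = {e \<in> E. e \<subseteq> W}"

definition adjacency :: "'v set set \<Rightarrow> ('v \<times> 'v) set" where
  "adjacency E = {(u, v). {u, v} \<in> E}"

definition connected_graph :: "'v set \<Rightarrow> 'v set set \<Rightarrow> bool" where
  "connected_graph V E \<longleftrightarrow> V \<noteq> {} \<and> (\<forall>u\<in>V. \<forall>v\<in>V. (u, v) \<in> (adjacency E)\<^sup>*)"

definition components :: "'v set \<Rightarrow> 'v set set \<Rightarrow> 'v set set" where
  "components V E = {{u \<in> V. (v, u) \<in> (adjacency E)\<^sup>*} | v. v \<in> V}"

definition graph_isomorphic ::
    "'v set \<Rightarrow> 'v set set \<Rightarrow> 'w set \<Rightarrow> 'w set set \<Rightarrow> bool" where
  "graph_isomorphic V E W F \<longleftrightarrow>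
     (\<exists>f. bij_betw f V W \<and> (\<forall>u\<in>V. \<forall>v\<in>V. {u, v} \<in> E \<longleftrightarrow> {f u, f v} \<in> F))"

definition cycle_edges :: "nat \<Rightarrow> nat set set" where
  "cycle_edges n = {{i, Suc i mod n} | i. i < n}"

definition is_cycle :: "nat \<Rightarrow> 'v set \<Rightarrow> 'v set set \<Rightarrow> bool" where
  "is_cycle n V E \<longleftrightarrow> n \<ge> 3 \<and> graph_isomorphic V E {..<n} (cycle_edges n)"

text \<open>Each recursive appeal is to a graph with fewer edges, or with the same number of edges and
  fewer vertices, and the cases are mutually exclusive on graphs with an edge (a graph without
  edges satisfies the condition of the second case anyway). So the least predicate closed under
  the rules is the one given by the recursion.\<close>

inductive class_G :: "'v set \<Rightarrow> 'v set set \<Rightarrow> bool" where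
  edgeless: "simple_graph V {} \<Longrightarrow> class_G V {}"
| disconnected:
    "\<lbrakk>simple_graph V E; \<not> connected_graph V E;
      \<forall>W\<in>components V E. class_G W (induced_edges E W)\<rbrakk> \<Longrightarrow> class_G V E"
| cycle: "\<lbrakk>simple_graph V E; is_cycle n V E\<rbrakk> \<Longrightarrow> class_G V E"
| delete_edge:
    "\<lbrakk>simple_graph V E; connected_graph V E; \<forall>n. \<not> is_cycle n V E;
      {x, y} \<in> E; neighbours E x \<subseteq> closed_neighbours E y; class_G V (E - {{x, y}})\<rbrakk>
     \<Longrightarrow> class_G V E"

definition class_G' :: "'v set \<Rightarrow> 'v set set \<Rightarrow> bool" where
  "class_G' V E \<longleftrightarrow> class_G V E \<and>
     (\<forall>n. n mod 3 = 2 \<longrightarrow> \<not> (\<exists>W\<subseteq>V. is_cycle n W (induced_edges E W)))"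


section \<open>The standard graded polynomial ring\<close>

text \<open>Monomials are finitely supported exponent vectors, polynomials are finitely supported
  functions from monomials to coefficients. The ring \<open>K[x\<^sub>v : v \<in> V]\<close> is the set \<open>polys V\<close>.\<close>

type_synonym ('v, 'k) mpoly = "('v \<Rightarrow>\<^sub>0 nat) \<Rightarrow>\<^sub>0 'k"

definition polys :: "'v set \<Rightarrow> ('v, 'k::zero) mpoly set" where
  "polys V = {p. \<forall>m \<in> Poly_Mapping.keys p. Poly_Mapping.keys m \<subseteq> V}"

definition var :: "'v \<Rightarrow> ('v, 'k::zero_neq_one) mpoly" where
  "var v = Poly_Mapping.single (Poly_Mapping.single v 1) 1"

definition mon_degree :: "('v \<Rightarrow>\<^sub>0 nat) \<Rightarrow> nat" where
  "mon_degree m = (\<Sum>v \<in> Poly_Mapping.keys m. Poly_Mapping.lookup m v)"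

definition ideal_generated ::
    "'v set \<Rightarrow> ('v, 'k::comm_ring_1) mpoly set \<Rightarrow> ('v, 'k) mpoly set" where
  "ideal_generated V S =
     {(\<Sum>s\<in>T. a s * s) | a T. finite T \<and> T \<subseteq> S \<and> (\<forall>s\<in>T. a s \<in> polys V)}"

definition edge_ideal :: "'v set \<Rightarrow> 'v set set \<Rightarrow> ('v, 'k::comm_ring_1) mpoly set" where
  "edge_ideal V E = ideal_generated V {var x * var y | x y. {x, y} \<in> E}"


section \<open>Minimal graded free resolutions, graded Betti numbers and strands\<close>

definition free_module :: "'v set \<Rightarrow> nat \<Rightarrow> ('v, 'k::zero) mpoly vec set" where
  "free_module V n = {u \<in> carrier_vec n. \<forall>i<n. u $ i \<in> polys V}"

text \<open>A list \<open>ds\<close> of degrees stands for the graded free module that is the direct sum of the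
  \<open>R(-d)\<close>, \<open>d\<close> in \<open>ds\<close>. A matrix is a degree-preserving map from the module of \<open>es\<close> to the
  module of \<open>ds\<close> if its entry in row \<open>r\<close> and column \<open>c\<close> is homogeneous of degree
  \<open>es ! c - ds ! r\<close> (hence zero if this is negative).\<close>

definition graded_map ::
    "'v set \<Rightarrow> nat list \<Rightarrow> nat list \<Rightarrow> ('v, 'k::zero) mpoly mat \<Rightarrow> bool" where
  "graded_map V ds es A \<longleftrightarrow> A \<in> carrier_mat (length ds) (length es) \<and>
     (\<forall>r<length ds. \<forall>c<length es. A $$ (r, c) \<in> polys V \<and>
        (\<forall>m \<in> Poly_Mapping.keys (A $$ (r, c)). mon_degree m + ds ! r = es ! c))"

text \<open>A graded free resolution \<open>\<dots> \<rightarrow> F\<^sub>2 \<rightarrow> F\<^sub>1 \<rightarrow> F\<^sub>0 = R \<rightarrow> R/I \<rightarrow> 0\<close> by finitely generated free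
  modules, for a proper homogeneous ideal \<open>I\<close>: \<open>D i\<close> lists the degrees of the basis of \<open>F\<^sub>i\<close>, and
  \<open>A i\<close> is the matrix of \<open>F\<^bsub>i+1\<^esub> \<rightarrow> F\<^sub>i\<close>. Since \<open>I\<close> is generated in nonnegative degrees, no
  negative degrees occur in the basis of a minimal resolution.\<close>

definition graded_free_resolution ::
    "'v set \<Rightarrow> ('v, 'k::comm_ring_1) mpoly set \<Rightarrow> (nat \<Rightarrow> nat list) \<Rightarrow>
     (nat \<Rightarrow> ('v, 'k) mpoly mat) \<Rightarrow> bool" where
  "graded_free_resolution V I D A \<longleftrightarrow>
     D 0 = [0] \<and>
     (\<forall>i. graded_map V (D i) (D (Suc i)) (A i)) \<and>
     {(A 0 *\<^sub>v u) $ 0 | u. u \<in> free_module V (length (D 1))} = I \<and>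
     (\<forall>i. {A (Suc i) *\<^sub>v u | u. u \<in> free_module V (length (D (Suc (Suc i))))} =
          {u \<in> free_module V (length (D (Suc i))). A i *\<^sub>v u = 0\<^sub>v (length (D i))})"

text \<open>Minimality: the entries of all matrices lie in the ideal generated by the variables, i.e.
  they have constant term zero.\<close>

definition minimal_graded_free_resolution ::
    "'v set \<Rightarrow> ('v, 'k::comm_ring_1) mpoly set \<Rightarrow> (nat \<Rightarrow> nat list) \<Rightarrow>
     (nat \<Rightarrow> ('v, 'k) mpoly mat) \<Rightarrow> bool" where
  "minimal_graded_free_resolution V I D A \<longleftrightarrow> graded_free_resolution V I D A \<and>
     (\<forall>i. \<forall>r<length (D i). \<forall>c<length (D (Suc i)).
        Poly_Mapping.lookup (A i $$ (r, c)) 0 = 0)"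

text \<open>The graded Betti number of \<open>R/I\<close> in homological degree \<open>i\<close> and internal degree \<open>d\<close>. For
  finite \<open>V\<close> and a proper homogeneous ideal \<open>I\<close> over a field, a minimal graded free resolution
  exists and the number of summands \<open>R(-d)\<close> of \<open>F\<^sub>i\<close> does not depend on its choice.\<close>

definition betti :: "'v set \<Rightarrow> ('v, 'k::field) mpoly set \<Rightarrow> nat \<Rightarrow> nat \<Rightarrow> nat" where
  "betti V I i d =
     (THE b. \<exists>D A. minimal_graded_free_resolution V I D A \<and> b = count_list (D i) d)"

definition strand :: "'v set \<Rightarrow> ('v, 'k::field) mpoly set \<Rightarrow> nat \<Rightarrow> nat set" where
  "strand V I j = {i. betti V I i (i + j) \<noteq> 0}"

definition strand_connected :: "'v set \<Rightarrow> ('v, 'k::field) mpoly set \<Rightarrow> bool" where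
  "strand_connected V I \<longleftrightarrow>
     (\<forall>j. strand V I j \<noteq> {} \<longrightarrow> strand V I j = {Min (strand V I j)..Max (strand V I j)})"

end

theory Submission
  imports Defs "Jordan_Normal_Form.Determinant" "HOL-Library.Nat_Bijection"
begin

text \<open>Strands are controlled through explicit minimal resolutions. If \<open>e = {x, y}\<close> satisfies
  \<open>N(x) \<subseteq> N[y]\<close>, let \<open>J = I(G - e)\<close>. The ideal \<open>J : xy\<close> is generated by the variables in
  \<open>N(y) - {x}\<close> and the edges outside \<open>N[y]\<close>, and multiplication by \<open>y\<close> already maps it into \<open>J\<close>.
  So multiplication by \<open>xy\<close> lifts to \<open>x\<close> times a chain map, its mapping cone is a minimal resolution
  of \<open>R/I(G)\<close>, and the Betti numbers add up. The same argument with a vertex \<open>x\<close> of a cycle, whose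
  neighbours are \<open>a\<close> and \<open>b\<close>, expresses the cycle by the path \<open>J\<close> without \<open>x\<close> and by the module
  \<open>((a, b) + J) / J\<close>, whose Betti numbers are bounded from above by those of shorter paths.

  The invariant of the induction is that the \<open>j\<close>-strand is empty or an interval that starts at \<open>j\<close>.
  For the cycle of length \<open>n\<close> the upper bounds suffice to keep it: they exceed the strands of \<open>J\<close> by at
  most one, unless \<open>n\<close> is congruent to 2 modulo 3. In order to avoid tensor products for disconnected
  graphs, all statements are proved for the disjoint union with an arbitrary graph that satisfies
  the invariant.\<close>

text \<open>Starting every strand at j makes the invariant stable: intervals with the same left end
  have an interval as union, the cone of an edge moves (i, j) to (i + 1, j + 1), and a Koszul factor
  only moves right ends. Intervals with unrelated left ends could leave gaps in a union. A cycle of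
  length at least four has no edge with N(x) \<subseteq> N[y]. Its module ((a, b) + J) / J is
  filtered by (a) + J, and the glued resolution of the two factors need not be minimal, so only an
  upper bound survives cancellation. That is enough because a position at most one step to the right
  of an interval leaves no gap, whether or not it occurs. The residue enters through paths: a path
  gains a new strand when its number of vertices reaches 2 modulo 3, and the bound compares the
  paths on n - 4 and n - 3 vertices. \<open>betti\<close> is a definite description over all minimal
  resolutions by matrices, so both the existence of one and the independence of the choice have to
  be proved. The constructions use complexes with a basis instead, where direct sums, cones and
  cancellations are operations on sets of numbers.\<close>

abbreviation keys :: "('a \<Rightarrow>\<^sub>0 'b::zero) \<Rightarrow> 'a set" where
  "keys \<equiv> Poly_Mapping.keys"

abbreviation lookup :: "('a \<Rightarrow>\<^sub>0 'b::zero) \<Rightarrow> 'a \<Rightarrow> 'b" where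
  "lookup \<equiv> Poly_Mapping.lookup"

abbreviation single :: "'a \<Rightarrow> 'b \<Rightarrow> ('a \<Rightarrow>\<^sub>0 'b::zero)" where
  "single \<equiv> Poly_Mapping.single"

abbreviation (input) unit :: "nat \<Rightarrow> (nat \<Rightarrow>\<^sub>0 'a::comm_ring_1)" where
  "unit b \<equiv> single b 1"

section \<open>Vectors with entries in a commutative ring\<close>

text \<open>Vectors are finitely supported functions on the natural numbers, so every basis is a set
  of numbers: modules of any rank share one type, and direct sums are unions of disjoint
  bases.\<close>

lift_definition smul :: "'a::comm_ring_1 \<Rightarrow> (nat \<Rightarrow>\<^sub>0 'a) \<Rightarrow> (nat \<Rightarrow>\<^sub>0 'a)" is
  "\<lambda>p u b. p * u b"
  by (erule finite_subset[rotated]) auto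

lemma lookup_smul [simp]: "lookup (smul p u) b = p * lookup u b"
  by transfer simp

lemma keys_smul: "keys (smul p u) \<subseteq> keys u"
  by (auto simp: in_keys_iff)

interpretation smul: Modules.module "smul :: 'a::comm_ring_1 \<Rightarrow> (nat \<Rightarrow>\<^sub>0 'a) \<Rightarrow> _"
  by (unfold_locales; rule poly_mapping_eqI) (simp_all add: lookup_add algebra_simps)

interpretation times: Modules.module "(*) :: 'a::comm_ring_1 \<Rightarrow> 'a \<Rightarrow> 'a"
  by unfold_locales (auto simp: algebra_simps)

declare times.scale_scale [simp del]

interpretation smul2: module_pair "smul :: 'a::comm_ring_1 \<Rightarrow> (nat \<Rightarrow>\<^sub>0 'a) \<Rightarrow> _" smul
  by unfold_locales

interpretation smul1: module_pair "smul :: 'a::comm_ring_1 \<Rightarrow> (nat \<Rightarrow>\<^sub>0 'a) \<Rightarrow> _" "(*)"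
  by unfold_locales

abbreviation lin :: "((nat \<Rightarrow>\<^sub>0 'a::comm_ring_1) \<Rightarrow> (nat \<Rightarrow>\<^sub>0 'a)) \<Rightarrow> bool" where
  "lin \<equiv> Modules.module_hom smul smul"

abbreviation linf :: "((nat \<Rightarrow>\<^sub>0 'a::comm_ring_1) \<Rightarrow> 'a) \<Rightarrow> bool" where
  "linf \<equiv> Modules.module_hom smul (*)"

lemma linI:
  assumes "\<And>u v. f (u + v) = f u + f v" "\<And>p u. f (smul p u) = smul p (f u)"
  shows "lin f"
  using assms by unfold_locales auto

lemma linfI:
  assumes "\<And>u v. f (u + v) = f u + f v" "\<And>p u. f (smul p u) = p * f u"
  shows "linf f"
  using assms by unfold_locales auto

lemma lin_comp: "lin f \<Longrightarrow> lin g \<Longrightarrow> lin (\<lambda>u. f (g u))"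
  by (rule linI) (metis module_hom.add, metis module_hom.scale)

lemma linf_comp: "linf f \<Longrightarrow> lin g \<Longrightarrow> linf (\<lambda>u. f (g u))"
  by (rule linfI) (metis module_hom.add, metis module_hom.scale)

lemma linf_mult: "linf f \<Longrightarrow> linf (\<lambda>u. p * f u)"
  by (rule smul1.module_hom_scale)

lemma lin_smul: "lin f \<Longrightarrow> lin (\<lambda>u. smul p (f u))"
  by (rule smul2.module_hom_scale)

lemma smul_unit: "smul p (unit b) = single b p"
  by (rule poly_mapping_eqI) (simp add: lookup_single when_def)

lemma lookup_sum_single:
  "finite A \<Longrightarrow> lookup (\<Sum>b\<in>A. single b (f b)) c = (if c \<in> A then f c else 0)"
  by (simp add: lookup_sum lookup_single when_def)

lemma unit_expansion:
  "u = (\<Sum>b\<in>keys u. smul (lookup u b) (unit b))"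
  by (rule poly_mapping_eqI) (simp add: smul_unit lookup_sum_single in_keys_iff)

lemma lin_expand:
  assumes "lin f"
  shows "f u = (\<Sum>b\<in>keys u. smul (lookup u b) (f (unit b)))"
  by (rule trans[OF arg_cong[OF unit_expansion]])
    (simp add: module_hom.sum[OF assms] module_hom.scale[OF assms])

lemma linf_expand:
  assumes "linf f"
  shows "f u = (\<Sum>b\<in>keys u. lookup u b * f (unit b))"
  by (rule trans[OF arg_cong[OF unit_expansion]])
    (simp add: module_hom.sum[OF assms] module_hom.scale[OF assms])

lemma lin_eqI:
  assumes "lin f" "lin g" "\<And>b. b \<in> keys u \<Longrightarrow> f (unit b) = g (unit b)"
  shows "f u = g u"
  unfolding lin_expand[OF assms(1), of u] lin_expand[OF assms(2), of u] by (simp add: assms(3))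

definition ext :: "(nat \<Rightarrow> (nat \<Rightarrow>\<^sub>0 'a::comm_ring_1)) \<Rightarrow> (nat \<Rightarrow>\<^sub>0 'a) \<Rightarrow> (nat \<Rightarrow>\<^sub>0 'a)" where
  "ext X u = (\<Sum>b\<in>keys u. smul (lookup u b) (X b))"

lemma ext_superset:
  assumes "finite A" "keys u \<subseteq> A"
  shows "ext X u = (\<Sum>b\<in>A. smul (lookup u b) (X b))"
  unfolding ext_def using assms
  by (intro sum.mono_neutral_left) (auto simp: in_keys_iff)

lemma lin_ext [simp]: "lin (ext X)"
proof (rule linI)
  fix u v :: "nat \<Rightarrow>\<^sub>0 'a"
  let ?A = "keys u \<union> keys v"
  have "keys (u + v) \<subseteq> ?A" by (rule keys_add)
  then show "ext X (u + v) = ext X u + ext X v"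
    by (simp add: ext_superset[of ?A] lookup_add smul.scale_left_distrib sum.distrib)
next
  fix p and u :: "nat \<Rightarrow>\<^sub>0 'a"
  show "ext X (smul p u) = smul p (ext X u)"
    using keys_smul[of p u]
    by (simp add: ext_superset[of "keys u"] smul.scale_sum_right)
qed

lemma ext_unit [simp]: "ext X (unit b) = X b"
  by (simp add: ext_def)

lemma ext_cong: "(\<And>b. b \<in> keys u \<Longrightarrow> X b = Y b) \<Longrightarrow> ext X u = ext Y u"
  by (simp add: ext_def)

text \<open>Defined through \<open>ext\<close> so that linearity is inherited. For disjoint bases it
  is the projection onto a direct summand.\<close>

definition restr :: "nat set \<Rightarrow> (nat \<Rightarrow>\<^sub>0 'a::comm_ring_1) \<Rightarrow> (nat \<Rightarrow>\<^sub>0 'a)" where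
  "restr A = ext (\<lambda>b. if b \<in> A then unit b else 0)"

lemma lin_restr [simp]: "lin (restr A)"
  by (simp add: restr_def)

lemma lookup_restr: "lookup (restr A u) b = (if b \<in> A then lookup u b else 0)"
proof -
  have "restr A u = (\<Sum>b\<in>keys u \<inter> A. single b (lookup u b))"
    unfolding restr_def ext_def by (rule sum.mono_neutral_cong_right) (auto simp: smul_unit)
  then show ?thesis
    by (simp add: smul_unit lookup_sum_single in_keys_iff)
qed

lemma keys_restr: "keys (restr A u) = keys u \<inter> A"
  by (auto simp: in_keys_iff lookup_restr split: if_splits)

lemma restr_id: "keys u \<subseteq> A \<Longrightarrow> restr A u = u"
  by (rule poly_mapping_eqI) (auto simp: lookup_restr in_keys_iff)

lemma restr_0: "keys u \<inter> A = {} \<Longrightarrow> restr A u = 0"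
  by (rule poly_mapping_eqI) (auto simp: lookup_restr in_keys_iff)

lemma restr_split: "A \<inter> C = {} \<Longrightarrow> keys u \<subseteq> A \<union> C \<Longrightarrow> u = restr A u + restr C u"
  by (rule poly_mapping_eqI) (auto simp: lookup_restr lookup_add in_keys_iff)

section \<open>Polynomials\<close>

lemma mon_degree_superset:
  assumes "finite A" "keys m \<subseteq> A"
  shows "mon_degree m = (\<Sum>v\<in>A. lookup m v)"
  unfolding mon_degree_def using assms
  by (intro sum.mono_neutral_left) (auto simp: in_keys_iff)

lemma mon_degree_add: "mon_degree (m + n) = mon_degree m + mon_degree n"
proof -
  let ?A = "keys m \<union> keys n"
  have "keys (m + n) \<subseteq> ?A" by (rule keys_add)
  then show ?thesis
    by (simp add: mon_degree_superset[of ?A] lookup_add sum.distrib)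
qed

lemma mon_degree_0 [simp]: "mon_degree 0 = 0"
  by (simp add: mon_degree_def)

lemma mon_degree_eq_0: "mon_degree m = 0 \<longleftrightarrow> m = 0"
  by (auto simp: mon_degree_def in_keys_iff intro!: poly_mapping_eqI)

lemma mon_degree_single [simp]: "mon_degree (single v n) = n"
  by (simp add: mon_degree_def)

lemma keys_add_nat:
  fixes m n :: "'v \<Rightarrow>\<^sub>0 nat"
  shows "keys (m + n) = keys m \<union> keys n"
  by (auto simp: in_keys_iff lookup_add)

lemma keys_minus_subset:
  fixes p q :: "'a \<Rightarrow>\<^sub>0 'k::ab_group_add"
  shows "keys (p - q) \<subseteq> keys p \<union> keys q"
  by (auto simp: in_keys_iff lookup_minus)

lemma polys_0 [simp]: "0 \<in> polys V"
  by (simp add: polys_def)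

lemma polys_1 [simp]: "(1 :: ('v, 'k::comm_ring_1) mpoly) \<in> polys V"
  by (simp add: polys_def)

lemma polys_add: "p \<in> polys V \<Longrightarrow> q \<in> polys V \<Longrightarrow> (p + q :: ('v, 'k::comm_ring_1) mpoly) \<in> polys V"
  using keys_add[of p q] by (auto simp: polys_def)

lemma polys_minus: "p \<in> polys V \<Longrightarrow> q \<in> polys V \<Longrightarrow> (p - q :: ('v, 'k::comm_ring_1) mpoly) \<in> polys V"
  using keys_minus_subset[of p q] by (auto simp: polys_def)

lemma polys_uminus: "p \<in> polys V \<Longrightarrow> (- p :: ('v, 'k::comm_ring_1) mpoly) \<in> polys V"
  using polys_minus[of 0 V p] by simp

lemma polys_mult: 
  fixes p q :: "('v, 'k::comm_ring_1) mpoly"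
  assumes "p \<in> polys V" "q \<in> polys V" 
  shows "p * q \<in> polys V"
  unfolding polys_def
proof safe
  fix m v assume "m \<in> keys (p * q)" "v \<in> keys m"
  then obtain a b where "a \<in> keys p" "b \<in> keys q" "m = a + b"
    using keys_mult[of p q] by blast
  with \<open>v \<in> _\<close> assms show "v \<in> V" by (auto simp: polys_def keys_add_nat)
qed

lemma polys_sum: "(\<And>x. x \<in> A \<Longrightarrow> f x \<in> polys V) \<Longrightarrow> (sum f A :: ('v, 'k::comm_ring_1) mpoly) \<in> polys V"
  by (induction A rule: infinite_finite_induct) (auto intro: polys_add)

definition homog :: "nat \<Rightarrow> ('v, 'k::zero) mpoly \<Rightarrow> bool" where
  "homog n p \<longleftrightarrow> (\<forall>m\<in>keys p. mon_degree m = n)"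

lemma homog_0 [simp]: "homog n 0"
  by (simp add: homog_def)

lemma homog_1 [simp]: "homog 0 (1 :: ('v, 'k::comm_ring_1) mpoly)"
  by (simp add: homog_def)

lemma homog_add: "homog n p \<Longrightarrow> homog n q \<Longrightarrow> homog n (p + q)"
  using keys_add[of p q] by (auto simp: homog_def)

lemma homog_minus: "homog n p \<Longrightarrow> homog n q \<Longrightarrow> homog n (p - q :: ('v, 'k::comm_ring_1) mpoly)"
  using keys_minus_subset[of p q] by (auto simp: homog_def)

lemma homog_mult:
  fixes p q :: "('v, 'k::comm_ring_1) mpoly"
  assumes "homog m p" "homog n q"
  shows "homog (m + n) (p * q)"
  using assms keys_mult[of p q] by (fastforce simp: homog_def mon_degree_add)

lemma homog_sum: "(\<And>x. x \<in> A \<Longrightarrow> homog n (f x)) \<Longrightarrow> homog n (sum f A)"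
  by (induction A rule: infinite_finite_induct) (auto intro: homog_add)

lift_definition hcomp :: "nat \<Rightarrow> ('v, 'k::comm_ring_1) mpoly \<Rightarrow> ('v, 'k) mpoly" is
  "\<lambda>n p m. if mon_degree m = n then p m else 0"
  by (erule finite_subset[rotated]) auto

lemma lookup_hcomp: "lookup (hcomp n p) m = (if mon_degree m = n then lookup p m else 0)"
  by transfer simp

lemma keys_hcomp: "keys (hcomp n p) = {m \<in> keys p. mon_degree m = n}"
  by (auto simp: in_keys_iff lookup_hcomp split: if_splits)

lemma hcomp_polys: "p \<in> polys V \<Longrightarrow> hcomp n p \<in> polys V"
  by (auto simp: polys_def keys_hcomp)

lemma homog_hcomp [simp]: "homog n (hcomp n p)"
  by (auto simp: homog_def keys_hcomp)

lemma hcomp_homog: "homog m p \<Longrightarrow> hcomp n p = (if m = n then p else 0)"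
  by (auto intro!: poly_mapping_eqI simp: lookup_hcomp homog_def in_keys_iff)

lemma hcomp_add: "hcomp n (p + q) = hcomp n p + hcomp n q"
  by (auto intro!: poly_mapping_eqI simp: lookup_hcomp lookup_add)

lemma hcomp_minus: "hcomp n (p - q) = hcomp n p - hcomp n q"
  by (auto intro!: poly_mapping_eqI simp: lookup_hcomp lookup_minus)

lemma hcomp_0 [simp]: "hcomp n 0 = 0"
  by (auto intro!: poly_mapping_eqI simp: lookup_hcomp)

lemma hcomp_mult_homog:
  fixes p q :: "('v, 'k::comm_ring_1) mpoly"
  assumes "homog k p"
  shows "hcomp n (q * p) = (if k \<le> n then hcomp (n - k) q * p else 0)"
proof (cases "k \<le> n")
  case True
  \<comment> \<open>\<open>?r\<close> has no part of degree \<open>n - k\<close>, so its product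
    with the homogeneous \<open>p\<close> has no part of degree \<open>n\<close>.\<close>
  let ?r = "q - hcomp (n - k) q"
  have "hcomp n (?r * p) = 0"
  proof (rule poly_mapping_eqI)
    fix m
    show "lookup (hcomp n (?r * p)) m = lookup 0 m"
    proof (rule ccontr)
      assume "\<not> ?thesis"
      then have "mon_degree m = n" "m \<in> keys (?r * p)"
        by (auto simp: lookup_hcomp in_keys_iff split: if_splits)
      then obtain a b where "a \<in> keys ?r" "b \<in> keys p" "m = a + b"
        using keys_mult[of ?r p] by blast
      moreover from this have "mon_degree a \<noteq> n - k"
        by (auto simp: in_keys_iff lookup_minus lookup_hcomp)
      ultimately show False using \<open>mon_degree m = n\<close> assms by (auto simp: homog_def mon_degree_add)
    qed
  qed
  moreover have "hcomp n (hcomp (n - k) q * p) = hcomp (n - k) q * p"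
    using homog_mult[OF homog_hcomp[of "n-k" q] assms] True by (simp add: hcomp_homog[of n])
  moreover have "q * p = ?r * p + hcomp (n - k) q * p" by (simp add: algebra_simps)
  ultimately show ?thesis using True by (metis hcomp_add add_0)
next
  case False
  have "hcomp n (q * p) = 0"
  proof (rule poly_mapping_eqI)
    fix m
    show "lookup (hcomp n (q * p)) m = lookup 0 m"
    proof (rule ccontr)
      assume "\<not> ?thesis"
      then have "mon_degree m = n" "m \<in> keys (q * p)"
        by (auto simp: lookup_hcomp in_keys_iff split: if_splits)
      then obtain a b where "a \<in> keys q" "b \<in> keys p" "m = a + b"
        using keys_mult[of q p] by blast
      then show False using \<open>mon_degree m = n\<close> assms False by (auto simp: homog_def mon_degree_add)
    qed
  qed
  with False show ?thesis by simp
qed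

text \<open>Exponents are natural numbers, so a product reaches exponent 0 only from constant terms.
  Taking constant terms is therefore a ring homomorphism, the reduction modulo the variables in
  which minimality and uniqueness are tested.\<close>

lemma mpoly_lookup_mult_0:
  fixes p q :: "('v, 'k::comm_ring_1) mpoly"
  shows "lookup (p * q) 0 = lookup p 0 * lookup q 0"
proof -
  have eq: "(0 = k + l) \<longleftrightarrow> k = 0 \<and> l = 0" for k l :: "'v \<Rightarrow>\<^sub>0 nat"
    by (metis add_is_0 add.right_neutral lookup_add lookup_zero poly_mapping_eqI)
  have "lookup (p * q) 0 =
      (\<Sum>l. lookup p l * (\<Sum>r. lookup q r when 0 = l + r))"
    by (simp add: lookup_mult)
  also have "\<dots> = (\<Sum>l. lookup p l * lookup q 0 when l = 0)"
  proof (rule Sum_any.cong)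
    fix l :: "'v \<Rightarrow>\<^sub>0 nat"
    show "lookup p l * (\<Sum>r. lookup q r when 0 = l + r) =
      (lookup p l * lookup q 0 when l = 0)"
      by (cases "l = 0") (auto simp: eq)
  qed
  finally show ?thesis by simp
qed

definition hideal :: "'v set \<Rightarrow> ('v, 'k::comm_ring_1) mpoly set \<Rightarrow> bool" where
  "hideal V J \<longleftrightarrow> J \<subseteq> polys V \<and> 0 \<in> J \<and> (\<forall>p\<in>J. \<forall>q\<in>J. p + q \<in> J) \<and>
     (\<forall>p\<in>polys V. \<forall>q\<in>J. p * q \<in> J) \<and> (\<forall>p\<in>J. \<forall>n. hcomp n p \<in> J)"

lemma hidealD:
  assumes "hideal V J"
  shows "p \<in> J \<Longrightarrow> p \<in> polys V" "0 \<in> J" "p \<in> J \<Longrightarrow> q \<in> J \<Longrightarrow> p + q \<in> J"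
    "r \<in> polys V \<Longrightarrow> p \<in> J \<Longrightarrow> r * p \<in> J" "p \<in> J \<Longrightarrow> hcomp n p \<in> J"
  using assms by (auto simp: hideal_def)

lemma hideal_uminus: "hideal V J \<Longrightarrow> p \<in> J \<Longrightarrow> - p \<in> J"
  using hidealD(4)[of V J "-1" p] by (simp add: polys_uminus)

lemma hideal_minus: "hideal V J \<Longrightarrow> p \<in> J \<Longrightarrow> q \<in> J \<Longrightarrow> p - q \<in> J"
  using hidealD(3)[of V J p "-q"] hideal_uminus by auto

lemma hideal_sum: "hideal V J \<Longrightarrow> (\<And>x. x \<in> A \<Longrightarrow> f x \<in> J) \<Longrightarrow> sum f A \<in> J"
  by (induction A rule: infinite_finite_induct) (auto simp: hidealD)

lemma hideal_polys: "hideal V (polys V)"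
  by (auto simp: hideal_def polys_add polys_mult hcomp_polys)

section \<open>Graded free modules\<close>

definition Fr :: "'v set \<Rightarrow> nat set \<Rightarrow> (nat \<Rightarrow>\<^sub>0 ('v, 'k::comm_ring_1) mpoly) set" where
  "Fr V B = {u. keys u \<subseteq> B \<and> (\<forall>b. lookup u b \<in> polys V)}"

lemma Fr_0 [simp]: "0 \<in> Fr V B"
  by (simp add: Fr_def)

lemma Fr_add: "u \<in> Fr V B \<Longrightarrow> v \<in> Fr V B \<Longrightarrow> u + v \<in> Fr V B"
  using keys_add[of u v] by (auto simp: Fr_def lookup_add polys_add)

lemma Fr_minus: "u \<in> Fr V B \<Longrightarrow> v \<in> Fr V B \<Longrightarrow> u - v \<in> Fr V B"
  using keys_minus_subset[of u v] by (auto simp: Fr_def lookup_minus polys_minus)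

lemma Fr_smul: "p \<in> polys V \<Longrightarrow> u \<in> Fr V B \<Longrightarrow> smul p u \<in> Fr V B"
  using keys_smul[of p u] by (auto simp: Fr_def polys_mult)

lemma Fr_sum: "(\<And>x. x \<in> A \<Longrightarrow> f x \<in> Fr V B) \<Longrightarrow> sum f A \<in> Fr V B"
  by (induction A rule: infinite_finite_induct) (auto intro: Fr_add)

lemma Fr_unit: "b \<in> B \<Longrightarrow> unit b \<in> Fr V B"
  by (auto simp: Fr_def lookup_single when_def)

lemma Fr_restr: "u \<in> Fr V B \<Longrightarrow> restr A u \<in> Fr V (B \<inter> A)"
  by (auto simp: Fr_def keys_restr lookup_restr)

lemma Fr_mono: "u \<in> Fr V A \<Longrightarrow> A \<subseteq> B \<Longrightarrow> u \<in> Fr V B"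
  by (auto simp: Fr_def)

lemma Fr_lin:
  assumes "lin f" "u \<in> Fr V B" "\<And>b. b \<in> B \<Longrightarrow> f (unit b) \<in> Fr V C"
  shows "f u \<in> Fr V C"
  unfolding lin_expand[OF assms(1), of u]
  using assms by (intro Fr_sum Fr_smul) (auto simp: Fr_def)

lemma hideal_linf:
  assumes "linf f" "hideal V J" "u \<in> Fr V B" "\<And>b. b \<in> B \<Longrightarrow> f (unit b) \<in> J"
  shows "f u \<in> J"
  unfolding linf_expand[OF assms(1), of u]
  using assms by (intro hideal_sum[OF assms(2)] hidealD(4)[OF assms(2)]) (auto simp: Fr_def)

lemma lin_eqI_Fr:
  assumes "lin f" "lin g" "u \<in> Fr V B" "\<And>b. b \<in> B \<Longrightarrow> f (unit b) = g (unit b)"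
  shows "f u = g u"
  by (rule lin_eqI[OF assms(1,2)]) (use assms(3,4) in \<open>auto simp: Fr_def\<close>)

text \<open>Levels are integers so that \<open>lv b - 1\<close> makes sense at level 0, where it
  forces the differential to vanish. The bound \<open>dg b \<le> n\<close> guards the truncated
  subtraction: otherwise constants would be allowed on basis elements of degree above
  \<open>n\<close>.\<close>

definition Hm :: "'v set \<Rightarrow> nat set \<Rightarrow> (nat \<Rightarrow> int) \<Rightarrow> (nat \<Rightarrow> nat) \<Rightarrow> int \<Rightarrow> nat \<Rightarrow>
    (nat \<Rightarrow>\<^sub>0 ('v, 'k::comm_ring_1) mpoly) set" where
  "Hm V B lv dg i n = {u \<in> Fr V B. \<forall>b\<in>keys u. lv b = i \<and> dg b \<le> n \<and>
      homog (n - dg b) (lookup u b)}"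

lemma Hm_Fr: "u \<in> Hm V B lv dg i n \<Longrightarrow> u \<in> Fr V B"
  by (simp add: Hm_def)

lemma Hm_0 [simp]: "0 \<in> Hm V B lv dg i n"
  by (simp add: Hm_def)

lemma Hm_homog: "u \<in> Hm V B lv dg i n \<Longrightarrow> homog (n - dg b) (lookup u b)"
  by (cases "b \<in> keys u") (auto simp: Hm_def in_keys_iff)

lemma Hm_add:
  assumes "u \<in> Hm V B lv dg i n" "v \<in> Hm V B lv dg i n"
  shows "u + v \<in> Hm V B lv dg i n"
proof -
  have "homog (n - dg b) (lookup (u + v) b)" for b
    using Hm_homog[OF assms(1)] Hm_homog[OF assms(2)] by (simp add: lookup_add homog_add)
  with assms keys_add[of u v] show ?thesis
    by (auto simp: Hm_def Fr_add)
qed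

lemma Hm_minus:
  assumes "u \<in> Hm V B lv dg i n" "v \<in> Hm V B lv dg i n"
  shows "u - v \<in> Hm V B lv dg i n"
proof -
  have "homog (n - dg b) (lookup (u - v) b)" for b
    using Hm_homog[OF assms(1)] Hm_homog[OF assms(2)] by (simp add: lookup_minus homog_minus)
  with assms keys_minus_subset[of u v] show ?thesis
    by (auto simp: Hm_def Fr_minus)
qed

lemma Hm_uminus: "u \<in> Hm V B lv dg i n \<Longrightarrow> - u \<in> Hm V B lv dg i n"
  using Hm_minus[of 0 V B lv dg i n u] by simp

lemma Hm_sum: "(\<And>x. x \<in> A \<Longrightarrow> f x \<in> Hm V B lv dg i n) \<Longrightarrow> sum f A \<in> Hm V B lv dg i n"
  by (induction A rule: infinite_finite_induct) (auto intro: Hm_add)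

lemma Hm_smul:
  assumes "p \<in> polys V" "homog k p" "u \<in> Hm V B lv dg i n"
  shows "smul p u \<in> Hm V B lv dg i (n + k)"
proof -
  have "homog (n + k - dg b) (p * lookup u b)" if "b \<in> keys u" for b
  proof -
    have "n + k - dg b = k + (n - dg b)" using that assms by (auto simp: Hm_def)
    then show ?thesis using homog_mult[OF assms(2) Hm_homog[OF assms(3), of b]] by simp
  qed
  then show ?thesis using assms keys_smul[of p u]
    by (auto simp: Hm_def Fr_smul intro: trans_le_add1)
qed

lemma Hm_unit: "b \<in> B \<Longrightarrow> unit b \<in> Hm V B lv dg (lv b) (dg b)"
  by (auto simp: Hm_def Fr_unit)

lemma Hm_lin:
  assumes "lin f" "u \<in> Hm V B lv dg i n"
    "\<And>b. b \<in> B \<Longrightarrow> f (unit b) \<in> Hm V C lv' dg' (lv b + k) (dg b)"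
  shows "f u \<in> Hm V C lv' dg' (i + k) n"
  unfolding lin_expand[OF assms(1), of u]
proof (intro Hm_sum)
  fix b assume b: "b \<in> keys u"
  with assms(2) have *: "b \<in> B" "lv b = i" "dg b \<le> n" "lookup u b \<in> polys V"
    "homog (n - dg b) (lookup u b)" 
    by (auto simp: Hm_def Fr_def)
  show "smul (lookup u b) (f (unit b)) \<in> Hm V C lv' dg' (i + k) n"
    using Hm_smul[OF *(4,5) assms(3)[OF *(1)]] * by simp
qed

definition proj :: "(nat \<Rightarrow> int) \<Rightarrow> (nat \<Rightarrow> nat) \<Rightarrow> int \<Rightarrow> nat \<Rightarrow>
    (nat \<Rightarrow>\<^sub>0 ('v, 'k::comm_ring_1) mpoly) \<Rightarrow> (nat \<Rightarrow>\<^sub>0 ('v, 'k) mpoly)" where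
  "proj lv dg i n u = (\<Sum>b\<in>keys u. single b
     (if lv b = i \<and> dg b \<le> n then hcomp (n - dg b) (lookup u b) else 0))"

lemma lookup_proj: "lookup (proj lv dg i n u) b =
    (if lv b = i \<and> dg b \<le> n then hcomp (n - dg b) (lookup u b) else 0)"
  by (simp add: proj_def lookup_sum_single in_keys_iff)

lemma proj_add: "proj lv dg i n (u + v) = proj lv dg i n u + proj lv dg i n v"
  by (auto intro!: poly_mapping_eqI simp: lookup_proj lookup_add hcomp_add)

lemma proj_0 [simp]: "proj lv dg i n 0 = 0"
  by (auto intro!: poly_mapping_eqI simp: lookup_proj)

lemma proj_sum: "proj lv dg i n (sum f A) = (\<Sum>x\<in>A. proj lv dg i n (f x))"
  by (induction A rule: infinite_finite_induct) (auto simp: proj_add)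

lemma proj_Hm:
  assumes "u \<in> Fr V B"
  shows "proj lv dg i n u \<in> Hm V B lv dg i n"
proof -
  have "keys (proj lv dg i n u) \<subseteq> keys u"
    by (auto simp: in_keys_iff lookup_proj split: if_splits)
  with assms show ?thesis
    by (auto simp: Hm_def Fr_def in_keys_iff lookup_proj hcomp_polys split: if_splits)
qed

lemma proj_smul_Hm:
  assumes "u \<in> Hm V B lv dg j k"
  shows "proj lv dg i n (smul p u) = (if i = j \<and> k \<le> n then smul (hcomp (n - k) p) u else 0)"
proof (rule poly_mapping_eqI)
  fix b
  show "lookup (proj lv dg i n (smul p u)) b =
    lookup (if i = j \<and> k \<le> n then smul (hcomp (n - k) p) u else 0) b"
  proof (cases "b \<in> keys u")
    case True
    with assms have *: "lv b = j" "dg b \<le> k" "homog (k - dg b) (lookup u b)"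
      by (auto simp: Hm_def)
    from * show ?thesis
      by (auto simp: lookup_proj hcomp_mult_homog[OF *(3)])
  qed (auto simp: lookup_proj in_keys_iff)
qed

lemma proj_id: "u \<in> Hm V B lv dg i n \<Longrightarrow> proj lv dg i n u = u"
  using proj_smul_Hm[of u V B lv dg i n i n 1] by (simp add: hcomp_homog[of 0])

text \<open>A map that is homogeneous on the basis commutes with the projections. Hence any preimage
  can be projected to a homogeneous one, and exactness may be stated for all vectors at
  once.\<close>

lemma proj_lin:
  assumes "lin f" "u \<in> Fr V B"
    "\<And>b. b \<in> B \<Longrightarrow> f (unit b) \<in> Hm V C lv' dg' (lv b + k) (dg b)"
  shows "f (proj lv dg i n u) = proj lv' dg' (i + k) n (f u)"
proof -
  have "f (proj lv dg i n u) = (\<Sum>b\<in>keys u. f (proj lv dg i n (smul (lookup u b) (unit b))))"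
    unfolding module_hom.sum[OF assms(1), symmetric] proj_sum[symmetric]
    by (rule arg_cong[where f="\<lambda>w. f (proj lv dg i n w)", OF unit_expansion])
  also have "\<dots> = (\<Sum>b\<in>keys u. proj lv' dg' (i + k) n (smul (lookup u b) (f (unit b))))"
  proof (rule sum.cong)
    fix b assume "b \<in> keys u"
    then have b: "b \<in> B" using assms by (auto simp: Fr_def)
    show "f (proj lv dg i n (smul (lookup u b) (unit b))) =
      proj lv' dg' (i + k) n (smul (lookup u b) (f (unit b)))"
      by (simp add: proj_smul_Hm[OF assms(3)[OF b]] proj_smul_Hm[OF Hm_unit[OF b]]
         module_hom.scale[OF assms(1)] module_hom.zero[OF assms(1)])
  qed simp
  also have "\<dots> = proj lv' dg' (i + k) n (f u)"
    unfolding lin_expand[OF assms(1), of u] proj_sum ..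
  finally show ?thesis .
qed

lemma hcomp_sum: "hcomp n (sum f A) = (\<Sum>x\<in>A. hcomp n (f x))"
  by (induction A rule: infinite_finite_induct) (auto simp: hcomp_add)

lemma proj_linf:
  assumes "linf f" "u \<in> Fr V B"
    "\<And>b. b \<in> B \<Longrightarrow> homog (dg b) (f (unit b))" "\<And>b. b \<in> B \<Longrightarrow> lv b \<noteq> i \<Longrightarrow> f (unit b) = 0"
  shows "f (proj lv dg i n u) = hcomp n (f u)"
proof -
  have "f (proj lv dg i n u) = (\<Sum>b\<in>keys u. f (proj lv dg i n (smul (lookup u b) (unit b))))"
    unfolding module_hom.sum[OF assms(1), symmetric] proj_sum[symmetric]
    by (rule arg_cong[where f="\<lambda>w. f (proj lv dg i n w)", OF unit_expansion])
  also have "\<dots> = (\<Sum>b\<in>keys u. hcomp n (lookup u b * f (unit b)))"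
  proof (rule sum.cong)
    fix b assume "b \<in> keys u"
    then have b: "b \<in> B" using assms by (auto simp: Fr_def)
    show "f (proj lv dg i n (smul (lookup u b) (unit b))) =
      hcomp n (lookup u b * f (unit b))"
      using assms(4)[OF b]
      by (auto simp: proj_smul_Hm[OF Hm_unit[OF b]] hcomp_mult_homog[OF assms(3)[OF b]]
         module_hom.scale[OF assms(1)] module_hom.zero[OF assms(1)])
  qed simp
  also have "\<dots> = hcomp n (f u)"
    unfolding linf_expand[OF assms(1), of u] hcomp_sum ..
  finally show ?thesis .
qed

section \<open>Graded free resolutions of subquotients of the polynomial ring\<close>

text \<open>A resolution of the module \<open>T / J\<close> is encoded by its total complex: \<open>B\<close> is the union of the
  bases, \<open>lv\<close> and \<open>dg\<close> are the homological and the internal degree, and \<open>d\<close> is the sum of all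
  differentials. The augmentation \<open>e\<close> takes values in the polynomial ring instead of \<open>T / J\<close>, so the
  condition \<open>e u \<in> J\<close> expresses exactness in homological degree 0 and is void in the others.\<close>

locale gres =
  fixes V :: "'v set" and T J :: "('v, 'k::field) mpoly set"
    and B :: "nat set" and lv :: "nat \<Rightarrow> int" and dg :: "nat \<Rightarrow> nat"
    and d :: "(nat \<Rightarrow>\<^sub>0 ('v, 'k) mpoly) \<Rightarrow> (nat \<Rightarrow>\<^sub>0 ('v, 'k) mpoly)"
    and e :: "(nat \<Rightarrow>\<^sub>0 ('v, 'k) mpoly) \<Rightarrow> ('v, 'k) mpoly"
  assumes hT: "hideal V T" and hJ: "hideal V J" and JT: "J \<subseteq> T"
    and lin_d: "lin d" and linf_e: "linf e"
    and lv_nonneg: "b \<in> B \<Longrightarrow> 0 \<le> lv b"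
    and d_unit: "b \<in> B \<Longrightarrow> d (unit b) \<in> Hm V B lv dg (lv b - 1) (dg b)"
    and e_unit: "b \<in> B \<Longrightarrow> e (unit b) \<in> T" "b \<in> B \<Longrightarrow> homog (dg b) (e (unit b))"
      "b \<in> B \<Longrightarrow> lv b \<noteq> 0 \<Longrightarrow> e (unit b) = 0"
    and dd_unit: "b \<in> B \<Longrightarrow> d (d (unit b)) = 0"
    and ed_unit: "b \<in> B \<Longrightarrow> e (d (unit b)) \<in> J"
    and exact: "u \<in> Fr V B \<Longrightarrow> d u = 0 \<Longrightarrow> e u \<in> J \<Longrightarrow> \<exists>v\<in>Fr V B. u = d v"
    and onto: "t \<in> T \<Longrightarrow> \<exists>u\<in>Fr V B. t - e u \<in> J"
begin

lemma d_Fr: "u \<in> Fr V B \<Longrightarrow> d u \<in> Fr V B"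
  by (rule Fr_lin[OF lin_d]) (auto intro: Hm_Fr[OF d_unit])

lemma dd: "u \<in> Fr V B \<Longrightarrow> d (d u) = 0"
  by (rule lin_eqI_Fr[OF lin_comp[OF lin_d lin_d] smul2.module_hom_zero, of u V B])
    (auto simp: dd_unit)

lemma ed: "u \<in> Fr V B \<Longrightarrow> e (d u) \<in> J"
  by (rule hideal_linf[OF linf_comp[OF linf_e lin_d] hJ]) (auto simp: ed_unit)

lemma e_T: "u \<in> Fr V B \<Longrightarrow> e u \<in> T"
  by (rule hideal_linf[OF linf_e hT]) (auto simp: e_unit)

lemma d_Hm: "u \<in> Hm V B lv dg i n \<Longrightarrow> d u \<in> Hm V B lv dg (i - 1) n"
  unfolding diff_conv_add_uminus
  by (rule Hm_lin[OF lin_d]) (auto dest: d_unit)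

lemma Hm_neg: "i < 0 \<Longrightarrow> u \<in> Hm V B lv dg i n \<Longrightarrow> u = 0"
proof -
  assume "i < 0" "u \<in> Hm V B lv dg i n"
  then have "b \<notin> keys u" for b using lv_nonneg[of b] by (auto simp: Hm_def Fr_def)
  then show "u = 0" using keys_eq_empty by blast
qed

lemma e_Hm: "i \<noteq> 0 \<Longrightarrow> u \<in> Hm V B lv dg i n \<Longrightarrow> e u = 0"
  unfolding linf_expand[OF linf_e, of u]
  by (rule sum.neutral) (auto simp: Hm_def Fr_def e_unit)

lemma d_proj: "u \<in> Fr V B \<Longrightarrow> d (proj lv dg i n u) = proj lv dg (i - 1) n (d u)"
  unfolding diff_conv_add_uminus
  by (rule proj_lin[OF lin_d]) (auto dest: d_unit)

lemma e_proj: "u \<in> Fr V B \<Longrightarrow> e (proj lv dg 0 n u) = hcomp n (e u)"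
  by (rule proj_linf[OF linf_e]) (auto simp: e_unit)

text \<open>The single extension step behind \<open>lift\<close>. At level 0 the prescribed boundary
  \<open>w\<close> is zero, as there is no level -1, and surjectivity onto T / J supplies the value;
  at other levels \<open>t\<close> is zero and exactness supplies a preimage. Projection makes
  either choice homogeneous.\<close>

lemma homogeneous_preimage:
  assumes w: "w \<in> Hm V B lv dg (i - 1) n" "d w = 0" "e w \<in> J"
    and t: "t \<in> T" "homog n t" "i \<noteq> 0 \<Longrightarrow> t = 0"
  shows "\<exists>v\<in>Hm V B lv dg i n. d v = w \<and> e v - t \<in> J"
proof (cases "i = 0")
  case True
  have "w = 0" using Hm_neg[OF _ w(1)] True by simp
  obtain u where u: "u \<in> Fr V B" "t - e u \<in> J" using onto[OF t(1)] by blast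
  let ?v = "proj lv dg 0 n u"
  have v: "?v \<in> Hm V B lv dg 0 n" by (rule proj_Hm[OF u(1)])
  have "d ?v = 0" using Hm_neg[OF _ d_Hm[OF v]] by simp
  moreover have "e ?v - t \<in> J"
  proof -
    have "hcomp n (t - e u) \<in> J" by (rule hidealD(5)[OF hJ u(2)])
    then have "t - e ?v \<in> J" using t(2) by (simp add: hcomp_minus e_proj[OF u(1)] hcomp_homog)
    from hideal_uminus[OF hJ this] show ?thesis by simp
  qed
  ultimately show ?thesis using v True \<open>w = 0\<close> by blast
next
  case False
  obtain v where v: "v \<in> Fr V B" "w = d v" using exact[OF Hm_Fr[OF w(1)] w(2,3)] by blast
  let ?v = "proj lv dg i n v"
  have v': "?v \<in> Hm V B lv dg i n" by (rule proj_Hm[OF v(1)])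
  have "d ?v = w" using d_proj[OF v(1)] v(2) proj_id[OF w(1)] by simp
  then show ?thesis using v' e_Hm[OF False v'] t(3)[OF False] hidealD(2)[OF hJ] by auto
qed

text \<open>One principle for all choices on the level of complexes: comparison maps (\<alpha> is
  zero), the connecting map of an extension (levels lowered by one, hence the bound -1) and
  homotopies (levels raised by one, \<beta> is zero). The conditions \<open>c1\<close> and
  \<open>c2\<close> make \<alpha> b + \<theta> (d'' b) a cycle with augmentation in J, so that it
  can be lifted.\<close>

lemma lift:
  assumes lin: "lin d''" "lin \<alpha>" "linf \<beta>"
    and lv': "\<And>b. b \<in> B' \<Longrightarrow> -1 \<le> lv' b"
    and d'': "\<And>b. b \<in> B' \<Longrightarrow> d'' (unit b) \<in> Hm V B' lv' dg' (lv' b - 1) (dg' b)"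
      "\<And>b. b \<in> B' \<Longrightarrow> d'' (d'' (unit b)) = 0"
    and \<alpha>: "\<And>b. b \<in> B' \<Longrightarrow> \<alpha> (unit b) \<in> Hm V B lv dg (lv' b - 1) (dg' b)"
    and \<beta>: "\<And>b. b \<in> B' \<Longrightarrow> \<beta> (unit b) \<in> T" "\<And>b. b \<in> B' \<Longrightarrow> homog (dg' b) (\<beta> (unit b))"
      "\<And>b. b \<in> B' \<Longrightarrow> lv' b \<noteq> 0 \<Longrightarrow> \<beta> (unit b) = 0"
    and c1: "\<And>b. b \<in> B' \<Longrightarrow> d (\<alpha> (unit b)) + \<alpha> (d'' (unit b)) = 0"
    and c2: "\<And>b. b \<in> B' \<Longrightarrow> e (\<alpha> (unit b)) + \<beta> (d'' (unit b)) \<in> J"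
  obtains \<theta> where "lin \<theta>"
    "\<And>b. b \<in> B' \<Longrightarrow> \<theta> (unit b) \<in> Hm V B lv dg (lv' b) (dg' b)"
    "\<And>u. u \<in> Fr V B' \<Longrightarrow> d (\<theta> u) = \<alpha> u + \<theta> (d'' u)"
    "\<And>u. u \<in> Fr V B' \<Longrightarrow> e (\<theta> u) - \<beta> u \<in> J"
proof -
  define P where "P f b v \<longleftrightarrow> (b \<in> B' \<longrightarrow> v \<in> Hm V B lv dg (lv' b) (dg' b) \<and>
      d v = \<alpha> (unit b) + ext f (d'' (unit b)) \<and> e v - \<beta> (unit b) \<in> J)" for f b v
  \<comment> \<open>\<open>d''\<close> lowers the level by one and no level is below -1, so after
    adding 1 the truncation \<open>nat\<close> still decreases strictly along the support of
    \<open>d''\<close>.\<close>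
  let ?R = "measure (\<lambda>b. nat (lv' b + 1))"
  have keys: "c \<in> B'" "lv' c = lv' b - 1" "dg' c \<le> dg' b"
    if "b \<in> B'" "c \<in> keys (d'' (unit b))" for b c
    using d''(1)[OF that(1)] that(2) by (auto simp: Hm_def Fr_def)
  have R: "(c, b) \<in> ?R" if "b \<in> B'" "c \<in> keys (d'' (unit b))" for b c
    using keys(2)[OF that] lv'[OF that(1)] lv'[OF keys(1)[OF that]] by simp
  have lins: "lin (\<lambda>u. \<alpha> u + ext f (d'' u))" for f
    by (intro smul2.module_hom_add lin lin_comp[OF lin_ext])
  have lins2: "linf (\<lambda>u. e (ext f u) - \<beta> u)" for f
    by (intro smul1.module_hom_sub lin linf_comp[OF linf_e lin_ext])
  \<comment> \<open>Recursion with choice: the value at \<open>b\<close> depends only on the values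
    already chosen on the support of \<open>d'' (unit b)\<close>.\<close>
  have "\<exists>f. \<forall>b. P f b (f b)"
  proof (rule dependent_wf_choice[of ?R])
    fix f g :: "nat \<Rightarrow> nat \<Rightarrow>\<^sub>0 ('v, 'k) mpoly" and b v
    assume *: "\<And>c. (c, b) \<in> ?R \<Longrightarrow> f c = g c"
    show "P f b v = P g b v"
    proof (cases "b \<in> B'")
      case True
      have "ext f (d'' (unit b)) = ext g (d'' (unit b))"
        by (rule ext_cong) (use * R[OF True] in blast)
      then show ?thesis by (simp add: P_def)
    qed (simp add: P_def)
  next
    fix b and f :: "nat \<Rightarrow> nat \<Rightarrow>\<^sub>0 ('v, 'k) mpoly"
    assume IH: "\<And>c. (c, b) \<in> ?R \<Longrightarrow> P f c (f c)"
    show "\<exists>v. P f b v"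
    proof (cases "b \<in> B'")
      case b: True
      let ?x = "d'' (unit b)"
      let ?C = "keys ?x"
      have C: "f c \<in> Hm V B lv dg (lv' c) (dg' c)" "d (f c) = \<alpha> (unit c) + ext f (d'' (unit c))"
        "e (f c) - \<beta> (unit c) \<in> J" if "c \<in> ?C" for c
        using IH[OF R[OF b that]] keys(1)[OF b that] by (auto simp: P_def)
      have x: "?x \<in> Fr V ?C" using Hm_Fr[OF d''(1)[OF b]] by (auto simp: Fr_def)
      have xH: "?x \<in> Hm V ?C lv' dg' (lv' b - 1) (dg' b)"
        using d''(1)[OF b] by (auto simp: Hm_def Fr_def)
      let ?w = "\<alpha> (unit b) + ext f ?x"
      have "ext f ?x \<in> Hm V B lv dg (lv' b - 1 + 0) (dg' b)"
        by (rule Hm_lin[OF lin_ext xH]) (use C(1) in simp)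
      then have w1: "?w \<in> Hm V B lv dg (lv' b - 1) (dg' b)"
        by (intro Hm_add \<alpha>[OF b]) simp
      have "d (ext f ?x) = \<alpha> ?x + ext f (d'' ?x)"
        by (rule lin_eqI_Fr[OF lin_comp[OF lin_d lin_ext] lins x]) (use C(2) in simp)
      also have "ext f (d'' ?x) = 0"
        using d''(2)[OF b] by (simp add: module_hom.zero[OF lin_ext])
      finally have "d ?w = d (\<alpha> (unit b)) + \<alpha> ?x" by (simp add: module_hom.add[OF lin_d])
      then have w2: "d ?w = 0" using c1[OF b] by simp
      have "e (ext f ?x) - \<beta> ?x \<in> J"
        by (rule hideal_linf[OF lins2 hJ x]) (use C(3) in simp)
      from hidealD(3)[OF hJ this c2[OF b]]
      have w3: "e ?w \<in> J" by (simp add: module_hom.add[OF linf_e] add.commute)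
      from homogeneous_preimage[OF w1 w2 w3 \<beta>[OF b]] show ?thesis
        by (auto simp: P_def)
    qed (simp add: P_def)
  qed simp
  then obtain f where f: "\<And>b. P f b (f b)" by blast
  show thesis
  proof (rule that[of "ext f"])
    show "lin (ext f)" by simp
    show "ext f (unit b) \<in> Hm V B lv dg (lv' b) (dg' b)" if "b \<in> B'" for b
      using f[of b] that by (simp add: P_def)
    show "d (ext f u) = \<alpha> u + ext f (d'' u)" if "u \<in> Fr V B'" for u
      by (rule lin_eqI_Fr[OF lin_comp[OF lin_d lin_ext] lins that]) (use f in \<open>simp add: P_def\<close>)
    show "e (ext f u) - \<beta> u \<in> J" if "u \<in> Fr V B'" for u
      by (rule hideal_linf[OF lins2 hJ that]) (use f in \<open>simp add: P_def\<close>)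
  qed
qed

end

definition minimal :: "nat set \<Rightarrow> ((nat \<Rightarrow>\<^sub>0 ('v, 'k::field) mpoly) \<Rightarrow> (nat \<Rightarrow>\<^sub>0 ('v, 'k) mpoly)) \<Rightarrow> bool" where
  "minimal B d \<longleftrightarrow> (\<forall>b\<in>B. \<forall>c. lookup (lookup (d (unit b)) c) 0 = 0)"

lemma linf_eqI_Fr:
  assumes "linf f" "linf g" "u \<in> Fr V B" "\<And>b. b \<in> B \<Longrightarrow> f (unit b) = g (unit b)"
  shows "f u = g u"
  unfolding linf_expand[OF assms(1), of u] linf_expand[OF assms(2), of u]
  by (rule sum.cong) (use assms(3,4) in \<open>auto simp: Fr_def\<close>)

lemma Hm_mono:
  assumes "u \<in> Hm V B lv dg i n" "B \<subseteq> B'" "\<And>b. b \<in> B \<Longrightarrow> lv' b = lv b + s"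
    "\<And>b. b \<in> B \<Longrightarrow> dg' b = dg b + k"
  shows "u \<in> Hm V B' lv' dg' (i + s) (n + k)"
  using assms by (auto simp: Hm_def Fr_def subset_iff)

lemma Hm_mono0:
  assumes "u \<in> Hm V B lv dg i n" "B \<subseteq> B'" "\<And>b. b \<in> B \<Longrightarrow> lv' b = lv b"
    "\<And>b. b \<in> B \<Longrightarrow> dg' b = dg b"
  shows "u \<in> Hm V B' lv' dg' i n"
  using Hm_mono[of u V B lv dg i n B' lv' 0 dg' 0] assms by simp

lemma Fr_0_restr: "u \<in> Fr V B \<Longrightarrow> B \<inter> A = {} \<Longrightarrow> restr A u = 0"
  by (rule restr_0) (auto simp: Fr_def)

lemma Fr_id_restr: "u \<in> Fr V B \<Longrightarrow> B \<subseteq> A \<Longrightarrow> restr A u = u"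
  by (rule restr_id) (auto simp: Fr_def)

lemma restr_unit: "restr A (unit b) = (if b \<in> A then unit b else 0)"
  by (simp add: restr_def)

lemma Fr_split:
  assumes "u \<in> Fr V (A \<union> C)" "A \<inter> C = {}"
  shows "restr A u \<in> Fr V A" "restr C u \<in> Fr V C" "u = restr A u + restr C u"
  using assms Fr_restr[of u V "A \<union> C" A] Fr_restr[of u V "A \<union> C" C]
    restr_split[of A C u]
  by (auto simp: Fr_def)

context gres
begin

lemma e_homog: "u \<in> Hm V B lv dg i n \<Longrightarrow> homog n (e u)"
  unfolding linf_expand[OF linf_e, of u]
proof (rule homog_sum)
  fix b assume *: "u \<in> Hm V B lv dg i n" "b \<in> keys u"
  then have "homog (n - dg b + dg b) (lookup u b * e (unit b))"
    by (intro homog_mult e_unit) (auto simp: Hm_def Fr_def)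
  with * show "homog n (lookup u b * e (unit b))" by (auto simp: Hm_def)
qed

text \<open>Discarding the components of positive level does not change the augmentation, and what
  remains has no boundary because there is no level -1.\<close>

lemma onto_cycle:
  assumes "t \<in> T"
  shows "\<exists>u\<in>Fr V B. d u = 0 \<and> t - e u \<in> J"
proof -
  obtain v where v: "v \<in> Fr V B" "t - e v \<in> J" using onto[OF assms] by blast
  let ?u = "restr {b. lv b = 0} v"
  have "d ?u = (0 :: nat \<Rightarrow>\<^sub>0 ('v, 'k) mpoly)"
    by (rule lin_eqI_Fr[OF lin_comp[OF lin_d lin_restr] smul2.module_hom_zero v(1)])
      (use Hm_neg[OF _ d_unit] in \<open>auto simp: restr_unit module_hom.zero[OF lin_d]\<close>)
  moreover have "e ?u = e v"
    by (rule linf_eqI_Fr[OF linf_comp[OF linf_e lin_restr] linf_e v(1)])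
      (auto simp: restr_unit module_hom.zero[OF linf_e] e_unit)
  moreover have "?u \<in> Fr V B" using Fr_restr[OF v(1)] by (rule Fr_mono) auto
  ultimately show ?thesis using v by auto
qed

end

section \<open>New resolutions from old ones: scaling, cones and extensions\<close>

lemma gres_base:
  "gres V (polys V) {0 :: ('v, 'k::field) mpoly} {0} (\<lambda>_. 0) (\<lambda>_. 0) (\<lambda>_. 0) (\<lambda>u. lookup u 0)"
proof (rule gres.intro)
  show "hideal V {0 :: ('v, 'k) mpoly}" by (auto simp: hideal_def)
  show "linf (\<lambda>u. lookup u 0 :: ('v, 'k) mpoly)"
    by (rule linfI) (auto simp: lookup_add)
  show "\<exists>v\<in>Fr V {0}. u = 0" if "u \<in> Fr V {0}" "lookup u 0 \<in> {0 :: ('v, 'k) mpoly}" for u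
  proof -
    have "lookup u c = 0" for c
      using that by (cases "c = 0") (auto simp: Fr_def in_keys_iff)
    then have "u = 0" by (intro poly_mapping_eqI[of u 0]) simp
    then show ?thesis using Fr_0 by blast
  qed
  show "\<exists>u\<in>Fr V {0}. t - lookup u 0 \<in> {0}" if "t \<in> polys V" for t :: "('v, 'k) mpoly"
    using that by (intro bexI[of _ "single 0 t"]) (auto simp: Fr_def lookup_single when_def)
qed (auto simp: hideal_polys smul2.module_hom_zero)

text \<open>Multiplication by \<open>f\<close> induces an isomorphism from T' / L onto T / J that
  raises degrees by \<open>k\<close>: \<open>colon\<close> gives injectivity, the description of
  \<open>T\<close> gives surjectivity. So the complex is reused with shifted degrees and rescaled
  augmentation.\<close>

lemma gres_mult:
  assumes "gres V T' L B lv dg d e"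
    and f: "f \<in> polys V" "homog k f"
    and h: "hideal V T" "hideal V J" "J \<subseteq> T"
    and colon: "\<And>t. t \<in> T' \<Longrightarrow> f * t \<in> J \<longleftrightarrow> t \<in> L"
    and T: "\<And>p. p \<in> T \<longleftrightarrow> (\<exists>t\<in>T'. p - f * t \<in> J)"
  shows "gres V T J B lv (\<lambda>b. dg b + k) d (\<lambda>u. f * e u)"
proof -
  interpret gres V T' L B lv dg d e by fact
  show ?thesis
  proof (rule gres.intro)
    show "linf (\<lambda>u. f * e u)" by (rule linf_mult[OF linf_e])
    show "d (unit b) \<in> Hm V B lv (\<lambda>b. dg b + k) (lv b - 1) (dg b + k)" if "b \<in> B" for b
      using Hm_mono[OF d_unit[OF that], where s=0 and k=k] by simp
    show "f * e (unit b) \<in> T" if "b \<in> B" for b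
      unfolding T using e_unit(1)[OF that] hidealD(2)[OF h(2)]
      by (intro bexI[of _ "e (unit b)"]) auto
    show "homog (dg b + k) (f * e (unit b))" if "b \<in> B" for b
      using homog_mult[OF f(2) e_unit(2)[OF that]] by (simp add: add.commute)
    show "f * e (d (unit b)) \<in> J" if "b \<in> B" for b
      using ed_unit[OF that] colon JT by blast
    show "\<exists>v\<in>Fr V B. u = d v" if "u \<in> Fr V B" "d u = 0" "f * e u \<in> J" for u
      using exact[OF that(1,2)] colon e_T[OF that(1)] that(3) by blast
    show "\<exists>u\<in>Fr V B. t - f * e u \<in> J" if "t \<in> T" for t
    proof -
      have "\<exists>s\<in>T'. t - f * s \<in> J" using T[THEN iffD1, OF that] .
      then obtain s where s: "s \<in> T'" "t - f * s \<in> J" by blast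
      have "\<exists>u\<in>Fr V B. s - e u \<in> L" by (rule onto[OF s(1)])
      then obtain u where u: "u \<in> Fr V B" "s - e u \<in> L" by blast
      have "f * (s - e u) \<in> J"
        using colon[OF subsetD[OF JT u(2)]] u(2) by simp
      from hidealD(3)[OF h(2) s(2) this] have "t - f * e u \<in> J" by (simp add: right_diff_distrib)
      with u(1) show ?thesis by (rule bexI[rotated])
    qed
  qed (use h lv_nonneg dd_unit e_unit lin_d in simp_all)
qed

text \<open>The mapping cone of \<open>z \<psi>\<close>, where the chain map \<open>\<psi>\<close> lifts the multiplication by \<open>w\<close>. The
  factor \<open>z\<close> makes the cone minimal if both resolutions are.\<close>

lemma gres_cone:
  assumes "gres V (polys V) J BF lvF dgF dF eF" and "gres V T L BQ lvQ dgQ dQ eQ"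
    and disj: "BF \<inter> BQ = {}"
    and w: "w \<in> polys V" "homog k w" and z: "z \<in> polys V" "homog 1 z"
    and colon: "\<And>t. t \<in> T \<Longrightarrow> z * w * t \<in> J \<longleftrightarrow> t \<in> L"
    and wL: "\<And>t. t \<in> L \<Longrightarrow> w * t \<in> J"
    and I: "hideal V I" "\<And>p. p \<in> I \<longleftrightarrow> (\<exists>t\<in>T. p - z * w * t \<in> J)"
  shows "\<exists>d. gres V (polys V) I (BF \<union> BQ) (\<lambda>b. if b \<in> BQ then lvQ b + 1 else lvF b)
      (\<lambda>b. if b \<in> BQ then dgQ b + (k + 1) else dgF b) d (\<lambda>u. eF (restr BF u)) \<and>
    (minimal BF dF \<longrightarrow> minimal BQ dQ \<longrightarrow> minimal (BF \<union> BQ) d)"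
proof -
  interpret F: gres V "polys V" J BF lvF dgF dF eF by fact
  interpret Q: gres V T L BQ lvQ dgQ dQ eQ by fact
  let ?lv = "\<lambda>b. if b \<in> BQ then lvQ b + 1 else lvF b"
  let ?dg = "\<lambda>b. if b \<in> BQ then dgQ b + (k + 1) else dgF b"
  let ?B = "BF \<union> BQ"
  obtain \<psi> where lin\<psi>: "lin \<psi>"
    and \<psi>Hm: "\<And>b. b \<in> BQ \<Longrightarrow> \<psi> (unit b) \<in> Hm V BF lvF dgF (lvQ b) (dgQ b + k)"
    and d\<psi>: "\<And>u. u \<in> Fr V BQ \<Longrightarrow> dF (\<psi> u) = 0 + \<psi> (dQ u)"
    and e\<psi>: "\<And>u. u \<in> Fr V BQ \<Longrightarrow> eF (\<psi> u) - w * eQ u \<in> J"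
  proof (rule F.lift[where d''=dQ and \<alpha>="\<lambda>_. 0" and \<beta>="\<lambda>u. w * eQ u" and B'=BQ and lv'=lvQ
        and dg'="\<lambda>b. dgQ b + k"])
    show "linf (\<lambda>u. w * eQ u)" by (rule linf_mult[OF Q.linf_e])
    show "-1 \<le> lvQ b" if "b \<in> BQ" for b using Q.lv_nonneg[OF that] by simp
    show "dQ (unit b) \<in> Hm V BQ lvQ (\<lambda>b. dgQ b + k) (lvQ b - 1) (dgQ b + k)" if "b \<in> BQ" for b
      using Hm_mono[OF Q.d_unit[OF that], where s=0 and k=k] by simp
    show "w * eQ (unit b) \<in> polys V" if "b \<in> BQ" for b
      using Q.e_unit(1)[OF that] hidealD(1)[OF Q.hT] w by (auto intro: polys_mult)
    show "homog (dgQ b + k) (w * eQ (unit b))" if "b \<in> BQ" for b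
      using homog_mult[OF w(2) Q.e_unit(2)[OF that]] by (simp add: add.commute)
    show "eF 0 + w * eQ (dQ (unit b)) \<in> J" if "b \<in> BQ" for b
      using wL[OF Q.ed_unit[OF that]] by (simp add: module_hom.zero[OF F.linf_e])
  qed (auto simp: Q.lin_d Q.dd_unit Q.e_unit smul2.module_hom_zero module_hom.zero[OF F.lin_d])
  let ?f = "restr BF :: (nat \<Rightarrow>\<^sub>0 ('a, 'b) mpoly) \<Rightarrow> _" 
  let ?q = "restr BQ :: (nat \<Rightarrow>\<^sub>0 ('a, 'b) mpoly) \<Rightarrow> _"
  let ?d = "\<lambda>u. dF (?f u) + smul z (\<psi> (?q u)) - dQ (?q u)"
  let ?e = "\<lambda>u. eF (?f u)"
  have JI: "J \<subseteq> I" using I(2) hidealD(2)[OF Q.hT] by force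
  have \<psi>Fr: "u \<in> Fr V BQ \<Longrightarrow> \<psi> u \<in> Fr V BF" for u
    by (rule Fr_lin[OF lin\<psi>]) (auto intro: Hm_Fr[OF \<psi>Hm])
  have z\<psi>Fr: "u \<in> Fr V BQ \<Longrightarrow> smul z (\<psi> u) \<in> Fr V BF" for u
    by (rule Fr_smul[OF z(1) \<psi>Fr])
  have e\<psi>': "eF (smul z (\<psi> u)) - z * w * eQ u \<in> J" if "u \<in> Fr V BQ" for u
    using hidealD(4)[OF F.hJ z(1) e\<psi>[OF that]]
    by (simp add: module_hom.scale[OF F.linf_e] algebra_simps)
  note rs = Fr_0_restr Fr_id_restr module_hom.add[OF lin_restr] module_hom.diff[OF lin_restr]
    module_hom.zero[OF lin_restr] module_hom.neg[OF lin_restr]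
  note split = Fr_split[OF _ disj]
  have fd: "?f (?d u) = dF (?f u) + smul z (\<psi> (?q u))" "?q (?d u) = - dQ (?q u)"
    if "u \<in> Fr V ?B" for u
    using F.d_Fr[OF split(1)[OF that]] Q.d_Fr[OF split(2)[OF that]] z\<psi>Fr[OF split(2)[OF that]] disj
    by (auto simp: rs Int_commute)
  have lind: "lin ?d"
    by (intro smul2.module_hom_sub smul2.module_hom_add lin_comp[OF F.lin_d] lin_comp[OF Q.lin_d]
        lin_smul lin_comp[OF lin\<psi>] lin_restr)
  have dd: "?d (?d u) = 0" if u: "u \<in> Fr V ?B" for u
  proof -
    have "dF (dF (?f u) + smul z (\<psi> (?q u))) = smul z (\<psi> (dQ (?q u)))"
      using F.dd[OF split(1)[OF u]] d\<psi>[OF split(2)[OF u]]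
      by (simp add: module_hom.add[OF F.lin_d] module_hom.scale[OF F.lin_d])
    then show ?thesis
      unfolding fd[OF u] using Q.dd[OF split(2)[OF u]]
      by (simp add: module_hom.neg[OF lin\<psi>] module_hom.neg[OF Q.lin_d])
  qed
  have ed: "?e (?d u) \<in> I" if u: "u \<in> Fr V ?B" for u
  proof -
    have "eF (dF (?f u)) + (eF (smul z (\<psi> (?q u))) - z * w * eQ (?q u)) \<in> J"
      using F.ed[OF split(1)[OF u]] e\<psi>'[OF split(2)[OF u]] by (rule hidealD(3)[OF F.hJ])
    then show ?thesis unfolding fd[OF u] I(2) using Q.e_T[OF split(2)[OF u]]
      by (auto simp: module_hom.add[OF F.linf_e] algebra_simps)
  qed
  have ex: "\<exists>v\<in>Fr V ?B. u = ?d v" if u: "u \<in> Fr V ?B" "?d u = 0" "?e u \<in> I" for u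
  proof -
    let ?a = "?f u" and ?x = "?q u"
    note a = split(1)[OF u(1)] and x = split(2)[OF u(1)]
    have da: "dF ?a = - smul z (\<psi> ?x)"
      using fd(1)[OF u(1)] unfolding u(2) module_hom.zero[OF lin_restr] eq_neg_iff_add_eq_0 by simp
    have dx: "dQ ?x = 0"
      using fd(2)[OF u(1)] unfolding u(2) module_hom.zero[OF lin_restr] by simp
    obtain t0 where t0: "t0 \<in> T" "eF ?a - z * w * t0 \<in> J" using u(3) I(2) by blast
    \<comment> \<open>Up to sign this vector is a boundary of F, so its augmentation lies in J.
      Comparison with the lifting property of \<psi> puts z w times \<open>eQ ?x\<close> into J, and
      the colon condition then puts \<open>eQ ?x\<close> into L.\<close>
    have "eF (smul z (\<psi> ?x)) \<in> J"
      using hideal_uminus[OF F.hJ F.ed[OF a]] by (simp add: da module_hom.neg[OF F.linf_e])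
    from hideal_minus[OF F.hJ this e\<psi>'[OF x]] have "eQ ?x \<in> L"
      using colon[OF Q.e_T[OF x]] by simp
    then obtain q1 where q1: "q1 \<in> Fr V BQ" "?x = dQ q1" using Q.exact[OF x dx] by blast
    \<comment> \<open>\<open>q1\<close> is determined only up to cycles. The cycle \<open>q2\<close>
      corrects its augmentation, so that \<open>?y\<close> has boundary - \<open>?x\<close> and
      augmentation \<open>t0\<close> modulo L; then \<open>?a'\<close> is a cycle with augmentation
      in J.\<close>
    have "t0 + eQ q1 \<in> T" using hidealD(3)[OF Q.hT t0(1) Q.e_T[OF q1(1)]] .
    then obtain q2 where q2: "q2 \<in> Fr V BQ" "dQ q2 = 0" "t0 + eQ q1 - eQ q2 \<in> L"
      using Q.onto_cycle by blast
    let ?y = "q2 - q1"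
    have y: "?y \<in> Fr V BQ" by (rule Fr_minus[OF q2(1) q1(1)])
    have dy: "dQ ?y = - ?x" using q1 q2 by (simp add: module_hom.diff[OF Q.lin_d])
    have ty: "t0 - eQ ?y \<in> L" using q2(3) by (simp add: module_hom.diff[OF Q.linf_e] algebra_simps)
    let ?a' = "?a - smul z (\<psi> ?y)"
    have a': "?a' \<in> Fr V BF" by (rule Fr_minus[OF a z\<psi>Fr[OF y]])
    have "dF ?a' = 0"
      using d\<psi>[OF y] by (simp add: module_hom.diff[OF F.lin_d] module_hom.scale[OF F.lin_d] da dy
          module_hom.neg[OF lin\<psi>])
    moreover have "eF ?a' \<in> J"
    proof -
      have "z * w * (t0 - eQ ?y) \<in> J" using colon ty Q.JT by blast
      from hidealD(3)[OF F.hJ t0(2) this]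
      have "eF ?a - z * w * eQ ?y \<in> J" by (simp add: algebra_simps)
      from hideal_minus[OF F.hJ this e\<psi>'[OF y]] show ?thesis
        by (simp add: module_hom.diff[OF F.linf_e])
    qed
    ultimately obtain a'' where a'': "a'' \<in> Fr V BF" "?a' = dF a''" using F.exact[OF a'] by blast
    have "?f (a'' + ?y) = a''" "?q (a'' + ?y) = ?y"
      using a''(1) y disj by (auto simp: module_hom.add[OF lin_restr] rs(1,2) Int_commute)
    then have "?d (a'' + ?y) = ?a + ?x" by (simp add: a''(2)[symmetric] dy)
    moreover have "a'' + ?y \<in> Fr V ?B"
      using Fr_mono[OF a''(1), of ?B] Fr_mono[OF y, of ?B] by (auto intro: Fr_add)
    ultimately show ?thesis using split(3)[OF u(1)] by metis
  qed
  have unit: "?d (unit b) = (if b \<in> BF then dF (unit b) else smul z (\<psi> (unit b)) - dQ (unit b))"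
    if "b \<in> ?B" for b
    using that disj by (auto simp: restr_unit module_hom.zero[OF lin\<psi>] module_hom.zero[OF F.lin_d]
        module_hom.zero[OF Q.lin_d])
  have "gres V (polys V) I ?B ?lv ?dg ?d ?e"
  proof (rule gres.intro)
    show "linf ?e" by (rule linf_comp[OF F.linf_e lin_restr])
    show "0 \<le> ?lv b" if "b \<in> ?B" for b
      using that F.lv_nonneg[of b] Q.lv_nonneg[of b] by auto
    show "?d (unit b) \<in> Hm V ?B ?lv ?dg (?lv b - 1) (?dg b)" if b: "b \<in> ?B" for b
    proof (cases "b \<in> BF")
      case True
      then have "b \<notin> BQ" using disj by auto
      have "dF (unit b) \<in> Hm V ?B ?lv ?dg (lvF b - 1) (dgF b)"
        by (rule Hm_mono0[OF F.d_unit[OF True]]) (use disj in auto)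
      with True \<open>b \<notin> BQ\<close> unit[OF b] show ?thesis by simp
    next
      case False
      then have bQ: "b \<in> BQ" using b by auto
      have 1: "dQ (unit b) \<in> Hm V ?B ?lv ?dg (lvQ b - 1 + 1) (dgQ b + (k + 1))"
        by (rule Hm_mono[OF Q.d_unit[OF bQ]]) (use disj in auto)
      have 2: "smul z (\<psi> (unit b)) \<in> Hm V ?B ?lv ?dg (lvQ b) (dgQ b + k + 1)"
        by (rule Hm_mono0[OF Hm_smul[OF z \<psi>Hm[OF bQ]]]) (use disj in auto)
      have "smul z (\<psi> (unit b)) - dQ (unit b) \<in> Hm V ?B ?lv ?dg (lvQ b) (dgQ b + (k + 1))"
        by (rule Hm_minus) (use 1 2 in \<open>simp_all add: add.assoc\<close>)
      with False bQ unit[OF b] show ?thesis by simp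
    qed
    show "?e (unit b) \<in> polys V" "homog (?dg b) (?e (unit b))" if "b \<in> ?B" for b
      using that disj F.e_unit(1,2)[of b] by (auto simp: restr_unit module_hom.zero[OF F.linf_e])
    show "?e (unit b) = 0" if "b \<in> ?B" "?lv b \<noteq> 0" for b
      using that disj F.e_unit(3)[of b]
      by (auto simp: restr_unit module_hom.zero[OF F.linf_e] split: if_splits)
    show "\<exists>u\<in>Fr V ?B. t - ?e u \<in> I" if t: "t \<in> polys V" for t
    proof -
      obtain u where u: "u \<in> Fr V BF" "t - eF u \<in> J" using F.onto[OF t] by blast
      then show ?thesis using JI Fr_mono[OF u(1), of ?B] by (auto intro!: bexI[of _ u] simp: rs)
    qed
    show "?d (?d (unit b)) = 0" if "b \<in> ?B" for b by (rule dd[OF Fr_unit[OF that]])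
    show "?e (?d (unit b)) \<in> I" if "b \<in> ?B" for b by (rule ed[OF Fr_unit[OF that]])
    show "\<exists>v\<in>Fr V ?B. u = ?d v" if "u \<in> Fr V ?B" "?d u = 0" "?e u \<in> I" for u
      by (rule ex[OF that])
    show "lin ?d" by (rule lind)
  qed (use I hideal_polys in \<open>auto dest: hidealD(1)\<close>)
  moreover have "minimal ?B ?d" if m: "minimal BF dF" "minimal BQ dQ"
    unfolding minimal_def
  proof (intro ballI allI)
    fix b c assume b: "b \<in> ?B"
    have "lookup z 0 = 0" using z(2) by (force simp: homog_def in_keys_iff)
    then show "lookup (lookup (?d (unit b)) c) 0 = 0"
      unfolding unit[OF b] using m b by (auto simp: minimal_def lookup_minus mpoly_lookup_mult_0)
  qed
  ultimately show ?thesis by blast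
qed

text \<open>The augmentation \<open>e2\<close> of a boundary lies in T1 but not necessarily in J, so
  a connecting map \<theta> has to compensate for it in the resolution of T1 / J. As \<theta> can
  contain constants, minimality is not inherited.\<close>

lemma gres_horseshoe:
  assumes "gres V T1 J B1 lv1 dg1 d1 e1" and "gres V T T1 B2 lv2 dg2 d2 e2"
    and disj: "B1 \<inter> B2 = {}"
  shows "\<exists>d. gres V T J (B1 \<union> B2) (\<lambda>b. if b \<in> B2 then lv2 b else lv1 b)
      (\<lambda>b. if b \<in> B2 then dg2 b else dg1 b) d (\<lambda>u. e1 (restr B1 u) + e2 (restr B2 u))"
proof -
  interpret F: gres V T1 J B1 lv1 dg1 d1 e1 by fact
  interpret Q: gres V T T1 B2 lv2 dg2 d2 e2 by fact
  let ?lv = "\<lambda>b. if b \<in> B2 then lv2 b else lv1 b"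
  let ?dg = "\<lambda>b. if b \<in> B2 then dg2 b else dg1 b"
  let ?B = "B1 \<union> B2"
  obtain \<theta> where lin\<theta>: "lin \<theta>"
    and \<theta>Hm: "\<And>b. b \<in> B2 \<Longrightarrow> \<theta> (unit b) \<in> Hm V B1 lv1 dg1 (lv2 b - 1) (dg2 b)"
    and d\<theta>: "\<And>u. u \<in> Fr V B2 \<Longrightarrow> d1 (\<theta> u) = 0 + \<theta> (- d2 u)"
    and e\<theta>: "\<And>u. u \<in> Fr V B2 \<Longrightarrow> e1 (\<theta> u) - (- e2 (d2 u)) \<in> J"
  \<comment> \<open>Lowering the levels of \<open>B2\<close> by one makes the connecting map level
    preserving, as \<open>lift\<close> requires. The sign of \<open>d''\<close> makes \<theta>
    anticommute with the differentials, which is what the square of the total differential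
    needs.\<close>
  proof (rule F.lift[where d''="\<lambda>u. - d2 u" and \<alpha>="\<lambda>_. 0" and \<beta>="\<lambda>u. - e2 (d2 u)" and B'=B2
        and lv'="\<lambda>b. lv2 b - 1" and dg'=dg2])
    show "lin (\<lambda>u. - d2 u)" by (rule smul2.module_hom_neg[OF Q.lin_d])
    show "linf (\<lambda>u. - e2 (d2 u))" by (rule smul1.module_hom_neg[OF linf_comp[OF Q.linf_e Q.lin_d]])
    show "-1 \<le> lv2 b - 1" if "b \<in> B2" for b using Q.lv_nonneg[OF that] by simp
    show "- d2 (unit b) \<in> Hm V B2 (\<lambda>b. lv2 b - 1) dg2 (lv2 b - 1 - 1) (dg2 b)" if "b \<in> B2" for b
      using Hm_uminus[OF Hm_mono[OF Q.d_unit[OF that], where s="-1" and k=0]] by simp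
    show "- e2 (d2 (unit b)) \<in> T1" if "b \<in> B2" for b
      by (rule hideal_uminus[OF F.hT Q.ed_unit[OF that]])
    show "homog (dg2 b) (- e2 (d2 (unit b)))" if "b \<in> B2" for b
      using homog_minus[OF homog_0 Q.e_homog[OF Q.d_unit[OF that]]] by simp
    show "- e2 (d2 (unit b)) = 0" if "b \<in> B2" "lv2 b - 1 \<noteq> 0" for b
      using Q.e_Hm[OF that(2) Q.d_unit[OF that(1)]] by simp
    show "e1 0 + - e2 (d2 (- d2 (unit b))) \<in> J" if "b \<in> B2" for b
      using Q.dd_unit[OF that] hidealD(2)[OF F.hJ]
      by (simp add: module_hom.neg[OF Q.lin_d] module_hom.zero[OF Q.linf_e] module_hom.zero[OF F.linf_e])
  qed (auto simp: Q.dd_unit smul2.module_hom_zero module_hom.zero[OF F.lin_d] module_hom.neg[OF Q.lin_d])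
  let ?f = "restr B1 :: (nat \<Rightarrow>\<^sub>0 ('a, 'b) mpoly) \<Rightarrow> _" 
  let ?q = "restr B2 :: (nat \<Rightarrow>\<^sub>0 ('a, 'b) mpoly) \<Rightarrow> _"
  let ?d = "\<lambda>u. d1 (?f u) + \<theta> (?q u) + d2 (?q u)"
  let ?e = "\<lambda>u. e1 (?f u) + e2 (?q u)"
  have \<theta>Fr: "u \<in> Fr V B2 \<Longrightarrow> \<theta> u \<in> Fr V B1" for u
    by (rule Fr_lin[OF lin\<theta>]) (auto intro: Hm_Fr[OF \<theta>Hm])
  note rs = Fr_0_restr Fr_id_restr module_hom.add[OF lin_restr] module_hom.diff[OF lin_restr]
    module_hom.zero[OF lin_restr] module_hom.neg[OF lin_restr]
  note split = Fr_split[OF _ disj]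
  have fd: "?f (?d u) = d1 (?f u) + \<theta> (?q u)" "?q (?d u) = d2 (?q u)"
    if "u \<in> Fr V ?B" for u
    using F.d_Fr[OF split(1)[OF that]] Q.d_Fr[OF split(2)[OF that]] \<theta>Fr[OF split(2)[OF that]] disj
    by (auto simp: rs Int_commute)
  have lind: "lin ?d"
    by (intro smul2.module_hom_add lin_comp[OF F.lin_d] lin_comp[OF Q.lin_d]
        lin_comp[OF lin\<theta>] lin_restr)
  have dd: "?d (?d u) = 0" if u: "u \<in> Fr V ?B" for u
    unfolding fd[OF u] using Q.dd[OF split(2)[OF u]] F.dd[OF split(1)[OF u]] d\<theta>[OF split(2)[OF u]]
    by (simp add: module_hom.neg[OF lin\<theta>] module_hom.add[OF F.lin_d])
  have ed: "?e (?d u) \<in> J" if u: "u \<in> Fr V ?B" for u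
  proof -
    have "e1 (d1 (?f u)) + (e1 (\<theta> (?q u)) - (- e2 (d2 (?q u)))) \<in> J"
      using F.ed[OF split(1)[OF u]] e\<theta>[OF split(2)[OF u]] by (rule hidealD(3)[OF F.hJ])
    then show ?thesis unfolding fd[OF u]
      by (simp add: module_hom.add[OF F.linf_e] algebra_simps)
  qed
  have ex: "\<exists>v\<in>Fr V ?B. u = ?d v" if u: "u \<in> Fr V ?B" "?d u = 0" "?e u \<in> J" for u
  proof -
    let ?a = "?f u" and ?x = "?q u"
    note a = split(1)[OF u(1)] and x = split(2)[OF u(1)]
    have da: "d1 ?a = - \<theta> ?x"
      using fd(1)[OF u(1)] unfolding u(2) module_hom.zero[OF lin_restr] eq_neg_iff_add_eq_0 by simp
    have dx: "d2 ?x = 0"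
      using fd(2)[OF u(1)] unfolding u(2) module_hom.zero[OF lin_restr] by simp
    \<comment> \<open>Modulo T1 the contribution of \<open>?a\<close> disappears, so exactness of
      the resolution of T / T1 applies to \<open>?x\<close>.\<close>
    have "?e u - e1 ?a \<in> T1" using u(3) F.JT by (intro hideal_minus[OF F.hT] F.e_T[OF a]) auto
    then have "e2 ?x \<in> T1" by simp
    then obtain y where y: "y \<in> Fr V B2" "?x = d2 y" using Q.exact[OF x dx] by blast
    let ?a' = "?a - \<theta> y"
    have a': "?a' \<in> Fr V B1" by (rule Fr_minus[OF a \<theta>Fr[OF y(1)]])
    have "d1 ?a' = 0"
      using d\<theta>[OF y(1)] by (simp add: module_hom.diff[OF F.lin_d] da y(2) module_hom.neg[OF lin\<theta>])
    moreover have "e1 ?a' \<in> J"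
      using hideal_minus[OF F.hJ u(3) e\<theta>[OF y(1)]]
      by (simp add: module_hom.diff[OF F.linf_e] y(2) algebra_simps)
    ultimately obtain a'' where a'': "a'' \<in> Fr V B1" "?a' = d1 a''" using F.exact[OF a'] by blast
    have "?f (a'' + y) = a''" "?q (a'' + y) = y"
      using a''(1) y disj by (auto simp: module_hom.add[OF lin_restr] rs(1,2) Int_commute)
    then have "?d (a'' + y) = ?a + ?x" by (simp add: a''(2)[symmetric] y(2))
    moreover have "a'' + y \<in> Fr V ?B"
      using Fr_mono[OF a''(1), of ?B] Fr_mono[OF y(1), of ?B] by (auto intro: Fr_add)
    ultimately show ?thesis using split(3)[OF u(1)] by metis
  qed
  have unit: "?d (unit b) = (if b \<in> B1 then d1 (unit b) else \<theta> (unit b) + d2 (unit b))"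
    if "b \<in> ?B" for b
    using that disj by (auto simp: restr_unit module_hom.zero[OF lin\<theta>] module_hom.zero[OF F.lin_d]
        module_hom.zero[OF Q.lin_d])
  have "gres V T J ?B ?lv ?dg ?d ?e"
  proof (rule gres.intro)
    show "linf ?e"
      by (intro smul1.module_hom_add linf_comp[OF F.linf_e lin_restr] linf_comp[OF Q.linf_e lin_restr])
    show "0 \<le> ?lv b" if "b \<in> ?B" for b
      using that F.lv_nonneg[of b] Q.lv_nonneg[of b] by auto
    show "?d (unit b) \<in> Hm V ?B ?lv ?dg (?lv b - 1) (?dg b)" if b: "b \<in> ?B" for b
    proof (cases "b \<in> B1")
      case True
      then have "b \<notin> B2" using disj by auto
      have "d1 (unit b) \<in> Hm V ?B ?lv ?dg (lv1 b - 1) (dg1 b)"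
        by (rule Hm_mono0[OF F.d_unit[OF True]]) (use disj in auto)
      with True \<open>b \<notin> B2\<close> unit[OF b] show ?thesis by simp
    next
      case False
      then have bQ: "b \<in> B2" using b by auto
      have 1: "d2 (unit b) \<in> Hm V ?B ?lv ?dg (lv2 b - 1) (dg2 b)"
        by (rule Hm_mono0[OF Q.d_unit[OF bQ]]) (use disj in auto)
      have 2: "\<theta> (unit b) \<in> Hm V ?B ?lv ?dg (lv2 b - 1) (dg2 b)"
        by (rule Hm_mono0[OF \<theta>Hm[OF bQ]]) (use disj in auto)
      from Hm_add[OF 2 1] False bQ unit[OF b] show ?thesis by simp
    qed
    show "?e (unit b) \<in> T" "homog (?dg b) (?e (unit b))" if "b \<in> ?B" for b
      using that disj F.e_unit(1,2)[of b] Q.e_unit(1,2)[of b] Q.JT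
      by (auto simp: restr_unit module_hom.zero[OF F.linf_e] module_hom.zero[OF Q.linf_e])
    show "?e (unit b) = 0" if "b \<in> ?B" "?lv b \<noteq> 0" for b
      using that disj F.e_unit(3)[of b] Q.e_unit(3)[of b]
      by (auto simp: restr_unit module_hom.zero[OF F.linf_e] module_hom.zero[OF Q.linf_e]
          split: if_splits)
    show "\<exists>u\<in>Fr V ?B. t - ?e u \<in> J" if t: "t \<in> T" for t
    proof -
      obtain v where v: "v \<in> Fr V B2" "t - e2 v \<in> T1" using Q.onto[OF t] by blast
      obtain u where u: "u \<in> Fr V B1" "t - e2 v - e1 u \<in> J" using F.onto[OF v(2)] by blast
      have "?f (u + v) = u" "?q (u + v) = v"
        using u(1) v(1) disj by (auto simp: module_hom.add[OF lin_restr] rs(1,2) Int_commute)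
      then have "t - ?e (u + v) \<in> J" using u(2) by (simp add: algebra_simps)
      moreover have "u + v \<in> Fr V ?B"
        using Fr_mono[OF u(1), of ?B] Fr_mono[OF v(1), of ?B] by (auto intro: Fr_add)
      ultimately show ?thesis by blast
    qed
    show "?d (?d (unit b)) = 0" if "b \<in> ?B" for b by (rule dd[OF Fr_unit[OF that]])
    show "?e (?d (unit b)) \<in> J" if "b \<in> ?B" for b by (rule ed[OF Fr_unit[OF that]])
    show "\<exists>v\<in>Fr V ?B. u = ?d v" if "u \<in> Fr V ?B" "?d u = 0" "?e u \<in> J" for u
      by (rule ex[OF that])
    show "lin ?d" by (rule lind)
  qed (use Q.hT F.hJ F.JT Q.JT in auto)
  then show ?thesis by blast
qed

section \<open>Cancellation of constant matrix entries\<close>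

lemma homog_0_const: "homog 0 p \<Longrightarrow> p = single 0 (lookup p 0)"
  by (rule poly_mapping_eqI)
    (auto simp: homog_def mon_degree_eq_0 lookup_single when_def in_keys_iff)

lemma homog_const [simp]: "homog 0 (single 0 c)"
  by (auto simp: homog_def)

lemma polys_const [simp]: "single 0 c \<in> polys V"
  by (auto simp: polys_def)

lemma homog_const_term: "homog n p \<Longrightarrow> n \<noteq> 0 \<Longrightarrow> lookup p 0 = 0"
  by (metis homog_def in_keys_iff mon_degree_0)

text \<open>Gaussian elimination. The entry is homogeneous with a nonzero constant term, hence a
  unit, so \<open>c\<close> and its boundary span a contractible subcomplex. The map \<pi> is the
  projection onto the remaining basis with this span as kernel, and \<pi> after \<open>d\<close> is
  the induced differential. The augmentation can stay, because \<pi> changes its values only by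
  multiples of the augmentation of a boundary.\<close>

lemma (in gres) gres_prune_step:
  assumes c: "c \<in> B" and r: "lookup (lookup (d (unit c)) r) 0 \<noteq> 0"
  shows "\<exists>B' d'. B' \<subset> B \<and> gres V T J B' lv dg d' e"
proof -
  let ?p = "lookup (d (unit c)) r"
  have "r \<in> keys (d (unit c))" using r by (auto simp: in_keys_iff)
  then have rB: "r \<in> B" and lvr: "lv r = lv c - 1" and "dg r \<le> dg c" and "homog (dg c - dg r) ?p"
    using d_unit[OF c] by (auto simp: Hm_def Fr_def)
  moreover from this r have "dg c - dg r = 0" using homog_const_term by blast
  ultimately have dgr: "dg r = dg c" and hp0: "homog 0 ?p" by simp_all
  let ?s = "single 0 (inverse (lookup ?p 0)) :: ('v, 'k) mpoly"
  have sp: "?s * ?p = 1"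
    by (subst homog_0_const[OF hp0]) (use r in \<open>simp add: mult_single\<close>)
  have cr: "c \<noteq> r" using lvr by auto
  \<comment> \<open>\<open>r\<close> lies one level below \<open>c\<close>, so \<open>c\<close> has
    positive level and its augmentation is 0.\<close>
  have lvc: "lv c \<noteq> 0" using lv_nonneg[OF rB] lvr by auto
  have dcc: "lookup (d (unit c)) c = 0"
    using d_unit[OF c] by (force simp: Hm_def in_keys_iff)
  define \<pi> where "\<pi> = (\<lambda>u. u - smul (?s * lookup u r) (d (unit c))
      - smul (lookup u c) (unit c))"
  let ?B = "B - {r, c}"
  have lin\<pi>: "lin \<pi>"
  proof (rule linI)
    show "\<pi> (u + v) = \<pi> u + \<pi> v" for u v
      by (simp add: \<pi>_def lookup_add distrib_left smul.scale_left_distrib)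
    show "\<pi> (smul p u) = smul p (\<pi> u)" for p u
      by (simp add: \<pi>_def smul.scale_right_diff_distrib mult.left_commute)
  qed
  have pol: "lookup u b \<in> polys V" if "u \<in> Fr V A" for u A b
    using that by (simp add: Fr_def)
  have \<pi>FrB: "\<pi> u \<in> Fr V B" if "u \<in> Fr V B" for u
    unfolding \<pi>_def using that c
    by (intro Fr_minus Fr_smul Fr_unit polys_mult pol d_Fr) auto
  have \<pi>r: "lookup (\<pi> u) r = 0" for u
  proof -
    have "?s * lookup u r * ?p = lookup u r * (?s * ?p)"
      by (simp only: ac_simps)
    then show ?thesis using cr sp by (simp add: \<pi>_def lookup_minus lookup_single when_def)
  qed
  have \<pi>c: "lookup (\<pi> u) c = 0" for u
    by (simp add: \<pi>_def lookup_minus dcc)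
  have \<pi>Fr: "\<pi> u \<in> Fr V ?B" if "u \<in> Fr V B" for u
    using \<pi>FrB[OF that] \<pi>r[of u] \<pi>c[of u] by (auto simp: Fr_def in_keys_iff)
  have \<pi>id: "\<pi> u = u" if "u \<in> Fr V ?B" for u
  proof -
    have "lookup u r = 0" "lookup u c = 0"
      using that by (auto simp: Fr_def in_keys_iff)
    then show ?thesis by (simp add: \<pi>_def)
  qed
  have B: "u \<in> Fr V B" if "u \<in> Fr V ?B" for u using that by (rule Fr_mono) auto
  have uc: "(unit c :: nat \<Rightarrow>\<^sub>0 ('v, 'k) mpoly) \<in> Fr V B" by (rule Fr_unit[OF c])
  have \<pi>dc: "\<pi> (d (unit c)) = 0" by (simp add: \<pi>_def sp dcc)
  have \<pi>uc: "\<pi> (unit c) = 0" using cr by (simp add: \<pi>_def lookup_single when_def)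
  have d\<pi>: "d (\<pi> u) = d u - smul (lookup u c) (d (unit c))" for u
    by (simp add: \<pi>_def module_hom.diff[OF lin_d] module_hom.scale[OF lin_d] dd[OF uc])
  \<comment> \<open>Projecting a vector changes its differential by a multiple of
    \<open>d (unit c)\<close>, which \<pi> kills.\<close>
  have \<pi>d\<pi>: "\<pi> (d (\<pi> u)) = \<pi> (d u)" for u
    by (simp add: d\<pi> module_hom.diff[OF lin\<pi>] module_hom.scale[OF lin\<pi>] \<pi>dc)
  have e\<pi>: "e u - e (\<pi> u) \<in> J" if "u \<in> Fr V B" for u
  proof -
    have "e u - e (\<pi> u) = ?s * lookup u r * e (d (unit c))"
      using e_unit(3)[OF c lvc]
      by (simp add: \<pi>_def module_hom.diff[OF linf_e] module_hom.scale[OF linf_e])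
    also have "\<dots> \<in> J" by (intro hidealD(4)[OF hJ] polys_mult ed[OF uc] pol[OF that]) auto
    finally show ?thesis .
  qed
  have "gres V T J ?B lv dg (\<lambda>u. \<pi> (d u)) e"
  proof (rule gres.intro)
    show "lin (\<lambda>u. \<pi> (d u))" by (rule lin_comp[OF lin\<pi> lin_d])
    show "\<pi> (d (unit b)) \<in> Hm V ?B lv dg (lv b - 1) (dg b)" if b: "b \<in> ?B" for b
    proof -
      have "\<pi> (unit b) \<in> Hm V B lv dg (lv b + 0) (dg b)" if b: "b \<in> B" for b
      proof (cases "b = r")
        case True
        have "smul ?s (d (unit c)) \<in> Hm V B lv dg (lv c - 1) (dg c + 0)"
          by (rule Hm_smul[OF _ _ d_unit[OF c]]) auto
        then show ?thesis using True cr lvr dgr Hm_minus[OF Hm_unit[OF rB, of V lv dg]]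
          by (simp add: \<pi>_def lookup_single when_def)
      next
        case False
        then show ?thesis using Hm_unit[OF b, of V lv dg]
          by (cases "b = c") (simp_all add: \<pi>uc, simp add: \<pi>_def lookup_single when_def)
      qed
      from Hm_lin[OF lin\<pi> d_unit this] have "\<pi> (d (unit b)) \<in> Hm V B lv dg (lv b - 1) (dg b)"
        using b by simp
      moreover have "\<pi> (d (unit b)) \<in> Fr V ?B" using b by (intro \<pi>Fr d_Fr Fr_unit) auto
      ultimately show ?thesis by (simp add: Hm_def)
    qed
    show "\<pi> (d (\<pi> (d (unit b)))) = 0" if "b \<in> ?B" for b
      using that dd_unit[of b] by (simp add: \<pi>d\<pi> module_hom.zero[OF lin\<pi>])
    show "e (\<pi> (d (unit b))) \<in> J" if "b \<in> ?B" for b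
    proof -
      have "d (unit b) \<in> Fr V B" using that by (intro d_Fr Fr_unit) auto
      from hideal_minus[OF hJ ed_unit e\<pi>[OF this], of b] that show ?thesis by simp
    qed
    show "\<exists>v\<in>Fr V ?B. u = \<pi> (d v)" if u: "u \<in> Fr V ?B" "\<pi> (d u) = 0" "e u \<in> J" for u
    proof -
      let ?x = "?s * lookup (d u) r" and ?y = "lookup (d u) c"
      have du: "d u = smul ?x (d (unit c)) + smul ?y (unit c)"
        using u(2) by (simp add: \<pi>_def algebra_simps)
      \<comment> \<open>Applying \<open>d\<close> once more leaves only \<open>?y\<close> times the
        boundary of \<open>c\<close>, whose entry at \<open>r\<close> is a unit. So
        \<open>?y\<close> vanishes, and subtracting \<open>?x\<close> times \<open>unit c\<close>
        from \<open>u\<close> gives a true cycle.\<close>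
      have "0 = d (d u)" using dd[OF B[OF u(1)]] by simp
      also have "\<dots> = smul ?y (d (unit c))"
        by (subst du) (simp add: module_hom.add[OF lin_d] module_hom.scale[OF lin_d] dd[OF uc])
      finally have "lookup (smul ?y (d (unit c))) r = 0" by (metis lookup_zero)
      then have "?s * (?y * ?p) = 0" by simp
      then have "?y * (?s * ?p) = 0" by (simp only: ac_simps)
      then have y: "?y = 0" using sp by simp
      let ?u = "u - smul ?x (unit c)"
      have u': "?u \<in> Fr V B"
        using B[OF u(1)] by (intro Fr_minus Fr_smul uc polys_mult pol[OF d_Fr]) auto
      have "d ?u = d u - smul ?x (d (unit c))"
        by (simp only: module_hom.diff[OF lin_d] module_hom.scale[OF lin_d])
      also have "\<dots> = 0" using du y by simp
      finally have du': "d ?u = 0" .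
      have "e ?u = e u"
        using e_unit(3)[OF c lvc] by (simp add: module_hom.diff[OF linf_e] module_hom.scale[OF linf_e])
      with exact[OF u' du'] u(3) obtain v where v: "v \<in> Fr V B" "?u = d v" by auto
      have "u = \<pi> ?u"
        by (simp add: module_hom.diff[OF lin\<pi>] module_hom.scale[OF lin\<pi>] \<pi>uc \<pi>id[OF u(1)])
      also have "\<dots> = \<pi> (d (\<pi> v))" by (simp only: v(2) \<pi>d\<pi>)
      finally show ?thesis using \<pi>Fr[OF v(1)] by blast
    qed
    show "\<exists>u\<in>Fr V ?B. t - e u \<in> J" if t: "t \<in> T" for t
    proof -
      obtain v where v: "v \<in> Fr V B" "t - e v \<in> J" using onto[OF t] by blast
      from hidealD(3)[OF hJ v(2) e\<pi>[OF v(1)]] have "t - e (\<pi> v) \<in> J" by simp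
      then show ?thesis using \<pi>Fr[OF v(1)] by blast
    qed
  qed (use hT hJ JT linf_e lv_nonneg e_unit in simp_all)
  moreover have "?B \<subset> B" using c by auto
  ultimately show ?thesis by blast
qed

text \<open>Elimination only removes basis elements and keeps the level and degree of the others, so
  upper bounds on the positions survive.\<close>

lemma gres_prune:
  assumes "finite B" "gres V T J B lv dg d e"
  shows "\<exists>B' d'. B' \<subseteq> B \<and> gres V T J B' lv dg d' e \<and> minimal B' d'"
  using assms
proof (induction B arbitrary: d rule: finite_psubset_induct)
  case (psubset B)
  show ?case
  proof (cases "minimal B d")
    case False
    then obtain c r where "c \<in> B" "lookup (lookup (d (unit c)) r) 0 \<noteq> 0"
      by (auto simp: minimal_def)
    from gres.gres_prune_step[OF psubset.prems this] obtain B' d' where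
      "B' \<subset> B" "gres V T J B' lv dg d' e" by blast
    with psubset.IH[of B' d'] show ?thesis by blast
  qed (use psubset.prems in blast)
qed

section \<open>Relabelling of bases\<close>

lemma map_key_involution:
  assumes "\<And>x. \<pi> (\<pi> x) = x"
  shows "lookup (Poly_Mapping.map_key \<pi> p) b = lookup p (\<pi> b)"
    "Poly_Mapping.map_key \<pi> (Poly_Mapping.map_key \<pi> p) = p"
    "keys (Poly_Mapping.map_key \<pi> p) = \<pi> ` keys p"
proof -
  have inj: "inj \<pi>" by (metis assms injI)
  show 1: "lookup (Poly_Mapping.map_key \<pi> p) b = lookup p (\<pi> b)" for p b
    by (simp add: map_key.rep_eq[OF inj])
  show "Poly_Mapping.map_key \<pi> (Poly_Mapping.map_key \<pi> p) = p"
    by (rule poly_mapping_eqI) (simp add: 1 assms)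
  show "keys (Poly_Mapping.map_key \<pi> p) = \<pi> ` keys p"
  proof (rule Set.set_eqI)
    fix b
    have "b \<in> keys (Poly_Mapping.map_key \<pi> p) \<longleftrightarrow> \<pi> b \<in> keys p"
      by (simp add: in_keys_iff 1)
    also have "\<dots> \<longleftrightarrow> b \<in> \<pi> ` keys p"
      using assms image_iff by metis
    finally show "b \<in> keys (Poly_Mapping.map_key \<pi> p) \<longleftrightarrow> b \<in> \<pi> ` keys p" .
  qed
qed

text \<open>Cones and extensions require disjoint bases. With an involution the induced map on
  vectors is its own inverse, so one map transports in both directions.\<close>

lemma gres_relabel:
  fixes \<pi> :: "nat \<Rightarrow> nat"
  assumes inv: "\<And>x. \<pi> (\<pi> x) = x" and "gres V T J B lv dg d e"
  defines "P \<equiv> Poly_Mapping.map_key \<pi>"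
  shows "gres V T J (\<pi> ` B) (\<lambda>b. lv (\<pi> b)) (\<lambda>b. dg (\<pi> b)) (\<lambda>u. P (d (P u))) (\<lambda>u. e (P u))"
    "minimal B d \<Longrightarrow> minimal (\<pi> ` B) (\<lambda>u. P (d (P u)))"
proof -
  interpret gres V T J B lv dg d e by fact
  have mk: "lookup (P u) b = lookup u (\<pi> b)" "P (P u) = u"
    "keys (P u) = \<pi> ` keys u" for u b
    unfolding P_def by (rule map_key_involution[OF inv])+
  have linP: "lin P"
    by (rule linI; rule poly_mapping_eqI) (simp_all add: mk lookup_add)
  have Pu: "P (unit b) = unit (\<pi> b)" for b
  proof (rule poly_mapping_eqI)
    fix k
    have "b = \<pi> k \<longleftrightarrow> \<pi> b = k" using inv by metis
    then show "lookup (P (unit b)) k = lookup (unit (\<pi> b)) k"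
      by (simp add: mk lookup_single when_def)
  qed
  have FrP: "P u \<in> Fr V (\<pi> ` A)" if "u \<in> Fr V A" for u A
    using that by (auto simp: Fr_def mk)
  have FrP': "P u \<in> Fr V A" if "u \<in> Fr V (\<pi> ` A)" for u A
    using FrP[OF that] by (simp add: image_image inv)
  have HmP: "P u \<in> Hm V (\<pi> ` B) (\<lambda>b. lv (\<pi> b)) (\<lambda>b. dg (\<pi> b)) i n" if "u \<in> Hm V B lv dg i n" for u i n
    using that FrP[of u B] by (auto simp: Hm_def mk inv)
  show "gres V T J (\<pi> ` B) (\<lambda>b. lv (\<pi> b)) (\<lambda>b. dg (\<pi> b)) (\<lambda>u. P (d (P u))) (\<lambda>u. e (P u))"
  proof (rule gres.intro)
    show "lin (\<lambda>u. P (d (P u)))" by (rule lin_comp[OF linP lin_comp[OF lin_d linP]])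
    show "linf (\<lambda>u. e (P u))" by (rule linf_comp[OF linf_e linP])
    show "\<exists>v\<in>Fr V (\<pi> ` B). u = P (d (P v))" if u: "u \<in> Fr V (\<pi> ` B)" "P (d (P u)) = 0" "e (P u) \<in> J" for u
    proof -
      have "d (P u) = 0" using arg_cong[OF u(2), of P] by (simp add: mk module_hom.zero[OF linP])
      from exact[OF FrP'[OF u(1)] this u(3)] obtain v where "v \<in> Fr V B" "P u = d v" by blast
      then have "P v \<in> Fr V (\<pi> ` B)" "u = P (d (P (P v)))" using FrP mk(2)[of u] by (simp_all add: mk(2))
      then show ?thesis by blast
    qed
    show "\<exists>u\<in>Fr V (\<pi> ` B). t - e (P u) \<in> J" if t: "t \<in> T" for t
    proof -
      obtain v where "v \<in> Fr V B" "t - e v \<in> J" using onto[OF t] by blast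
      then show ?thesis using FrP by (intro bexI[of _ "P v"]) (auto simp: mk(2))
    qed
  qed (use hT hJ JT lv_nonneg in \<open>auto simp: Pu inv mk(2) dd_unit ed_unit e_unit module_hom.zero[OF linP]
      intro!: HmP d_unit\<close>)
  show "minimal (\<pi> ` B) (\<lambda>u. P (d (P u)))" if "minimal B d"
    using that by (auto simp: minimal_def Pu mk(1) inv)
qed

lemma avoiding_involution:
  fixes A B :: "nat set"
  assumes "finite A" "finite B"
  obtains \<pi> :: "nat \<Rightarrow> nat" where "\<And>x. \<pi> (\<pi> x) = x" "\<pi> ` B \<inter> A = {}"
proof -
  obtain N where N: "\<And>x. x \<in> A \<union> B \<Longrightarrow> x < N"
    using assms finite_nat_set_iff_bounded[of "A \<union> B"] by auto
  \<comment> \<open>Swaps the blocks [0, N) and [N, 2N) and fixes the rest, which moves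
    \<open>B\<close> past \<open>A\<close>.\<close>
  let ?p = "\<lambda>x. if x < N then x + N else if x < 2 * N then x - N else x"
  show thesis
  proof (rule that[of ?p])
    show "?p (?p x) = x" for x by auto
    show "?p ` B \<inter> A = {}" using N by force
  qed
qed

section \<open>Positions of the nonzero Betti numbers\<close>

text \<open>The basis elements are recorded by the pair of the homological degree and the strand.\<close>

definition positions :: "nat set \<Rightarrow> (nat \<Rightarrow> int) \<Rightarrow> (nat \<Rightarrow> nat) \<Rightarrow> (nat \<times> nat) set" where
  "positions B lv dg = (\<lambda>b. (nat (lv b), nat (int (dg b) - lv b))) ` B"

text \<open>The inequality keeps strand indices nonnegative, so the truncation by \<open>nat\<close>
  in \<open>positions\<close> loses no information.\<close>

definition min_res :: "'v set \<Rightarrow> ('v, 'k::field) mpoly set \<Rightarrow> ('v, 'k) mpoly set \<Rightarrow> (nat \<times> nat) set \<Rightarrow> bool" where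
  "min_res V T J Y \<longleftrightarrow> (\<exists>B lv dg d e. gres V T J B lv dg d e \<and> finite B \<and> minimal B d \<and>
     (\<forall>b\<in>B. lv b \<le> int (dg b)) \<and> Y = positions B lv dg)"

text \<open>A single generator \<open>b0\<close> at level 0, of degree 0 and with augmentation 1, is
  the shape F0 = R that \<open>graded_free_resolution\<close> demands.\<close>

definition min_res_quotient :: "'v set \<Rightarrow> ('v, 'k::field) mpoly set \<Rightarrow> (nat \<times> nat) set \<Rightarrow> bool" where
  "min_res_quotient V J Y \<longleftrightarrow> (\<exists>B lv dg d e b0. gres V (polys V) J B lv dg d e \<and> finite B \<and> minimal B d \<and>
     (\<forall>b\<in>B. lv b \<le> int (dg b)) \<and> Y = positions B lv dg \<and>
     b0 \<in> B \<and> (\<forall>b\<in>B. lv b = 0 \<longleftrightarrow> b = b0) \<and> dg b0 = 0 \<and> e (unit b0) = 1)"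

lemma positions_Un: "positions (A \<union> B) lv dg = positions A lv dg \<union> positions B lv dg"
  by (simp add: positions_def image_Un)

lemma positions_mono: "A \<subseteq> B \<Longrightarrow> positions A lv dg \<subseteq> positions B lv dg"
  unfolding positions_def by (rule image_mono)

lemma min_res_quotient_imp: "min_res_quotient V J Y \<Longrightarrow> min_res V (polys V) J Y"
  unfolding min_res_quotient_def min_res_def by blast

lemma min_res_quotient_0: "min_res_quotient V {0 :: ('v, 'k::field) mpoly} {(0, 0)}"
  unfolding min_res_quotient_def
  by (rule exI[of _ "{0}"], rule exI[of _ "\<lambda>_. 0"], rule exI[of _ "\<lambda>_. 0"], rule exI[of _ "\<lambda>_. 0"],
      rule exI[of _ "\<lambda>u. lookup u 0"], rule exI[of _ 0])
    (simp add: gres_base minimal_def positions_def)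

lemma min_res_mult:
  fixes f :: "('v, 'k::field) mpoly"
  assumes "min_res V T' L Y"
    and "f \<in> polys V" "homog k f"
    and "hideal V T" "hideal V J" "J \<subseteq> T"
    and "\<And>t. t \<in> T' \<Longrightarrow> f * t \<in> J \<longleftrightarrow> t \<in> L"
    and "\<And>p. p \<in> T \<longleftrightarrow> (\<exists>t\<in>T'. p - f * t \<in> J)"
  shows "min_res V T J ((\<lambda>(i, j). (i, j + k)) ` Y)"
proof -
  from assms(1) obtain B lv dg d e where *: "gres V T' L B lv dg d e" "finite B" "minimal B d"
     "\<forall>b\<in>B. lv b \<le> int (dg b)" "Y = positions B lv dg"
    unfolding min_res_def by blast
  have "(\<lambda>(i, j). (i, j + k)) ` Y = positions B lv (\<lambda>b. dg b + k)"
    unfolding *(5) positions_def image_image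
  proof (rule image_cong)
    fix b assume "b \<in> B"
    then have "lv b \<le> int (dg b)" using *(4) by blast
    then have "nat (int (dg b) - lv b) + k = nat (int (dg b + k) - lv b)" by arith
    then show "(case (nat (lv b), nat (int (dg b) - lv b)) of (i, j) \<Rightarrow> (i, j + k)) =
      (nat (lv b), nat (int (dg b + k) - lv b))" by simp
  qed simp
  moreover have "\<forall>b\<in>B. lv b \<le> int (dg b + k)" using *(4) by force
  ultimately show ?thesis using gres_mult[OF *(1) assms(2-8)] *(2,3)
    unfolding min_res_def by blast
qed

text \<open>In the cone a basis element of the second resolution rises by one level and by k + 1
  degrees, so its strand index grows by k.\<close>

lemma min_res_cone:
  fixes w z :: "('v, 'k::field) mpoly"
  assumes F: "min_res_quotient V J Y" and Q: "min_res V T L Z"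
    and wz: "w \<in> polys V" "homog k w" "z \<in> polys V" "homog 1 z"
    and colon: "\<And>t. t \<in> T \<Longrightarrow> z * w * t \<in> J \<longleftrightarrow> t \<in> L" "\<And>t. t \<in> L \<Longrightarrow> w * t \<in> J"
    and I: "hideal V I" "\<And>p. p \<in> I \<longleftrightarrow> (\<exists>t\<in>T. p - z * w * t \<in> J)"
  shows "min_res_quotient V I (Y \<union> (\<lambda>(i, j). (Suc i, j + k)) ` Z)"
proof -
  from F obtain BF lvF dgF dF eF b0 where F: "gres V (polys V) J BF lvF dgF dF eF" "finite BF" "minimal BF dF"
     "\<forall>b\<in>BF. lvF b \<le> int (dgF b)" "Y = positions BF lvF dgF" "b0 \<in> BF" "\<forall>b\<in>BF. lvF b = 0 \<longleftrightarrow> b = b0"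
     "dgF b0 = 0" "eF (unit b0) = 1"
    unfolding min_res_quotient_def by blast
  from Q obtain B1 lv1 dg1 d1 e1 where Q1: "gres V T L B1 lv1 dg1 d1 e1" "finite B1" "minimal B1 d1"
     "\<forall>b\<in>B1. lv1 b \<le> int (dg1 b)" "Z = positions B1 lv1 dg1"
    unfolding min_res_def by blast
  obtain \<pi> :: "nat \<Rightarrow> nat" where \<pi>: "\<And>x. \<pi> (\<pi> x) = x" "\<pi> ` B1 \<inter> BF = {}"
    using avoiding_involution[OF F(2) Q1(2)] by blast
  let ?BQ = "\<pi> ` B1" and ?lvQ = "\<lambda>b. lv1 (\<pi> b)" and ?dgQ = "\<lambda>b. dg1 (\<pi> b)"
  note Q = gres_relabel[OF \<pi>(1) Q1(1)]
  let ?lv = "\<lambda>b. if b \<in> ?BQ then ?lvQ b + 1 else lvF b"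
  let ?dg = "\<lambda>b. if b \<in> ?BQ then ?dgQ b + (k + 1) else dgF b"
  have disj: "BF \<inter> ?BQ = {}" using \<pi>(2) by auto
  obtain d where d: "gres V (polys V) I (BF \<union> ?BQ) ?lv ?dg d (\<lambda>u. eF (restr BF u))"
    "minimal (BF \<union> ?BQ) d"
    using gres_cone[OF F(1) Q(1) disj wz colon I] F(3) Q(2)[OF Q1(3)] by auto
  have nn: "0 \<le> lv1 b" if "b \<in> B1" for b using gres.lv_nonneg[OF Q1(1) that] .
  have "positions ?BQ ?lv ?dg = (\<lambda>(i, j). (Suc i, j + k)) ` Z"
    unfolding Q1(5) positions_def image_image
  proof (rule image_cong)
    fix b assume "b \<in> B1"
    then have "0 \<le> lv1 b" "lv1 b \<le> int (dg1 b)" using nn Q1(4) by blast+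
    then have "nat (lv1 b + 1) = Suc (nat (lv1 b))"
      "nat (int (dg1 b + (k + 1)) - (lv1 b + 1)) = nat (int (dg1 b) - lv1 b) + k" by arith+
    with \<open>b \<in> B1\<close> show "(nat (?lv (\<pi> b)), nat (int (?dg (\<pi> b)) - ?lv (\<pi> b))) =
      (case (nat (lv1 b), nat (int (dg1 b) - lv1 b)) of (i, j) \<Rightarrow> (Suc i, j + k))"
      by (simp add: \<pi>(1))
  qed simp
  moreover have "positions BF ?lv ?dg = Y"
    unfolding F(5) positions_def by (rule image_cong) (use disj in auto)
  ultimately have "Y \<union> (\<lambda>(i, j). (Suc i, j + k)) ` Z = positions (BF \<union> ?BQ) ?lv ?dg"
    by (simp add: positions_Un)
  moreover have "\<forall>b\<in>BF \<union> ?BQ. ?lv b \<le> int (?dg b)" using F(4) Q1(4) by (force simp: \<pi>(1))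
  moreover have "\<forall>b\<in>BF \<union> ?BQ. ?lv b = 0 \<longleftrightarrow> b = b0" using F(6,7) disj nn by (force simp: \<pi>(1))
  moreover have "?dg b0 = 0" "eF (restr BF (unit b0)) = 1" using F(6,8,9) disj by (auto simp: restr_unit)
  moreover have "finite (BF \<union> ?BQ)" "b0 \<in> BF \<union> ?BQ" using F(2,6) Q1(2) by auto
  ultimately show ?thesis
    unfolding min_res_quotient_def using d by blast
qed

text \<open>The glued resolution may have constant entries. Cancelling them can remove positions
  from either side and never adds any, hence an inclusion instead of an equality.\<close>

lemma min_res_extension:
  assumes F: "min_res V T1 J Y" and Q: "min_res V T T1 Z"
  shows "\<exists>X \<subseteq> Y \<union> Z. min_res V T (J :: ('v, 'k::field) mpoly set) X"
proof -
  from F obtain BF lvF dgF dF eF where F: "gres V T1 J BF lvF dgF dF eF" "finite BF"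
     "\<forall>b\<in>BF. lvF b \<le> int (dgF b)" "Y = positions BF lvF dgF"
    unfolding min_res_def by blast
  from Q obtain B1 lv1 dg1 d1 e1 where Q1: "gres V T T1 B1 lv1 dg1 d1 e1" "finite B1"
     "\<forall>b\<in>B1. lv1 b \<le> int (dg1 b)" "Z = positions B1 lv1 dg1"
    unfolding min_res_def by blast
  obtain \<pi> :: "nat \<Rightarrow> nat" where \<pi>: "\<And>x. \<pi> (\<pi> x) = x" "\<pi> ` B1 \<inter> BF = {}"
    using avoiding_involution[OF F(2) Q1(2)] by blast
  let ?BQ = "\<pi> ` B1" and ?lvQ = "\<lambda>b. lv1 (\<pi> b)" and ?dgQ = "\<lambda>b. dg1 (\<pi> b)"
  note Q = gres_relabel(1)[OF \<pi>(1) Q1(1)]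
  let ?lv = "\<lambda>b. if b \<in> ?BQ then ?lvQ b else lvF b"
  let ?dg = "\<lambda>b. if b \<in> ?BQ then ?dgQ b else dgF b"
  have disj: "BF \<inter> ?BQ = {}" using \<pi>(2) by auto
  obtain d e where d: "gres V T J (BF \<union> ?BQ) ?lv ?dg d e"
    using gres_horseshoe[OF F(1) Q disj] by blast
  have "finite (BF \<union> ?BQ)" using F(2) Q1(2) by auto
  from gres_prune[OF this d] obtain B' d' where B': "B' \<subseteq> BF \<union> ?BQ" "gres V T J B' ?lv ?dg d' e"
    "minimal B' d'" by blast
  have "positions ?BQ ?lv ?dg = Z"
    unfolding Q1(4) positions_def image_image by (rule image_cong) (auto simp: \<pi>(1))
  moreover have "positions BF ?lv ?dg = Y"
    unfolding F(4) positions_def by (rule image_cong) (use disj in auto)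
  ultimately have "positions B' ?lv ?dg \<subseteq> Y \<union> Z"
    using positions_mono[OF B'(1), of ?lv ?dg] unfolding positions_Un by simp
  moreover have "\<forall>b\<in>B'. ?lv b \<le> int (?dg b)" using B'(1) F(3) Q1(3) by (force simp: \<pi>(1))
  moreover have "finite B'" using B'(1) F(2) Q1(2) by (auto intro: finite_subset)
  ultimately show ?thesis unfolding min_res_def using B'(2,3) by blast
qed

section \<open>Uniqueness of the Betti numbers\<close>

text \<open>If \<open>A\<close> were larger, padding both matrices with zeros to size
  \<open>card A\<close> would give square matrices with product 1. The product in the opposite order
  would be 1 as well, but its row \<open>?m\<close> is zero.\<close>

lemma card_le_of_left_inverse:
  fixes M :: "'a \<Rightarrow> 'b \<Rightarrow> 'k::field" and N :: "'b \<Rightarrow> 'a \<Rightarrow> 'k"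
  assumes fin: "finite A" "finite C"
    and MN: "\<And>a a'. a \<in> A \<Longrightarrow> a' \<in> A \<Longrightarrow> (\<Sum>c\<in>C. M a c * N c a') = (if a = a' then 1 else 0)"
  shows "card A \<le> card C"
proof (rule ccontr)
  let ?n = "card A" and ?m = "card C"
  assume "\<not> ?n \<le> ?m"
  then have mn: "?m < ?n" by simp
  obtain f where f: "bij_betw f {..<?n} A" using fin(1) ex_bij_betw_nat_finite lessThan_atLeast0 by metis
  obtain g where g: "bij_betw g {..<?m} C" using fin(2) ex_bij_betw_nat_finite lessThan_atLeast0 by metis
  define P where "P = mat ?n ?n (\<lambda>(i, j). if j < ?m then M (f i) (g j) else 0)"
  define Q where "Q = mat ?n ?n (\<lambda>(i, j). if i < ?m then N (g i) (f j) else 0)"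
  have P: "P \<in> carrier_mat ?n ?n" and Q: "Q \<in> carrier_mat ?n ?n" by (simp_all add: P_def Q_def)
  have "P * Q = 1\<^sub>m ?n"
  proof (rule eq_matI)
    fix i j assume "i < dim_row (1\<^sub>m ?n)" "j < dim_col (1\<^sub>m ?n)"
    then have ij: "i < ?n" "j < ?n" by auto
    have "(P * Q) $$ (i, j) = (\<Sum>k<?n. (if k < ?m then M (f i) (g k) else 0) * (if k < ?m then N (g k) (f j) else 0))"
      using ij P Q by (auto simp: scalar_prod_def P_def Q_def lessThan_atLeast0)
    also have "\<dots> = (\<Sum>k<?m. M (f i) (g k) * N (g k) (f j))"
      using mn by (intro sum.mono_neutral_cong_right) auto
    also have "\<dots> = (\<Sum>c\<in>C. M (f i) c * N c (f j))"
      by (rule sum.reindex_bij_betw[OF g])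
    also have "\<dots> = (if f i = f j then 1 else 0)"
      using ij f by (intro MN) (auto simp: bij_betw_def)
    also have "f i = f j \<longleftrightarrow> i = j" using ij f by (auto simp: bij_betw_def inj_on_def)
    finally show "(P * Q) $$ (i, j) = 1\<^sub>m ?n $$ (i, j)" using ij by simp
  qed (simp_all add: P_def Q_def)
  from mat_mult_left_right_inverse[OF P Q this] have "(Q * P) $$ (?m, ?m) = 1" using mn by simp
  moreover have "(Q * P) $$ (?m, ?m) = 0"
    using mn P Q by (auto simp: scalar_prod_def P_def Q_def)
  ultimately show False by simp
qed

abbreviation const_term :: "('v, 'k::field) mpoly \<Rightarrow> 'k" where
  "const_term p \<equiv> lookup p 0"

lemma const_term_lin:
  assumes "lin f"
  shows "const_term (lookup (f u) c) =
    (\<Sum>b\<in>keys u. const_term (lookup u b) * const_term (lookup (f (unit b)) c))"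
  unfolding lin_expand[OF assms, of u] by (simp add: lookup_sum mpoly_lookup_mult_0)

text \<open>The comparison maps in both directions compose to a map homotopic to the identity.
  Modulo the variables both homotopy terms vanish, since \<open>d\<close> has no constant entries;
  so the constant parts of the comparison maps are one-sided inverses of each other. Finiteness is
  asked for one level and degree at a time, because a resolution by matrices may have infinite
  length.\<close>

lemma gres_card_le:
  fixes d :: "(nat \<Rightarrow>\<^sub>0 ('v, 'k::field) mpoly) \<Rightarrow> (nat \<Rightarrow>\<^sub>0 ('v, 'k) mpoly)"
  assumes "gres V T J B lv dg d e" and "gres V T J B' lv' dg' d' e'" and min: "minimal B d"
    and fin: "finite {b \<in> B. lv b = i \<and> dg b = n}" "finite {b \<in> B'. lv' b = i \<and> dg' b = n}"
  shows "card {b \<in> B. lv b = i \<and> dg b = n} \<le> card {b \<in> B'. lv' b = i \<and> dg' b = n}"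
proof -
  interpret F: gres V T J B lv dg d e by fact
  interpret G: gres V T J B' lv' dg' d' e' by fact
  obtain f where lf: "lin f" and f: "\<And>b. b \<in> B \<Longrightarrow> f (unit b) \<in> Hm V B' lv' dg' (lv b) (dg b)"
    and df: "\<And>u. u \<in> Fr V B \<Longrightarrow> d' (f u) = 0 + f (d u)" and ef: "\<And>u. u \<in> Fr V B \<Longrightarrow> e' (f u) - e u \<in> J"
  proof (rule G.lift[where d''=d and \<alpha>="\<lambda>_. 0" and \<beta>=e and B'=B and lv'=lv and dg'=dg])
    show "-1 \<le> lv b" if "b \<in> B" for b using F.lv_nonneg[OF that] by simp
  qed (auto simp: F.lin_d F.linf_e F.d_unit F.dd_unit F.e_unit F.ed_unit smul2.module_hom_zero
      module_hom.zero[OF G.lin_d] module_hom.zero[OF G.linf_e])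
  obtain g where lg: "lin g" and g: "\<And>b. b \<in> B' \<Longrightarrow> g (unit b) \<in> Hm V B lv dg (lv' b) (dg' b)"
    and dg: "\<And>u. u \<in> Fr V B' \<Longrightarrow> d (g u) = 0 + g (d' u)" and eg: "\<And>u. u \<in> Fr V B' \<Longrightarrow> e (g u) - e' u \<in> J"
  proof (rule F.lift[where d''=d' and \<alpha>="\<lambda>_. 0" and \<beta>=e' and B'=B' and lv'=lv' and dg'=dg'])
    show "-1 \<le> lv' b" if "b \<in> B'" for b using G.lv_nonneg[OF that] by simp
  qed (auto simp: G.lin_d G.linf_e G.d_unit G.dd_unit G.e_unit G.ed_unit smul2.module_hom_zero
      module_hom.zero[OF F.lin_d] module_hom.zero[OF F.linf_e])
  have fFr: "f u \<in> Fr V B'" if "u \<in> Fr V B" for u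
    by (rule Fr_lin[OF lf that Hm_Fr[OF f]])
  have lgf: "lin (\<lambda>u. g (f u) - u)"
    by (intro smul2.module_hom_sub lin_comp[OF lg lf] smul.module_hom_ident)
  obtain h where lh: "lin h" and hHm: "\<And>b. b \<in> B \<Longrightarrow> h (unit b) \<in> Hm V B lv dg (lv b + 1) (dg b)"
    and dh: "\<And>u. u \<in> Fr V B \<Longrightarrow> d (h u) = g (f u) - u + h (- d u)"
  proof (rule F.lift[where d''="\<lambda>u. - d u" and \<alpha>="\<lambda>u. g (f u) - u" and \<beta>="\<lambda>_. 0" and B'=B
        and lv'="\<lambda>b. lv b + 1" and dg'=dg])
    show "-1 \<le> lv b + 1" if "b \<in> B" for b using F.lv_nonneg[OF that] by simp
    show "- d (unit b) \<in> Hm V B (\<lambda>b. lv b + 1) dg (lv b + 1 - 1) (dg b)" if "b \<in> B" for b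
      using Hm_uminus[OF Hm_mono[OF F.d_unit[OF that], where s=1 and k=0]] by simp
    show "g (f (unit b)) - unit b \<in> Hm V B lv dg (lv b + 1 - 1) (dg b)" if "b \<in> B" for b
      using Hm_lin[OF lg f[OF that], where k=0] g Hm_unit[OF that] by (auto intro!: Hm_minus)
    show "d (g (f (unit b)) - unit b) + (g (f (- d (unit b))) - - d (unit b)) = 0" if "b \<in> B" for b
      using dg[OF fFr[OF Fr_unit[OF that]]] df[OF Fr_unit[OF that]]
      by (simp add: module_hom.diff[OF F.lin_d] module_hom.neg[OF lf] module_hom.neg[OF lg])
    show "e (g (f (unit b)) - unit b) + 0 \<in> J" if "b \<in> B" for b
      using hidealD(3)[OF F.hJ eg[OF fFr[OF Fr_unit[OF that]]] ef[OF Fr_unit[OF that]]]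
      by (simp add: module_hom.diff[OF F.linf_e])
  qed (auto simp: smul2.module_hom_neg F.lin_d lgf smul1.module_hom_zero F.dd_unit
      module_hom.neg[OF F.lin_d] hidealD(2)[OF F.hT])
  have cd: "const_term (lookup (d u) c) = 0" if "u \<in> Fr V B" for u c
    unfolding const_term_lin[OF F.lin_d, of u] using min that
    by (intro sum.neutral) (auto simp: minimal_def Fr_def)
  have ch: "const_term (lookup (h (d (unit b))) c) = 0" if "b \<in> B" for b c
    unfolding const_term_lin[OF lh, of "d (unit b)"] using cd[OF Fr_unit[OF that]] by simp
  let ?A = "{b \<in> B. lv b = i \<and> dg b = n}" and ?C = "{b \<in> B'. lv' b = i \<and> dg' b = n}"
  show ?thesis
  proof (rule card_le_of_left_inverse[OF fin,
        where M="\<lambda>b c. const_term (lookup (f (unit b)) c)" and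
          N="\<lambda>c b. const_term (lookup (g (unit c)) b)"])
    fix a a' assume a: "a \<in> ?A" "a' \<in> ?A"
    then have aB: "a \<in> B" by simp
    show "(\<Sum>c\<in>?C. const_term (lookup (f (unit a)) c) * const_term (lookup (g (unit c)) a'))
      = (if a = a' then 1 else 0)" (is "?S = _")
    proof -
      let ?x = "f (unit a)"
      have x: "?x \<in> Hm V B' lv' dg' i n" using f[OF aB] a by simp
      have "const_term (lookup (g ?x) a') = (\<Sum>b\<in>keys ?x.
          const_term (lookup ?x b) * const_term (lookup (g (unit b)) a'))"
        by (rule const_term_lin[OF lg])
      also have "\<dots> = ?S"
      \<comment> \<open>A homogeneous coefficient of positive degree has no constant term, so only
        basis elements of degree \<open>n\<close> itself contribute.\<close>
      proof (rule sum.mono_neutral_cong[OF fin(2) finite_keys])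
        fix c assume c: "c \<in> keys ?x - ?C"
        then have "c \<in> B'" "lv' c = i" "dg' c \<le> n" "homog (n - dg' c) (lookup ?x c)"
          using x by (auto simp: Hm_def Fr_def)
        with c have "const_term (lookup ?x c) = 0" using homog_const_term[of "n - dg' c"] by auto
        then show "const_term (lookup ?x c) * const_term (lookup (g (unit c)) a') = 0" by simp
      qed (auto simp: in_keys_iff)
      finally have S: "?S = const_term (lookup (g ?x) a')" ..
      have "g ?x = unit a + d (h (unit a)) + h (d (unit a))"
        using dh[OF Fr_unit[OF aB]] by (simp add: module_hom.neg[OF lh])
      moreover have "const_term (lookup (d (h (unit a))) a') = 0"
        by (rule cd[OF Hm_Fr[OF hHm[OF aB]]])
      ultimately show ?thesis
        using S ch[OF aB] by (simp add: lookup_add lookup_single when_def)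
    qed
  qed
qed


section \<open>Passing between matrices and bases\<close>

definition coords :: "nat list \<Rightarrow> (nat \<Rightarrow>\<^sub>0 ('v, 'k::field) mpoly) \<Rightarrow> ('v, 'k) mpoly vec" where
  "coords bs u = vec (length bs) (\<lambda>r. lookup u (bs ! r))"

definition combination :: "nat list \<Rightarrow> ('v, 'k::field) mpoly vec \<Rightarrow> (nat \<Rightarrow>\<^sub>0 ('v, 'k) mpoly)" where
  "combination bs w = (\<Sum>c<length bs. single (bs ! c) (w $ c))"

lemma lookup_combination:
  assumes "distinct bs" "r < length bs"
  shows "lookup (combination bs w) (bs ! r) = w $ r"
proof -
  have "lookup (combination bs w) (bs ! r) = (\<Sum>c<length bs. if c = r then w $ c else 0)"
    unfolding combination_def lookup_sum
    by (rule sum.cong) (use assms in \<open>auto simp: lookup_single when_def nth_eq_iff_index_eq\<close>)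
  then show ?thesis using assms by simp
qed

lemma lookup_combination_0: "b \<notin> set bs \<Longrightarrow> lookup (combination bs w) b = 0"
  unfolding combination_def lookup_sum
  by (rule sum.neutral) (auto simp: lookup_single when_def)

lemma coords_combination:
  "distinct bs \<Longrightarrow> w \<in> carrier_vec (length bs) \<Longrightarrow> coords bs (combination bs w) = w"
  by (rule eq_vecI) (auto simp: coords_def lookup_combination)

lemma combination_Fr:
  "distinct bs \<Longrightarrow> w \<in> free_module V (length bs) \<Longrightarrow> set bs \<subseteq> B \<Longrightarrow> combination bs w \<in> Fr V B"
proof -
  assume *: "distinct bs" "w \<in> free_module V (length bs)" "set bs \<subseteq> B"
  have "lookup (combination bs w) b \<in> polys V" for b
  proof (cases "b \<in> set bs")
    case True
    then obtain r where "r < length bs" "b = bs ! r" by (auto simp: in_set_conv_nth)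
    then show ?thesis using * by (auto simp: lookup_combination free_module_def)
  qed (simp add: lookup_combination_0)
  moreover have "keys (combination bs w) \<subseteq> B"
    using *(3) lookup_combination_0 by (fastforce simp: in_keys_iff)
  ultimately show "combination bs w \<in> Fr V B" by (simp add: Fr_def)
qed

lemma coords_free_module: "u \<in> Fr V B \<Longrightarrow> coords bs u \<in> free_module V (length bs)"
  by (auto simp: coords_def free_module_def Fr_def)

lemma coords_lin:
  assumes f: "lin f" and A: "A \<in> carrier_mat (length bs) (length cs)"
    and ent: "\<And>r c. r < length bs \<Longrightarrow> c < length cs \<Longrightarrow>
      A $$ (r, c) = lookup (f (unit (cs ! c))) (bs ! r)"
    and cs: "distinct cs"
    and out: "\<And>b r. b \<in> keys u \<Longrightarrow> b \<notin> set cs \<Longrightarrow> r < length bs \<Longrightarrow>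
      lookup (f (unit b)) (bs ! r) = 0"
  shows "coords bs (f u) = A *\<^sub>v coords cs u"
proof (rule eq_vecI)
  fix r assume "r < dim_vec (A *\<^sub>v coords cs u)"
  then have r: "r < length bs" using A by simp
  have "coords bs (f u) $ r = (\<Sum>b\<in>keys u. lookup u b * lookup (f (unit b)) (bs ! r))"
    unfolding lin_expand[OF f, of u] using r by (simp add: coords_def lookup_sum)
  also have "\<dots> = (\<Sum>b\<in>set cs. lookup u b * lookup (f (unit b)) (bs ! r))"
    by (rule sum.mono_neutral_cong[OF finite_set finite_keys]) (use out r in \<open>auto simp: in_keys_iff\<close>)
  also have "\<dots> = (\<Sum>c<length cs. lookup u (cs ! c) * lookup (f (unit (cs ! c))) (bs ! r))"
    by (rule sum.reindex_bij_betw[symmetric, OF bij_betw_nth]) (use cs in auto)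
  also have "\<dots> = (A *\<^sub>v coords cs u) $ r"
    using r A by (auto simp: scalar_prod_def coords_def ent lessThan_atLeast0 mult.commute intro!: sum.cong)
  finally show "coords bs (f u) $ r = (A *\<^sub>v coords cs u) $ r" .
qed (use A in \<open>simp add: coords_def\<close>)

lemma count_list_map:
  assumes "distinct bs"
  shows "count_list (map f bs) n = card {b \<in> set bs. f b = n}"
proof -
  have "count_list (map f bs) n = length (filter (\<lambda>b. f b = n) bs)"
    by (induction bs) auto
  also have "\<dots> = card (set (filter (\<lambda>b. f b = n) bs))"
    using assms distinct_card[of "filter (\<lambda>b. f b = n) bs"] by simp
  finally show ?thesis by simp
qed

text \<open>Listing the basis elements of each level turns the total complex into a sequence of
  matrices. Levels beyond the finite basis give empty lists, so the sequence continues by zero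
  modules.\<close>

lemma (in gres) matrix_resolution:
  assumes T: "T = polys V" and B: "finite B" "minimal B d"
    and b0: "b0 \<in> B" "\<And>b. b \<in> B \<Longrightarrow> lv b = 0 \<longleftrightarrow> b = b0" "dg b0 = 0" "e (unit b0) = 1"
  shows "\<exists>D A. minimal_graded_free_resolution V J D A \<and>
    (\<forall>i n. count_list (D i) n = card {b \<in> B. lv b = int i \<and> dg b = n})"
proof -
  define bs where "bs i = sorted_list_of_set {b \<in> B. lv b = int i}" for i
  have set_bs: "set (bs i) = {b \<in> B. lv b = int i}" and dist: "distinct (bs i)" for i
    using B(1) by (auto simp: bs_def)
  have nth: "bs i ! r \<in> B" "lv (bs i ! r) = int i" if "r < length (bs i)" for i r
    using nth_mem[OF that] set_bs[of i] by auto
  define D where "D i = map dg (bs i)" for i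
  define A where "A i = mat (length (bs i)) (length (bs (Suc i)))
      (\<lambda>(r, c). lookup (d (unit (bs (Suc i) ! c))) (bs i ! r))" for i
  have lenD [simp]: "length (D i) = length (bs i)" for i by (simp add: D_def)
  have A_carrier: "A i \<in> carrier_mat (length (bs i)) (length (bs (Suc i)))" for i by (simp add: A_def)
  have bs0: "bs 0 = [b0]"
  proof -
    have "{b \<in> B. lv b = int 0} = {b0}" using b0(1,2) by auto
    then show ?thesis by (simp add: bs_def)
  qed
  have Ad: "coords (bs i) (d u) = A i *\<^sub>v coords (bs (Suc i)) u" if u: "u \<in> Fr V B" for i u
  proof (rule coords_lin[OF lin_d A_carrier _ dist])
    fix b r assume b: "b \<in> keys u" "b \<notin> set (bs (Suc i))" and r: "r < length (bs i)"
    then have "b \<in> B" "lv b \<noteq> int (Suc i)" using u set_bs by (auto simp: Fr_def)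
    then have "lv (bs i ! r) \<noteq> lv b - 1" using nth(2)[OF r] by simp
    then show "lookup (d (unit b)) (bs i ! r) = 0"
      using d_unit[OF \<open>b \<in> B\<close>] by (auto simp: Hm_def in_keys_iff)
  qed (simp add: A_def)
  have eu: "e u = lookup u b0" if u: "u \<in> Fr V B" for u
  proof -
    have "linf (\<lambda>u. lookup u b0 :: ('v, 'k) mpoly)"
      by (rule linfI) (auto simp: lookup_add)
    then show ?thesis
      by (rule linf_eqI_Fr[OF linf_e _ u]) (use b0 e_unit(3) in \<open>auto simp: lookup_single when_def\<close>)
  qed
  have comb: "combination (bs i) w \<in> Fr V B" "coords (bs i) (combination (bs i) w) = w"
    "keys (combination (bs i) w) \<subseteq> {b. lv b = int i}"
    if "w \<in> free_module V (length (bs i))" for w i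
  proof -
    show "combination (bs i) w \<in> Fr V B"
      by (rule combination_Fr[OF dist that]) (auto simp: set_bs)
    show "coords (bs i) (combination (bs i) w) = w"
      by (rule coords_combination[OF dist]) (use that in \<open>simp add: free_module_def\<close>)
    have "keys (combination (bs i) w) \<subseteq> set (bs i)"
      using lookup_combination_0 by (fastforce simp: in_keys_iff)
    then show "keys (combination (bs i) w) \<subseteq> {b. lv b = int i}" by (auto simp: set_bs)
  qed
  have A_Fr: "A i *\<^sub>v w \<in> free_module V (length (bs i))"
    if "w \<in> free_module V (length (bs (Suc i)))" for w i
  proof -
    have "A i *\<^sub>v w = coords (bs i) (d (combination (bs (Suc i)) w))"
      using Ad[OF comb(1)[OF that], of i] comb(2)[OF that] by simp
    then show ?thesis using coords_free_module[OF d_Fr[OF comb(1)[OF that]], of "bs i"] by simp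
  qed
  have "graded_map V (D i) (D (Suc i)) (A i)" for i
    unfolding graded_map_def
  proof (intro conjI allI impI)
    fix r c assume rc: "r < length (D i)" "c < length (D (Suc i))"
    let ?b = "bs (Suc i) ! c"
    have b: "?b \<in> B" using nth rc by simp
    have ent: "A i $$ (r, c) = lookup (d (unit ?b)) (bs i ! r)" using rc by (simp add: A_def)
    show "A i $$ (r, c) \<in> polys V" unfolding ent using Hm_Fr[OF d_unit[OF b]] by (simp add: Fr_def)
    show "\<forall>m\<in>keys (A i $$ (r, c)). mon_degree m + D i ! r = D (Suc i) ! c"
    proof
      fix m assume m: "m \<in> keys (A i $$ (r, c))"
      then have "bs i ! r \<in> keys (d (unit ?b))" unfolding ent by (auto simp: in_keys_iff)
      then have "dg (bs i ! r) \<le> dg ?b" "homog (dg ?b - dg (bs i ! r)) (A i $$ (r, c))"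
        using d_unit[OF b] unfolding ent by (auto simp: Hm_def)
      then show "mon_degree m + D i ! r = D (Suc i) ! c" using m rc by (simp add: homog_def D_def)
    qed
  qed (simp add: A_def)
  moreover have "D 0 = [0]" by (simp add: D_def bs0 b0)
  moreover have "{(A 0 *\<^sub>v u) $ 0 | u. u \<in> free_module V (length (D 1))} = J"
  proof (intro equalityI subsetI)
    fix p assume "p \<in> {(A 0 *\<^sub>v u) $ 0 | u. u \<in> free_module V (length (D 1))}"
    then obtain w where w: "w \<in> free_module V (length (bs (Suc 0)))" "p = (A 0 *\<^sub>v w) $ 0" by auto
    let ?u = "combination (bs (Suc 0)) w"
    have "p = coords (bs 0) (d ?u) $ 0" using Ad[OF comb(1)[OF w(1)]] comb(2)[OF w(1)] w(2) by simp
    also have "\<dots> = e (d ?u)" by (simp add: coords_def bs0 eu[OF d_Fr[OF comb(1)[OF w(1)]]])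
    also have "\<dots> \<in> J" by (rule ed[OF comb(1)[OF w(1)]])
    finally show "p \<in> J" .
  next
    fix p assume p: "p \<in> J"
    let ?u = "smul p (unit b0)"
    have u: "?u \<in> Fr V B" by (intro Fr_smul Fr_unit b0(1) hidealD(1)[OF hJ p])
    have "d (unit b0) = 0" using Hm_neg[OF _ d_unit[OF b0(1)]] b0(2)[OF b0(1)] by auto
    then have "d ?u = 0" by (simp only: module_hom.scale[OF lin_d]) simp
    moreover have "e ?u = p" by (simp add: module_hom.scale[OF linf_e] b0(4))
    ultimately obtain v where v: "v \<in> Fr V B" "?u = d v" using exact[OF u] p by auto
    have "p = coords (bs 0) (d v) $ 0" by (simp add: coords_def bs0 v(2)[symmetric])
    also have "\<dots> = (A 0 *\<^sub>v coords (bs (Suc 0)) v) $ 0" by (simp only: Ad[OF v(1)])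
    finally show "p \<in> {(A 0 *\<^sub>v u) $ 0 | u. u \<in> free_module V (length (D 1))}"
      using coords_free_module[OF v(1), of "bs (Suc 0)"] by auto
  qed
  moreover have "{A (Suc i) *\<^sub>v u | u. u \<in> free_module V (length (D (Suc (Suc i))))} =
      {u \<in> free_module V (length (D (Suc i))). A i *\<^sub>v u = 0\<^sub>v (length (D i))}" for i
  proof (intro equalityI subsetI)
    fix x assume "x \<in> {A (Suc i) *\<^sub>v u | u. u \<in> free_module V (length (D (Suc (Suc i))))}"
    then obtain w where w: "w \<in> free_module V (length (bs (Suc (Suc i))))" "x = A (Suc i) *\<^sub>v w" by auto
    let ?u = "combination (bs (Suc (Suc i))) w"
    note u = comb(1)[OF w(1)]
    have "x = coords (bs (Suc i)) (d ?u)" using Ad[OF u] comb(2)[OF w(1)] w(2) by simp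
    then have "A i *\<^sub>v x = coords (bs i) (d (d ?u))" using Ad[OF d_Fr[OF u]] by simp
    also have "\<dots> = 0\<^sub>v (length (bs i))" by (rule eq_vecI) (simp_all add: dd[OF u] coords_def)
    finally show "x \<in> {u \<in> free_module V (length (D (Suc i))). A i *\<^sub>v u = 0\<^sub>v (length (D i))}"
      using A_Fr[OF w(1)] w(2) by simp
  next
    fix w assume "w \<in> {u \<in> free_module V (length (D (Suc i))). A i *\<^sub>v u = 0\<^sub>v (length (D i))}"
    then have w: "w \<in> free_module V (length (bs (Suc i)))" "A i *\<^sub>v w = 0\<^sub>v (length (bs i))" by auto
    let ?u = "combination (bs (Suc i)) w"
    note u = comb(1)[OF w(1)]
    have 0: "coords (bs i) (d ?u) = 0\<^sub>v (length (bs i))" using Ad[OF u] comb(2)[OF w(1)] w(2) by simp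
    have k: "b \<in> B" "lv b = int (Suc i)" if "b \<in> keys ?u" for b
      using comb(1,3)[OF w(1)] that by (auto simp: Fr_def)
    \<comment> \<open>The vanishing coordinates account for the elements of level \<open>i\<close>;
      all other entries are zero because \<open>?u\<close> lives at level
      \<open>i + 1\<close>.\<close>
    have "lookup (d ?u) b = 0" for b
    proof (cases "b \<in> set (bs i)")
      case True
      then obtain r where "r < length (bs i)" "b = bs i ! r" by (auto simp: in_set_conv_nth)
      then show ?thesis using arg_cong[OF 0, of "\<lambda>x. x $ r"] by (simp add: coords_def)
    next
      case False
      have "lookup (d (unit c)) b = 0" if "c \<in> keys ?u" for c
      proof (rule ccontr)
        assume "lookup (d (unit c)) b \<noteq> 0"
        then have "b \<in> B" "lv b = lv c - 1"
          using d_unit[OF k(1)[OF that]] by (auto simp: Hm_def Fr_def in_keys_iff)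
        then show False using False k(2)[OF that] by (simp add: set_bs)
      qed
      then show ?thesis unfolding lin_expand[OF lin_d, of ?u] by (simp add: lookup_sum)
    qed
    then have "d ?u = 0" by (intro poly_mapping_eqI[of _ 0]) simp
    moreover have "e ?u = 0"
      unfolding linf_expand[OF linf_e, of ?u] using k e_unit(3) by (intro sum.neutral) auto
    ultimately obtain v where v: "v \<in> Fr V B" "?u = d v" using exact[OF u] hidealD(2)[OF hJ] by auto
    have "w = coords (bs (Suc i)) (d v)" using comb(2)[OF w(1)] v(2) by simp
    also have "\<dots> = A (Suc i) *\<^sub>v coords (bs (Suc (Suc i))) v" by (rule Ad[OF v(1)])
    finally show "w \<in> {A (Suc i) *\<^sub>v u | u. u \<in> free_module V (length (D (Suc (Suc i))))}"
      using coords_free_module[OF v(1), of "bs (Suc (Suc i))"] by auto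
  qed
  ultimately have "graded_free_resolution V J D A"
    unfolding graded_free_resolution_def by simp
  moreover have "lookup (A i $$ (r, c)) 0 = 0" if "r < length (D i)" "c < length (D (Suc i))" for i r c
    using that B(2) nth(1)[of c "Suc i"] by (simp add: A_def minimal_def)
  ultimately have "minimal_graded_free_resolution V J D A"
    unfolding minimal_graded_free_resolution_def by blast
  moreover have "count_list (D i) n = card {b \<in> B. lv b = int i \<and> dg b = n}" for i n
    unfolding D_def count_list_map[OF dist] set_bs by (rule arg_cong[of _ _ card]) auto
  ultimately show ?thesis by blast
qed

text \<open>The \<open>r\<close>-th basis element in homological degree \<open>i\<close> is encoded as the number of the pair
  \<open>(i, r)\<close>. The total complex has an infinite basis, so the exactness statement uses that a vector
  has finite support.\<close>

lemma gres_of_matrices: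
  fixes I :: "('v, 'k::field) mpoly set"
  assumes res: "minimal_graded_free_resolution V I D A" and I: "hideal V I"
  defines "B \<equiv> {prod_encode (i, r) | i r. r < length (D i)}"
    and "lv \<equiv> \<lambda>b. int (fst (prod_decode b))"
    and "dg \<equiv> \<lambda>b. D (fst (prod_decode b)) ! snd (prod_decode b)"
  shows "\<exists>d e. gres V (polys V) I B lv dg d e \<and> minimal B d"
    "finite {b \<in> B. lv b = int i \<and> dg b = n}"
    "card {b \<in> B. lv b = int i \<and> dg b = n} = count_list (D i) n"
proof -
  let ?enc = "\<lambda>i r. prod_encode (i, r)"
  define bs where "bs i = map (?enc i) [0..<length (D i)]" for i
  have len [simp]: "length (bs i) = length (D i)" for i by (simp add: bs_def)
  have nth: "bs i ! r = ?enc i r" if "r < length (D i)" for i r using that by (simp add: bs_def)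
  have dist: "distinct (bs i)" for i by (auto simp: bs_def distinct_map inj_on_def prod_encode_eq)
  have set_bs: "set (bs i) = {b \<in> B. lv b = int i}" for i
    by (auto simp: bs_def B_def lv_def)
  have set_B: "set (bs i) \<subseteq> B" for i by (auto simp: set_bs)
  have mem: "?enc i r \<in> B \<longleftrightarrow> r < length (D i)" for i r by (auto simp: B_def prod_encode_eq)
  have lv_enc [simp]: "lv (?enc i r) = int i" and dg_enc [simp]: "dg (?enc i r) = D i ! r" for i r
    by (simp_all add: lv_def dg_def)
  have level: "{b \<in> B. lv b = int i \<and> dg b = n} = {b \<in> set (bs i). dg b = n}"
    by (auto simp: set_bs)
  show "finite {b \<in> B. lv b = int i \<and> dg b = n}" unfolding level by simp
  have "map dg (bs i) = D i"
    by (rule nth_equalityI) (simp_all add: nth)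
  then show "card {b \<in> B. lv b = int i \<and> dg b = n} = count_list (D i) n"
    unfolding level using count_list_map[OF dist, of dg i n] by simp
  have D0: "D 0 = [0]" and gm: "\<And>i. graded_map V (D i) (D (Suc i)) (A i)"
    and im0: "{(A 0 *\<^sub>v u) $ 0 | u. u \<in> free_module V (length (D 1))} = I"
    and im: "\<And>i. {A (Suc i) *\<^sub>v u | u. u \<in> free_module V (length (D (Suc (Suc i))))} =
          {u \<in> free_module V (length (D (Suc i))). A i *\<^sub>v u = 0\<^sub>v (length (D i))}"
    and mini: "\<And>i r c. r < length (D i) \<Longrightarrow> c < length (D (Suc i)) \<Longrightarrow> const_term (A i $$ (r, c)) = 0"
    using res unfolding minimal_graded_free_resolution_def graded_free_resolution_def by auto
  have Ac: "A i \<in> carrier_mat (length (D i)) (length (D (Suc i)))" for i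
    using gm[of i] by (simp add: graded_map_def)
  \<comment> \<open>The boundary of a basis element is the corresponding matrix column. Level 0 and
    numbers that encode no basis element get the value 0.\<close>
  define X where "X b = (case prod_decode b of (i, c) \<Rightarrow>
    if i = 0 \<or> c \<ge> length (D i) then 0 else combination (bs (i - 1)) (col (A (i - 1)) c))" for b
  define d where "d = ext X"
  define e where "e = (\<lambda>u. lookup u (?enc 0 0) :: ('v, 'k) mpoly)"
  have lin_d: "lin d" by (simp add: d_def)
  have linf_e: "linf e" unfolding e_def by (rule linfI) (auto simp: lookup_add)
  have X: "d (unit b) = X b" for b by (simp add: d_def)
  have ent: "lookup (X (?enc (Suc i) c)) (?enc i r) = A i $$ (r, c)"
    if "r < length (D i)" "c < length (D (Suc i))" for i r c
  proof -
    have "lookup (X (?enc (Suc i) c)) (bs i ! r) = A i $$ (r, c)"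
      using that Ac[of i] by (simp add: X_def lookup_combination[OF dist])
    then show ?thesis using that by (simp add: nth)
  qed
  have Xk: "\<exists>i r c. b = ?enc (Suc i) c \<and> c < length (D (Suc i)) \<and> k = ?enc i r \<and> r < length (D i)"
    if nz: "lookup (X b) k \<noteq> 0" for b k
  proof -
    obtain j c where b: "b = ?enc j c" by (metis prod.collapse prod_decode_inverse)
    with nz have jc: "j \<noteq> 0" "c < length (D j)"
      "lookup (combination (bs (j - 1)) (col (A (j - 1)) c)) k \<noteq> 0"
      by (auto simp: X_def split: if_splits)
    then have "k \<in> set (bs (j - 1))" using lookup_combination_0 by blast
    then obtain r where "k = ?enc (j - 1) r" "r < length (D (j - 1))" by (auto simp: bs_def)
    moreover obtain i where "j = Suc i" using jc(1) not0_implies_Suc by blast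
    ultimately show ?thesis using b jc(2) by auto
  qed
  have FrX: "X b \<in> Fr V B" for b
  proof -
    have "lookup (X b) k \<in> polys V \<and> (lookup (X b) k \<noteq> 0 \<longrightarrow> k \<in> B)" for k
    proof (cases "lookup (X b) k = 0")
      case False
      from Xk[OF this] obtain i r c where *: "b = ?enc (Suc i) c" "c < length (D (Suc i))" "k = ?enc i r"
        "r < length (D i)" by blast
      then show ?thesis using gm[of i] by (simp add: ent mem graded_map_def)
    qed simp
    then show ?thesis by (auto simp: Fr_def in_keys_iff)
  qed
  have d_Fr: "d u \<in> Fr V B" if "u \<in> Fr V B" for u
    by (rule Fr_lin[OF lin_d that]) (simp add: X FrX)
  have Ad: "coords (bs i) (d u) = A i *\<^sub>v coords (bs (Suc i)) u" for i u
  proof (rule coords_lin[OF lin_d])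
    show "A i \<in> carrier_mat (length (bs i)) (length (bs (Suc i)))" using Ac by simp
    show "A i $$ (r, c) = lookup (d (unit (bs (Suc i) ! c))) (bs i ! r)"
      if "r < length (bs i)" "c < length (bs (Suc i))" for r c
      using that by (simp add: nth X ent)
    show "lookup (d (unit b)) (bs i ! r) = 0"
      if "b \<notin> set (bs (Suc i))" "r < length (bs i)" for b r
    proof (rule ccontr)
      assume "lookup (d (unit b)) (bs i ! r) \<noteq> 0"
      with that(2) have "lookup (X b) (?enc i r) \<noteq> 0" by (simp add: X nth)
      from Xk[OF this] that(1) show False by (auto simp: bs_def prod_encode_eq)
    qed
  qed (rule dist)
  have eqI: "u = v" if uv: "u \<in> Fr V B" "v \<in> Fr V B" "\<And>i. coords (bs i) u = coords (bs i) v"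
    for u v :: "nat \<Rightarrow>\<^sub>0 ('v, 'k) mpoly"
  proof (rule poly_mapping_eqI)
    fix b
    show "lookup u b = lookup v b"
    proof (cases "b \<in> B")
      case True
      then obtain i r where b: "b = ?enc i r" "r < length (D i)" by (auto simp: B_def)
      then show ?thesis
        using arg_cong[OF uv(3)[of i], of "\<lambda>w. w $ r"] by (simp add: coords_def nth)
    next
      case False
      then have "b \<notin> keys u" "b \<notin> keys v" using uv(1,2) by (auto simp: Fr_def)
      then show ?thesis by (simp add: in_keys_iff)
    qed
  qed
  have coords_fm: "coords (bs i) u \<in> free_module V (length (D i))" if "u \<in> Fr V B" for i u
    using coords_free_module[OF that, of "bs i"] by simp
  have coords0: "coords (bs i) (0 :: nat \<Rightarrow>\<^sub>0 ('v, 'k) mpoly) = 0\<^sub>v (length (D i))" for i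
    by (rule eq_vecI) (simp_all add: coords_def)
  have dd: "d (d u) = 0" if u: "u \<in> Fr V B" for u
  proof (rule eqI[OF d_Fr[OF d_Fr[OF u]] Fr_0])
    fix i
    have "A (Suc i) *\<^sub>v coords (bs (Suc (Suc i))) u \<in> {A (Suc i) *\<^sub>v u | u. u \<in> free_module V (length (D (Suc (Suc i))))}"
      using coords_fm[OF u] by blast
    then show "coords (bs i) (d (d u)) = coords (bs i) 0"
      unfolding im by (simp add: Ad coords0)
  qed
  have e_coords: "e u = coords (bs 0) u $ 0" for u
    using D0 nth[of 0 0] by (simp add: e_def coords_def)
  have ed: "e (d u) \<in> I" if u: "u \<in> Fr V B" for u
    unfolding im0[symmetric] e_coords Ad using coords_fm[OF u, of 1] by auto
  have ex: "\<exists>v\<in>Fr V B. u = d v" if u: "u \<in> Fr V B" "d u = 0" "e u \<in> I" for u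
  proof -
    \<comment> \<open>At level 0 the preimage comes from \<open>e u \<in> I\<close>, at positive
      levels from the vanishing of the differential one level below.\<close>
    have "\<exists>w. w \<in> free_module V (length (D (Suc i))) \<and> coords (bs i) u = A i *\<^sub>v w" for i
    proof (cases i)
      case 0
      obtain w where w: "w \<in> free_module V (length (D 1))" "e u = (A 0 *\<^sub>v w) $ 0"
        using u(3) unfolding im0[symmetric] by blast
      have "coords (bs 0) u = A 0 *\<^sub>v w"
      proof (rule eq_vecI)
        show "coords (bs 0) u $ j = (A 0 *\<^sub>v w) $ j" if "j < dim_vec (A 0 *\<^sub>v w)" for j
          using that w(2) Ac[of 0] D0 by (simp add: e_coords)
      qed (use Ac[of 0] in \<open>simp add: coords_def\<close>)
      then show ?thesis using w(1) 0 by auto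
    next
      case (Suc j)
      have "coords (bs (Suc j)) u \<in> {u \<in> free_module V (length (D (Suc j))). A j *\<^sub>v u = 0\<^sub>v (length (D j))}"
        using coords_fm[OF u(1)] Ad[of j u] by (simp add: u(2) coords0)
      then show ?thesis unfolding im[symmetric] Suc by auto
    qed
    then obtain W where W: "\<And>i. W i \<in> free_module V (length (D (Suc i)))"
      "\<And>i. coords (bs i) u = A i *\<^sub>v W i" by metis
    obtain N where N: "\<And>b. b \<in> keys u \<Longrightarrow> fst (prod_decode b) < N"
      using finite_nat_set_iff_bounded[of "(\<lambda>b. fst (prod_decode b)) ` keys u"] by auto
    define v where "v = (\<Sum>i<N. combination (bs (Suc i)) (W i))"
    have v: "v \<in> Fr V B" unfolding v_def
      by (intro Fr_sum combination_Fr dist set_B) (use W(1) in simp)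
    have cv: "coords (bs (Suc i)) v = (if i < N then W i else 0\<^sub>v (length (D (Suc i))))" for i
    proof (rule eq_vecI)
      fix r assume "r < dim_vec (if i < N then W i else 0\<^sub>v (length (D (Suc i))))"
      then have r: "r < length (D (Suc i))" using W(1)[of i] by (auto simp: free_module_def split: if_splits)
      have "lookup (combination (bs (Suc j)) (W j)) (?enc (Suc i) r) = (if j = i then W i $ r else 0)" for j
      proof (cases "j = i")
        case True
        then show ?thesis using lookup_combination[OF dist, of r "Suc i"] r by (simp add: nth)
      next
        case False
        then show ?thesis by (simp add: lookup_combination_0 bs_def prod_encode_eq image_iff)
      qed
      then show "coords (bs (Suc i)) v $ r = (if i < N then W i else 0\<^sub>v (length (D (Suc i)))) $ r"
        using r by (simp add: coords_def nth v_def lookup_sum)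
    qed (use W(1)[of i] in \<open>auto simp: coords_def free_module_def\<close>)
    have "u = d v"
    proof (rule eqI[OF u(1) d_Fr[OF v]])
      fix i
      show "coords (bs i) u = coords (bs i) (d v)"
      proof (cases "i < N")
        case False
        have "coords (bs i) u = 0\<^sub>v (length (D i))"
        proof (rule eq_vecI)
          fix r assume "r < dim_vec (0\<^sub>v (length (D i)) :: ('v, 'k) mpoly vec)"
          then have r: "r < length (D i)" by simp
          have "?enc i r \<notin> keys u" using N False by fastforce
          then show "coords (bs i) u $ r = 0\<^sub>v (length (D i)) $ r"
            using r by (simp add: coords_def nth in_keys_iff)
        qed (simp add: coords_def)
        moreover have "A i *\<^sub>v 0\<^sub>v (length (D (Suc i))) = 0\<^sub>v (length (D i))"
          using Ac[of i] by (intro eq_vecI) auto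
        ultimately show ?thesis using False by (simp add: Ad cv)
      qed (simp add: Ad cv W(2))
    qed
    then show ?thesis using v by blast
  qed
  have "gres V (polys V) I B lv dg d e"
  proof (rule gres.intro)
    show "d (unit b) \<in> Hm V B lv dg (lv b - 1) (dg b)" for b
    proof -
      have "lv k = lv b - 1 \<and> dg k \<le> dg b \<and> homog (dg b - dg k) (lookup (X b) k)"
        if k: "k \<in> keys (X b)" for k
      proof -
        have nz: "lookup (X b) k \<noteq> 0" using k by (simp add: in_keys_iff)
        from Xk[OF nz] obtain i r c where *: "b = ?enc (Suc i) c" "c < length (D (Suc i))" "k = ?enc i r"
          "r < length (D i)" by blast
        have deg: "mon_degree m + dg k = dg b" if "m \<in> keys (lookup (X b) k)" for m
          using gm[of i] that * by (simp add: graded_map_def ent)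
        obtain m where "m \<in> keys (lookup (X b) k)"
          using nz keys_eq_empty by blast
        from deg[OF this] have "dg k \<le> dg b" by simp
        then show ?thesis using deg * by (force simp: homog_def)
      qed
      then show ?thesis using FrX by (simp add: Hm_def X)
    qed
    show "homog (dg b) (e (unit b))" for b
      by (cases "b = ?enc 0 0") (simp_all add: e_def lookup_single when_def D0)
    show "e (unit b) = 0" if "b \<in> B" "lv b \<noteq> 0" for b
      using that by (auto simp: e_def lookup_single when_def)
    show "\<exists>u\<in>Fr V B. t - e u \<in> I" if t: "t \<in> polys V" for t
    proof (rule bexI[of _ "smul t (unit (?enc 0 0))"])
      show "smul t (unit (?enc 0 0)) \<in> Fr V B"
        using D0 by (intro Fr_smul[OF t] Fr_unit) (simp add: mem)
      show "t - e (smul t (unit (?enc 0 0))) \<in> I" using hidealD(2)[OF I] by (simp add: e_def)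
    qed
    show "d (d (unit b)) = 0" if "b \<in> B" for b by (rule dd[OF Fr_unit[OF that]])
    show "e (d (unit b)) \<in> I" if "b \<in> B" for b by (rule ed[OF Fr_unit[OF that]])
    show "\<exists>v\<in>Fr V B. u = d v" if "u \<in> Fr V B" "d u = 0" "e u \<in> I" for u by (rule ex[OF that])
    show "e (unit b) \<in> polys V" for b by (simp add: e_def lookup_single when_def)
  qed (use I hideal_polys lin_d linf_e in \<open>auto simp: lv_def dest: hidealD(1)\<close>)
  moreover have "minimal B d"
    unfolding minimal_def
  proof (intro ballI allI)
    fix b k
    show "const_term (lookup (d (unit b)) k) = 0"
    proof (cases "lookup (X b) k = 0")
      case False
      from Xk[OF this] obtain i r c where *: "b = ?enc (Suc i) c" "c < length (D (Suc i))" "k = ?enc i r"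
        "r < length (D i)" by blast
      then show ?thesis using mini by (simp add: X ent)
    qed (simp add: X)
  qed
  ultimately show "\<exists>d e. gres V (polys V) I B lv dg d e \<and> minimal B d" by blast
qed

section \<open>Betti numbers and strands read off from a complex with a basis\<close>

lemma betti_eq_card:
  fixes J :: "('v, 'k::field) mpoly set"
  assumes g: "gres V (polys V) J B lv dg d e" and B: "finite B" "minimal B d"
    and b0: "b0 \<in> B" "\<And>b. b \<in> B \<Longrightarrow> lv b = 0 \<longleftrightarrow> b = b0" "dg b0 = 0" "e (unit b0) = 1"
  shows "betti V J i n = card {b \<in> B. lv b = int i \<and> dg b = n}"
  unfolding betti_def
proof (rule the_equality)
  obtain D A where "minimal_graded_free_resolution V J D A"
    "count_list (D i) n = card {b \<in> B. lv b = int i \<and> dg b = n}"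
    using gres.matrix_resolution[OF g refl B b0] by blast
  then show "\<exists>D A. minimal_graded_free_resolution V J D A \<and> card {b \<in> B. lv b = int i \<and> dg b = n} = count_list (D i) n"
    by metis
next
  fix m assume "\<exists>D A. minimal_graded_free_resolution V J D A \<and> m = count_list (D i) n"
  then obtain D A where DA: "minimal_graded_free_resolution V J D A" "m = count_list (D i) n" by blast
  note * = gres_of_matrices[OF DA(1) gres.hJ[OF g]]
  obtain d' e' where **: "gres V (polys V) J {prod_encode (i, r) |i r. r < length (D i)}
      (\<lambda>b. int (fst (prod_decode b))) (\<lambda>b. D (fst (prod_decode b)) ! snd (prod_decode b)) d' e'"
    "minimal {prod_encode (i, r) |i r. r < length (D i)} d'"
    using *(1) by blast
  have fin: "finite {b \<in> B. lv b = int i \<and> dg b = n}" using B(1) by simp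
  \<comment> \<open>Both resolutions are minimal, so the comparison of cardinalities applies in both
    directions.\<close>
  show "m = card {b \<in> B. lv b = int i \<and> dg b = n}"
    using gres_card_le[OF g **(1) B(2) fin *(2)] gres_card_le[OF **(1) g **(2) *(2) fin] *(3) DA(2)
    by (intro order_antisym) simp_all
qed

lemma strand_eq:
  fixes J :: "('v, 'k::field) mpoly set"
  assumes "min_res_quotient V J Y"
  shows "strand V J j = {i. (i, j) \<in> Y}" "finite Y"
proof -
  obtain B lv dg d e b0 where *: "gres V (polys V) J B lv dg d e" "finite B" "minimal B d"
     "\<forall>b\<in>B. lv b \<le> int (dg b)" "Y = positions B lv dg" "b0 \<in> B" "\<And>b. b \<in> B \<Longrightarrow> lv b = 0 \<longleftrightarrow> b = b0"
     "dg b0 = 0" "e (unit b0) = 1"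
    using assms unfolding min_res_quotient_def by blast
  show "finite Y" using *(2,5) by (simp add: positions_def)
  have "betti V J i (i + j) \<noteq> 0 \<longleftrightarrow> (i, j) \<in> Y" for i
  proof -
    have bc: "betti V J i (i + j) = card {b \<in> B. lv b = int i \<and> dg b = i + j}"
      by (rule betti_eq_card[OF *(1,2,3,6-9)])
    have "betti V J i (i + j) \<noteq> 0 \<longleftrightarrow> (\<exists>b\<in>B. lv b = int i \<and> dg b = i + j)"
      unfolding bc card_eq_0_iff using *(2) by auto
    also have "\<dots> \<longleftrightarrow> (\<exists>b\<in>B. nat (lv b) = i \<and> nat (int (dg b) - lv b) = j)"
    proof (rule bex_cong[OF refl])
      fix b assume "b \<in> B"
      then have "0 \<le> lv b" "lv b \<le> int (dg b)" using *(4) gres.lv_nonneg[OF *(1)] by blast+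
      then show "(lv b = int i \<and> dg b = i + j) = (nat (lv b) = i \<and> nat (int (dg b) - lv b) = j)" by arith
    qed
    also have "\<dots> \<longleftrightarrow> (i, j) \<in> Y" unfolding *(5) positions_def by auto
    finally show ?thesis .
  qed
  then show "strand V J j = {i. (i, j) \<in> Y}" by (simp add: strand_def)
qed

section \<open>Squarefree monomial ideals\<close>

text \<open>A squarefree monomial ideal is given by the predicate \<open>N\<close> that holds for the supports of the
  monomials of the ideal, i.e. by the nonfaces of its Stanley-Reisner complex.\<close>

definition mideal :: "'v set \<Rightarrow> ('v set \<Rightarrow> bool) \<Rightarrow> ('v, 'k::field) mpoly set" where
  "mideal V N = {p \<in> polys V. \<forall>m\<in>keys p. N (keys m)}"

definition upclosed :: "('v set \<Rightarrow> bool) \<Rightarrow> bool" where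
  "upclosed N \<longleftrightarrow> (\<forall>s t. s \<subseteq> t \<longrightarrow> N s \<longrightarrow> N t)"

lemma upclosedD: "upclosed N \<Longrightarrow> N s \<Longrightarrow> s \<subseteq> t \<Longrightarrow> N t"
  by (auto simp: upclosed_def)

lemma hideal_mideal:
  assumes "upclosed N"
  shows "hideal V (mideal V N :: ('v, 'k::field) mpoly set)"
  unfolding hideal_def
proof (intro conjI ballI allI)
  fix p q :: "('v, 'k) mpoly"
  assume p: "p \<in> mideal V N" and q: "q \<in> mideal V N"
  show "p + q \<in> mideal V N"
    using keys_add[of p q] p q by (auto simp: mideal_def polys_add)
next
  fix p q :: "('v, 'k) mpoly"
  assume p: "p \<in> polys V" and q: "q \<in> mideal V N"
  show "p * q \<in> mideal V N"
    unfolding mideal_def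
  proof (intro CollectI conjI ballI)
    show "p * q \<in> polys V" using p q by (simp add: mideal_def polys_mult)
    fix m assume "m \<in> keys (p * q)"
    then obtain a b where "a \<in> keys p" "b \<in> keys q" "m = a + b"
      using keys_mult[of p q] by blast
    then show "N (keys m)"
      using q upclosedD[OF assms] by (auto simp: mideal_def keys_add_nat)
  qed
qed (auto simp: mideal_def hcomp_polys keys_hcomp)

lemma mideal_polys: "mideal V (\<lambda>_. True) = polys V"
  by (auto simp: mideal_def)

lemma mideal_mono: "(\<And>s. N s \<Longrightarrow> N' s) \<Longrightarrow> mideal V N \<subseteq> mideal V N'"
  by (auto simp: mideal_def)

lemma mpoly_expansion:
  "p = (\<Sum>m\<in>keys p. single m (lookup p m))"
  for p :: "'a \<Rightarrow>\<^sub>0 'b::comm_monoid_add"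
  by (rule poly_mapping_eqI) (auto simp: lookup_sum lookup_single when_def in_keys_iff)

text \<open>Adding a fixed exponent vector is injective, so no two terms can cancel.\<close>

lemma keys_single_mult:
  fixes p :: "('v, 'k::field) mpoly"
  shows "keys (single \<mu> 1 * p) = (+) \<mu> ` keys p"
proof -
  have "single \<mu> 1 * p =
      (\<Sum>m\<in>keys p. single (\<mu> + m) (lookup p m))"
    by (subst (1) mpoly_expansion) (simp add: sum_distrib_left mult_single)
  also have "\<dots> = (\<Sum>k\<in>(+) \<mu> ` keys p. single k (lookup p (k - \<mu>)))"
    by (subst sum.reindex) (auto simp: inj_on_def)
  finally have *: "single \<mu> 1 * p = \<dots>" .
  have "lookup (single \<mu> 1 * p) k =
      (if k \<in> (+) \<mu> ` keys p then lookup p (k - \<mu>) else 0)" for k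
    unfolding * lookup_sum by (simp add: lookup_single when_def)
  then show ?thesis by (auto simp: in_keys_iff split: if_splits)
qed

lemma mideal_colon:
  assumes "keys \<mu> \<subseteq> V" "p \<in> polys V"
  shows "single \<mu> 1 * p \<in> mideal V N \<longleftrightarrow> p \<in> mideal V (\<lambda>s. N (keys \<mu> \<union> s))"
proof -
  have "single \<mu> (1::'b) \<in> polys V" using assms(1) by (auto simp: polys_def)
  then have "single \<mu> 1 * p \<in> polys V" using assms(2) by (rule polys_mult)
  then show ?thesis using assms(2) by (simp add: mideal_def keys_single_mult keys_add_nat)
qed

text \<open>A term of \<open>p\<close> outside the ideal of \<open>N1\<close> is divisible by \<mu>,
  because \<mu> is squarefree and its support is contained in that of the term. The quotient may or
  may not retain variables of \<mu>; as \<open>N2\<close> is insensitive to them, it lies in the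
  ideal of \<open>N2\<close> either way.\<close>

lemma mideal_sum:
  fixes p :: "('v, 'k::field) mpoly"
  assumes V: "keys \<mu> \<subseteq> V" and sf: "\<And>v. v \<in> keys \<mu> \<Longrightarrow> lookup \<mu> v = 1"
    and N2: "\<And>s. N2 (keys \<mu> \<union> s) = N2 s"
    and N: "\<And>s. N s \<longleftrightarrow> N1 s \<or> (keys \<mu> \<subseteq> s \<and> N2 s)"
  shows "p \<in> mideal V N \<longleftrightarrow> (\<exists>t\<in>mideal V N2. p - single \<mu> 1 * t \<in> mideal V N1)"
proof
  assume p: "p \<in> mideal V N"
  define K where "K = {m \<in> keys p. \<not> N1 (keys m)}"
  have K: "keys \<mu> \<subseteq> keys m" "N2 (keys m)"
    "m \<in> keys p" if "m \<in> K" for m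
    using that p N by (auto simp: K_def mideal_def)
  have fK: "finite K" by (simp add: K_def)
  have add: "\<mu> + (m - \<mu>) = m" if "m \<in> K" for m
  proof (rule poly_mapping_eqI)
    fix v
    show "lookup (\<mu> + (m - \<mu>)) v = lookup m v"
    proof (cases "v \<in> keys \<mu>")
      case True
      then have "v \<in> keys m" using K(1)[OF that] by blast
      then have "lookup m v \<ge> 1" by (simp add: in_keys_iff Suc_le_eq)
      then show ?thesis using sf[OF True] by (simp add: lookup_add lookup_minus)
    qed (simp add: lookup_add lookup_minus in_keys_iff)
  qed
  have keys: "keys \<mu> \<union> keys (m - \<mu>) = keys m" if "m \<in> K" for m
    using arg_cong[OF add[OF that], of keys] by (simp add: keys_add_nat)
  define t where "t = (\<Sum>m\<in>K. single (m - \<mu>) (lookup p m))"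
  have kt: "\<exists>m\<in>K. k = m - \<mu>" if "k \<in> keys t" for k
  proof (rule ccontr)
    assume "\<not> ?thesis"
    then have "lookup t k = 0"
      unfolding t_def lookup_sum by (intro sum.neutral) (auto simp: lookup_single when_def)
    then show False using that by (simp add: in_keys_iff)
  qed
  have t: "t \<in> mideal V N2"
    unfolding mideal_def polys_def
  proof (intro CollectI conjI ballI)
    fix k assume "k \<in> keys t"
    then obtain m where m: "m \<in> K" "k = m - \<mu>" using kt by blast
    have "keys k \<subseteq> keys m" using keys[OF m(1)] m(2) by auto
    moreover have "keys m \<subseteq> V" using K(3)[OF m(1)] p by (auto simp: mideal_def polys_def)
    ultimately show "keys k \<subseteq> V" by simp
    show "N2 (keys k)" using K(2)[OF m(1)] N2[of "keys k"] keys[OF m(1)] m(2) by simp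
  qed
  have "single \<mu> 1 * t = (\<Sum>m\<in>K. single m (lookup p m))"
    unfolding t_def sum_distrib_left by (rule sum.cong) (simp_all add: mult_single add)
  then have lk: "lookup (single \<mu> 1 * t) k = (if k \<in> K then lookup p k else 0)" for k
    using fK by (simp add: lookup_sum lookup_single when_def)
  have "keys (p - single \<mu> 1 * t) \<subseteq> keys p - K"
    by (auto simp: in_keys_iff lookup_minus lk split: if_splits)
  then have "p - single \<mu> 1 * t \<in> mideal V N1"
    using p by (auto simp: mideal_def polys_def K_def)
  with t show "\<exists>t\<in>mideal V N2. p - single \<mu> 1 * t \<in> mideal V N1" by blast
next
  assume "\<exists>t\<in>mideal V N2. p - single \<mu> 1 * t \<in> mideal V N1"
  then obtain t where t: "t \<in> mideal V N2" "p - single \<mu> 1 * t \<in> mideal V N1" by blast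
  have "t \<in> polys V" using t(1) by (simp add: mideal_def)
  then have "single \<mu> 1 * t \<in> mideal V N"
    unfolding mideal_colon[OF V \<open>t \<in> polys V\<close>] using t(1) N2 N by (auto simp: mideal_def)
  moreover have "p - single \<mu> 1 * t \<in> mideal V N"
    using t(2) N by (auto simp: mideal_def)
  ultimately have "p - single \<mu> 1 * t + single \<mu> 1 * t \<in> mideal V N"
    using keys_add[of "p - single \<mu> 1 * t" "single \<mu> 1 * t"]
    unfolding mideal_def by (blast intro: polys_add)
  then show "p \<in> mideal V N" by simp
qed

lemma var_props:
  assumes "v \<in> V"
  shows "var v \<in> polys V" "homog 1 (var v :: ('v, 'k::field) mpoly)"
  using assms by (auto simp: var_def polys_def homog_def)

lemma var_colon:
  fixes p :: "('v, 'k::field) mpoly"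
  assumes "v \<in> V" "p \<in> polys V"
  shows "var v * p \<in> mideal V N \<longleftrightarrow> p \<in> mideal V (\<lambda>s. N (insert v s))"
  using mideal_colon[of "single v 1" V p N] assms by (simp add: var_def)

lemma var_sum:
  fixes p :: "('v, 'k::field) mpoly"
  assumes "v \<in> V" "\<And>s. N2 (insert v s) = N2 s" "\<And>s. N s \<longleftrightarrow> N1 s \<or> (v \<in> s \<and> N2 s)"
  shows "p \<in> mideal V N \<longleftrightarrow> (\<exists>t\<in>mideal V N2. p - var v * t \<in> mideal V N1)"
  using mideal_sum[of "single v 1" V N2 N N1 p] assms by (simp add: var_def)

lemma var2: "var x * var y = (single (single x 1 + single y 1) 1 :: ('v, 'k::field) mpoly)"
  by (simp add: var_def mult_single)

section \<open>Building minimal resolutions of monomial ideals\<close>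

abbreviation betti_positions :: "'k::field itself \<Rightarrow> 'v set \<Rightarrow> ('v set \<Rightarrow> bool) \<Rightarrow> (nat \<times> nat) set \<Rightarrow> bool" where
  "betti_positions k V N Y \<equiv> min_res_quotient V (mideal V N :: ('v, 'k) mpoly set) Y"

text \<open>A variable that does not occur in the ideal is a nonzerodivisor modulo it. The cone of
  multiplication by \<open>v\<close> on two copies of the same resolution is one Koszul
  step.\<close>

lemma betti_positions_var:
  assumes "betti_positions TYPE('k::field) V N Y" "v \<in> V" "upclosed N" "\<And>s. N (insert v s) = N s"
  shows "betti_positions TYPE('k) V (\<lambda>s. N s \<or> v \<in> s) (Y \<union> (\<lambda>(i, j). (Suc i, j)) ` Y)"
proof -
  have "min_res_quotient V (mideal V (\<lambda>s. N s \<or> v \<in> s) :: ('a, 'k) mpoly set) (Y \<union> (\<lambda>(i, j). (Suc i, j + 0)) ` Y)"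
  proof (rule min_res_cone[OF assms(1) min_res_quotient_imp[OF assms(1)], where w=1 and z="var v"])
    show "var v * 1 * t \<in> mideal V N \<longleftrightarrow> t \<in> mideal V N" if "t \<in> polys V" for t :: "('a, 'k) mpoly"
      using var_colon[OF assms(2) that] by (simp add: assms(4))
    show "hideal V (mideal V (\<lambda>s. N s \<or> v \<in> s))"
      by (rule hideal_mideal) (use assms(3) in \<open>auto simp: upclosed_def\<close>)
    show "p \<in> mideal V (\<lambda>s. N s \<or> v \<in> s) \<longleftrightarrow> (\<exists>t\<in>polys V. p - var v * 1 * t \<in> mideal V N)"
      for p :: "('a, 'k) mpoly"
      using var_sum[of v V "\<lambda>_. True" _ N p] assms(2) by (simp add: mideal_polys)
  qed (use assms(2) var_props in auto)
  then show ?thesis by simp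
qed

text \<open>The effect of a Koszul complex on \<open>n\<close> new variables: levels rise by 0 to
  \<open>n\<close> within the same strand. Multiplicities are forgotten, as strands only ask which
  Betti numbers are nonzero.\<close>

definition shifts :: "nat \<Rightarrow> (nat \<times> nat) set \<Rightarrow> (nat \<times> nat) set" where
  "shifts n Y = {(i + l, j) | i j l. (i, j) \<in> Y \<and> l \<le> n}"

lemma betti_positions_vars:
  assumes "finite Z" "Z \<subseteq> V" "betti_positions TYPE('k::field) V N Y" "upclosed N"
    and "\<And>v s. v \<in> Z \<Longrightarrow> N (insert v s) = N s"
  shows "betti_positions TYPE('k) V (\<lambda>s. N s \<or> Z \<inter> s \<noteq> {}) (shifts (card Z) Y)"
  using assms
proof (induction Z)
  case empty
  then show ?case by (simp add: shifts_def)
next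
  case (insert v Z)
  let ?N = "\<lambda>s. N s \<or> Z \<inter> s \<noteq> {}"
  have "betti_positions TYPE('k) V (\<lambda>s. ?N s \<or> v \<in> s) (shifts (card Z) Y \<union> (\<lambda>(i, j). (Suc i, j)) ` shifts (card Z) Y)"
  proof (rule betti_positions_var)
    show "upclosed ?N" using insert.prems(3) by (auto simp: upclosed_def)
    show "?N (insert v s) = ?N s" for s using insert.prems(4)[of v s] insert.hyps(2) by auto
  qed (use insert in auto)
  moreover have "shifts (card Z) Y \<union> (\<lambda>(i, j). (Suc i, j)) ` shifts (card Z) Y = shifts (card (insert v Z)) Y"
  proof -
    have "shifts (Suc (card Z)) Y \<subseteq> shifts (card Z) Y \<union> (\<lambda>(i, j). (Suc i, j)) ` shifts (card Z) Y"
    proof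
      fix p assume "p \<in> shifts (Suc (card Z)) Y"
      then obtain i j l where p: "p = (i + l, j)" "(i, j) \<in> Y" "l \<le> Suc (card Z)"
        unfolding shifts_def by blast
      show "p \<in> shifts (card Z) Y \<union> (\<lambda>(i, j). (Suc i, j)) ` shifts (card Z) Y"
      proof (cases l)
        case 0
        have "(i + 0, j) \<in> shifts (card Z) Y" unfolding shifts_def using p(2) by blast
        then show ?thesis using 0 p(1) by simp
      next
        case (Suc k)
        have "k \<le> card Z" using p(3) Suc by simp
        then have "(i + k, j) \<in> shifts (card Z) Y" unfolding shifts_def using p(2) by blast
        then have "(Suc (i + k), j) \<in> (\<lambda>(i, j). (Suc i, j)) ` shifts (card Z) Y" by force
        then show ?thesis using Suc p(1) by simp
      qed
    qed
    moreover have "shifts (card Z) Y \<subseteq> shifts (Suc (card Z)) Y"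
      by (fastforce simp: shifts_def)
    moreover have "(\<lambda>(i, j). (Suc i, j)) ` shifts (card Z) Y \<subseteq> shifts (Suc (card Z)) Y"
    proof
      fix p assume "p \<in> (\<lambda>(i, j). (Suc i, j)) ` shifts (card Z) Y"
      then obtain i j l where "p = (i + Suc l, j)" "(i, j) \<in> Y" "Suc l \<le> Suc (card Z)"
        by (auto simp: shifts_def)
      then show "p \<in> shifts (Suc (card Z)) Y" unfolding shifts_def by blast
    qed
    ultimately show ?thesis using insert.hyps by (simp add: equalityI)
  qed
  moreover have "(\<lambda>s. ?N s \<or> v \<in> s) = (\<lambda>s. N s \<or> insert v Z \<inter> s \<noteq> {})" by auto
  ultimately show ?case by simp
qed

lemma betti_positions_edge:
  assumes N: "betti_positions TYPE('k::field) V N Y" "upclosed N"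
    and N': "betti_positions TYPE('k) V N' Z" "\<And>s. N' s \<longleftrightarrow> N (insert x (insert y s))"
      "\<And>s. N' s \<Longrightarrow> N (insert y s)"
    and xy: "x \<in> V" "y \<in> V" "x \<noteq> y"
  shows "betti_positions TYPE('k) V (\<lambda>s. N s \<or> {x, y} \<subseteq> s) (Y \<union> (\<lambda>(i, j). (Suc i, Suc j)) ` Z)"
proof -
  let ?\<mu> = "single x 1 + single y (1::nat)"
  have keys\<mu>: "keys ?\<mu> = {x, y}" by (simp add: keys_add_nat insert_commute)
  have "min_res_quotient V (mideal V (\<lambda>s. N s \<or> {x, y} \<subseteq> s) :: ('a, 'k) mpoly set) (Y \<union> (\<lambda>(i, j). (Suc i, j + 1)) ` Z)"
  proof (rule min_res_cone[OF N(1) min_res_quotient_imp[OF N'(1)], where w="var y" and z="var x"])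
    show "var x * var y * t \<in> mideal V N \<longleftrightarrow> t \<in> mideal V N'" if "t \<in> polys V" for t :: "('a, 'k) mpoly"
    proof -
      have "var x * var y * t \<in> mideal V N \<longleftrightarrow> t \<in> mideal V (\<lambda>s. N ({x, y} \<union> s))"
        unfolding var2 by (rule mideal_colon[of ?\<mu> V t N, unfolded keys\<mu>]) (use xy that in auto)
      also have "(\<lambda>s. N ({x, y} \<union> s)) = N'" by (simp add: fun_eq_iff N'(2))
      finally show ?thesis .
    qed
    show "var y * t \<in> mideal V N" if "t \<in> mideal V N'" for t :: "('a, 'k) mpoly"
    proof -
      have "t \<in> polys V" using that by (simp add: mideal_def)
      then show ?thesis using var_colon[OF xy(2), of t N] that N'(3) by (auto simp: mideal_def)
    qed
    show "hideal V (mideal V (\<lambda>s. N s \<or> {x, y} \<subseteq> s))"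
      by (rule hideal_mideal) (use N(2) in \<open>auto simp: upclosed_def\<close>)
    show "p \<in> mideal V (\<lambda>s. N s \<or> {x, y} \<subseteq> s) \<longleftrightarrow> (\<exists>t\<in>polys V. p - var x * var y * t \<in> mideal V N)"
      for p :: "('a, 'k) mpoly"
      unfolding var2 mideal_polys[symmetric]
      by (rule mideal_sum[of ?\<mu>, unfolded keys\<mu>]) (use xy in \<open>auto simp: lookup_add lookup_single\<close>)
  qed (use xy var_props in auto)
  then show ?thesis by simp
qed

text \<open>With T = (a, b) + J, both new edges come from the single multiplication by x on T / J,
  which is injective since x does not occur in J. The filtration by (a) + J has the factors R / (J :
  a) and R / (((a) + J) : b), each shifted by one degree; \<open>Ya\<close> and \<open>Yb\<close>
  are their positions.\<close>

lemma betti_positions_path_to_cycle: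
  assumes N: "betti_positions TYPE('k::field) V N Y" "upclosed N" "\<And>s. N (insert x s) = N s"
    and Na: "betti_positions TYPE('k) V (\<lambda>s. N (insert a s)) Ya"
    and Nb: "betti_positions TYPE('k) V (\<lambda>s. N (insert b s) \<or> a \<in> s) Yb"
    and xab: "x \<in> V" "a \<in> V" "b \<in> V" "x \<noteq> a" "x \<noteq> b" "a \<noteq> b"
  shows "\<exists>Z \<subseteq> (\<lambda>(i, j). (Suc i, Suc j)) ` (Ya \<union> Yb).
    betti_positions TYPE('k) V (\<lambda>s. N s \<or> {x, a} \<subseteq> s \<or> {x, b} \<subseteq> s) (Y \<union> Z)"
proof -
  let ?J = "mideal V N :: ('a, 'k) mpoly set"
  let ?T1 = "mideal V (\<lambda>s. N s \<or> a \<in> s) :: ('a, 'k) mpoly set"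
  let ?N2 = "\<lambda>s. N s \<or> a \<in> s \<or> b \<in> s"
  let ?T = "mideal V ?N2 :: ('a, 'k) mpoly set"
  let ?I = "mideal V (\<lambda>s. N s \<or> {x, a} \<subseteq> s \<or> {x, b} \<subseteq> s) :: ('a, 'k) mpoly set"
  have hid: "hideal V ?J" "hideal V ?T1" "hideal V ?T" "hideal V ?I"
    by (rule hideal_mideal, use N(2) in \<open>auto simp: upclosed_def\<close>)+
  have 1: "min_res V ?T1 ?J ((\<lambda>(i, j). (i, j + 1)) ` Ya)"
  proof (rule min_res_mult[OF min_res_quotient_imp[OF Na], where f="var a"])
    show "var a * t \<in> ?J \<longleftrightarrow> t \<in> mideal V (\<lambda>s. N (insert a s))" if "t \<in> polys V" for t :: "('a, 'k) mpoly"
      by (rule var_colon[OF xab(2) that])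
    show "p \<in> ?T1 \<longleftrightarrow> (\<exists>t\<in>polys V. p - var a * t \<in> ?J)" for p :: "('a, 'k) mpoly"
      using var_sum[of a V "\<lambda>_. True" _ N p] xab by (simp add: mideal_polys)
    show "?J \<subseteq> ?T1" by (rule mideal_mono) auto
  qed (use xab var_props hid in auto)
  have 2: "min_res V ?T ?T1 ((\<lambda>(i, j). (i, j + 1)) ` Yb)"
  proof (rule min_res_mult[OF min_res_quotient_imp[OF Nb], where f="var b"])
    show "var b * t \<in> ?T1 \<longleftrightarrow> t \<in> mideal V (\<lambda>s. N (insert b s) \<or> a \<in> s)" if "t \<in> polys V" for t :: "('a, 'k) mpoly"
      using var_colon[OF xab(3) that, of "\<lambda>s. N s \<or> a \<in> s"] xab by simp
    show "p \<in> ?T \<longleftrightarrow> (\<exists>t\<in>polys V. p - var b * t \<in> ?T1)" for p :: "('a, 'k) mpoly"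
      unfolding mideal_polys[symmetric] by (rule var_sum) (use xab in auto)
    show "?T1 \<subseteq> ?T" by (rule mideal_mono) auto
  qed (use xab var_props hid in auto)
  obtain X where X: "X \<subseteq> (\<lambda>(i, j). (i, j + 1)) ` Ya \<union> (\<lambda>(i, j). (i, j + 1)) ` Yb" "min_res V ?T ?J X"
    using min_res_extension[OF 1 2] by blast
  have "min_res_quotient V ?I (Y \<union> (\<lambda>(i, j). (Suc i, j + 0)) ` X)"
  proof (rule min_res_cone[OF N(1) X(2), where w=1 and z="var x"])
    show "var x * 1 * t \<in> ?J \<longleftrightarrow> t \<in> ?J" if "t \<in> ?T" for t :: "('a, 'k) mpoly"
      using var_colon[OF xab(1), of t N] that by (simp add: mideal_def N(3))
    show "p \<in> ?I \<longleftrightarrow> (\<exists>t\<in>?T. p - var x * 1 * t \<in> ?J)" for p :: "('a, 'k) mpoly"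
      unfolding mult_1_right by (rule var_sum) (use xab N(3) in auto)
  qed (use xab var_props hid in auto)
  moreover have "(\<lambda>(i, j). (Suc i, j + 0)) ` X \<subseteq> (\<lambda>(i, j). (Suc i, Suc j)) ` (Ya \<union> Yb)"
    using X(1) by (force simp: image_iff)
  ultimately show ?thesis by blast
qed

section \<open>Edge ideals\<close>

lemma edge_ideal_eq_mideal:
  assumes "simple_graph V E"
  shows "(edge_ideal V E :: ('v, 'k::field) mpoly set) = mideal V (\<lambda>s. \<exists>e\<in>E. e \<subseteq> s)"
proof (intro equalityI subsetI)
  have up: "upclosed (\<lambda>s. \<exists>e\<in>E. e \<subseteq> s)" unfolding upclosed_def by (meson order_trans)
  fix p :: "('v, 'k) mpoly" assume "p \<in> edge_ideal V E"
  then obtain a T where p: "p = (\<Sum>s\<in>T. a s * s)" and T: "T \<subseteq> {var x * var y | x y. {x, y} \<in> E}"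
    and a: "\<forall>s\<in>T. a s \<in> polys V" unfolding edge_ideal_def ideal_generated_def by blast
  show "p \<in> mideal V (\<lambda>s. \<exists>e\<in>E. e \<subseteq> s)"
    unfolding p
  proof (rule hideal_sum[OF hideal_mideal[OF up]])
    fix s assume s: "s \<in> T"
    then obtain x y where xy: "s = var x * var y" "{x, y} \<in> E" using T by blast
    then have "{x, y} \<subseteq> V" using assms by (auto simp: simple_graph_def)
    with xy have "s \<in> mideal V (\<lambda>s. \<exists>e\<in>E. e \<subseteq> s)"
      by (auto simp: var2 mideal_def polys_def keys_add_nat intro!: bexI[of _ "{x, y}"])
    then show "a s * s \<in> mideal V (\<lambda>s. \<exists>e\<in>E. e \<subseteq> s)"
      using a s by (intro hidealD(4)[OF hideal_mideal[OF up]]) auto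
  qed
next
  fix p :: "('v, 'k) mpoly" assume p: "p \<in> mideal V (\<lambda>s. \<exists>e\<in>E. e \<subseteq> s)"
  have "\<forall>m\<in>keys p. \<exists>gc. fst gc \<in> {var x * var y | x y. {x, y} \<in> E} \<and> snd gc \<in> polys V \<and>
    single m (lookup p m) = snd gc * fst gc"
  proof
    fix m assume m: "m \<in> keys p"
    obtain e where e: "e \<in> E" "e \<subseteq> keys m" using p m by (auto simp: mideal_def)
    then have "card e = 2" using assms by (auto simp: simple_graph_def)
    then obtain x y where xy: "e = {x, y}" "x \<noteq> y" by (auto simp: card_2_iff)
    let ?\<mu> = "single x 1 + single y (1::nat)"
    have eq: "(m - ?\<mu>) + ?\<mu> = m"
    proof (rule poly_mapping_eqI)
      fix v
      have "lookup m x \<noteq> 0" "lookup m y \<noteq> 0"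
        using e(2) xy by (auto simp: in_keys_iff)
      then show "lookup ((m - ?\<mu>) + ?\<mu>) v = lookup m v"
        using xy(2) by (auto simp: lookup_add lookup_minus lookup_single when_def)
    qed
    let ?c = "single (m - ?\<mu>) (lookup p m) :: ('v, 'k) mpoly"
    have "single m (lookup p m) = ?c * (var x * var y)"
      unfolding var2 mult_single eq by simp
    moreover have "?c \<in> polys V"
    proof -
      have "keys (m - ?\<mu>) \<subseteq> keys m"
        using arg_cong[OF eq, of keys] unfolding keys_add_nat by blast
      also have "\<dots> \<subseteq> V" using p m by (auto simp: mideal_def polys_def)
      finally show ?thesis by (auto simp: polys_def)
    qed
    moreover have "var x * var y \<in> {var x * var y | x y. {x, y} \<in> E}" using e(1) xy(1) by blast
    ultimately show "\<exists>gc. fst gc \<in> {var x * var y | x y. {x, y} \<in> E} \<and> snd gc \<in> polys V \<and>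
      single m (lookup p m) = snd gc * fst gc"
      by (intro exI[of _ "(var x * var y, ?c)"]) simp
  qed
  from bchoice[OF this] obtain h where h: "\<forall>m\<in>keys p. fst (h m) \<in> {var x * var y | x y. {x, y} \<in> E} \<and>
    snd (h m) \<in> polys V \<and> single m (lookup p m) = snd (h m) * fst (h m)"
    by (elim exE)
  define g where "g m = fst (h m)" for m
  define c where "c m = snd (h m)" for m
  have gc: "g m \<in> {var x * var y | x y. {x, y} \<in> E}" "c m \<in> polys V"
    "single m (lookup p m) = c m * g m" if "m \<in> keys p" for m
    using h that by (simp_all only: g_def c_def)
  let ?T = "g ` keys p"
  \<comment> \<open>Several terms may choose the same generator, whereas
    \<open>ideal_generated\<close> provides one coefficient per generator, so their cofactors are
    added up.\<close>
  let ?a = "\<lambda>s. \<Sum>m\<in>{m \<in> keys p. g m = s}. c m"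
  have "p = (\<Sum>m\<in>keys p. c m * g m)"
    by (subst mpoly_expansion) (rule sum.cong[OF refl gc(3)])
  also have "\<dots> = (\<Sum>s\<in>?T. \<Sum>m\<in>{m \<in> keys p. g m = s}. c m * g m)"
    by (rule sum.image_gen) simp
  also have "\<dots> = (\<Sum>s\<in>?T. ?a s * s)"
    by (rule sum.cong) (auto simp: sum_distrib_right)
  finally have "p = (\<Sum>s\<in>?T. ?a s * s)" .
  moreover have "?a s \<in> polys V" for s by (rule polys_sum) (use gc(2) in auto)
  moreover have "?T \<subseteq> {var x * var y | x y. {x, y} \<in> E}" using gc(1) by blast
  ultimately show "p \<in> edge_ideal V E"
    unfolding edge_ideal_def ideal_generated_def
    by (intro CollectI exI[of _ ?a] exI[of _ ?T]) auto
qed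

section \<open>Strands and their combinatorics\<close>

definition down_closed :: "(nat \<times> nat) set \<Rightarrow> bool" where
  "down_closed Y \<longleftrightarrow> (\<forall>i j. (i, j) \<in> Y \<longrightarrow> j \<le> i \<and> (\<forall>i'. j \<le> i' \<longrightarrow> i' \<le> i \<longrightarrow> (i', j) \<in> Y))"

lemma down_closedD:
  assumes "down_closed Y" "(i, j) \<in> Y"
  shows "j \<le> i" "j \<le> i' \<Longrightarrow> i' \<le> i \<Longrightarrow> (i', j) \<in> Y"
  using assms unfolding down_closed_def by blast+

definition diag :: "(nat \<times> nat) set \<Rightarrow> (nat \<times> nat) set" where
  "diag Y = (\<lambda>(i, j). (Suc i, Suc j)) ` Y"

lemma diag_iff: "(i, j) \<in> diag Y \<longleftrightarrow> (\<exists>i' j'. i = Suc i' \<and> j = Suc j' \<and> (i', j') \<in> Y)"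
  by (auto simp: diag_def)

lemma shifts_iff: "(i, j) \<in> shifts n Y \<longleftrightarrow> (\<exists>l\<le>n. l \<le> i \<and> (i - l, j) \<in> Y)"
proof
  assume "\<exists>l\<le>n. l \<le> i \<and> (i - l, j) \<in> Y"
  then obtain l where "l \<le> n" "l \<le> i" "(i - l, j) \<in> Y" by blast
  then have "(i - l + l, j) \<in> shifts n Y" unfolding shifts_def by blast
  then show "(i, j) \<in> shifts n Y" using \<open>l \<le> i\<close> by simp
qed (auto simp: shifts_def)

lemma diagI: "(a, b) \<in> Y \<Longrightarrow> (Suc a, Suc b) \<in> diag Y"
  by (auto simp: diag_iff)

lemma shiftsI: "(a, b) \<in> Y \<Longrightarrow> l \<le> n \<Longrightarrow> (a + l, b) \<in> shifts n Y"
  unfolding shifts_def by blast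

lemma down_closed_shifts:
  assumes "down_closed Y" shows "down_closed (shifts n Y)"
  unfolding down_closed_def
proof (intro allI impI conjI)
  fix i j assume "(i, j) \<in> shifts n Y"
  then obtain l where l: "l \<le> n" "l \<le> i" "(i - l, j) \<in> Y" by (auto simp: shifts_iff)
  show "j \<le> i" using down_closedD(1)[OF assms l(3)] by simp
  fix i' assume i': "j \<le> i'" "i' \<le> i"
  show "(i', j) \<in> shifts n Y"
  proof (cases "i' \<le> i - l")
    case True
    then have "(i', j) \<in> Y" using down_closedD(2)[OF assms l(3) i'(1)] by simp
    then show ?thesis unfolding shifts_iff by (intro exI[of _ 0]) simp
  next
    case False
    then have "i' - (i - l) \<le> n" "i' - (i - l) \<le> i'" "i' - (i' - (i - l)) = i - l" using i' l by auto
    then show ?thesis unfolding shifts_iff using l(3) by metis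
  qed
qed

lemma down_closed_diag:
  assumes "down_closed Y" shows "down_closed (diag Y)"
  unfolding down_closed_def
proof (intro allI impI conjI)
  fix i j assume "(i, j) \<in> diag Y"
  then obtain a b where ab: "i = Suc a" "j = Suc b" "(a, b) \<in> Y" by (auto simp: diag_iff)
  show "j \<le> i" using ab down_closedD(1)[OF assms ab(3)] by simp
  fix i' assume i': "j \<le> i'" "i' \<le> i"
  obtain c where "i' = Suc c" using i' ab by (cases i') auto
  moreover from this have "(c, b) \<in> Y" using i' ab down_closedD(2)[OF assms ab(3), of c] by simp
  ultimately show "(i', j) \<in> diag Y" using ab(2) by (simp add: diag_iff)
qed

lemma down_closed_Un: "down_closed Y \<Longrightarrow> down_closed Z \<Longrightarrow> down_closed (Y \<union> Z)"
  unfolding down_closed_def Un_iff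
proof (intro allI impI)
  fix i j assume "\<forall>i j. (i, j) \<in> Y \<longrightarrow> j \<le> i \<and> (\<forall>i'\<ge>j. i' \<le> i \<longrightarrow> (i', j) \<in> Y)"
    "\<forall>i j. (i, j) \<in> Z \<longrightarrow> j \<le> i \<and> (\<forall>i'\<ge>j. i' \<le> i \<longrightarrow> (i', j) \<in> Z)" "(i, j) \<in> Y \<or> (i, j) \<in> Z"
  then show "j \<le> i \<and> (\<forall>i'\<ge>j. i' \<le> i \<longrightarrow> (i', j) \<in> Y \<or> (i', j) \<in> Z)" by metis
qed

text \<open>The positions for the disjoint union of a path on \<open>m\<close> vertices with a graph whose positions
  are \<open>Y\<close>.\<close>

fun path_positions :: "nat \<Rightarrow> (nat \<times> nat) set \<Rightarrow> (nat \<times> nat) set" where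
  "path_positions 0 Y = Y"
| "path_positions (Suc 0) Y = Y"
| "path_positions (Suc (Suc 0)) Y = Y \<union> diag (shifts 0 Y)"
| "path_positions (Suc (Suc (Suc m))) Y = path_positions (Suc (Suc m)) Y \<union> diag (shifts 1 (path_positions m Y))"

lemma down_closed_path_positions: "down_closed Y \<Longrightarrow> down_closed (path_positions m Y)"
  by (induction m Y rule: path_positions.induct)
    (auto intro!: down_closed_Un down_closed_diag down_closed_shifts)

text \<open>One more vertex lengthens a strand by at most one and can open a new strand only when
  the number of vertices becomes 2 modulo 3. The recursion goes back three vertices and so preserves
  the residue. The path on two vertices enters with shift 0 instead of 1, which makes m = 2 a base
  case of its own.\<close>

lemma path_positions_Suc:
  assumes "Suc m mod 3 \<noteq> 2" "(i, j) \<in> path_positions (Suc m) Y"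
  shows "(i, j) \<in> path_positions m Y \<or> (0 < i \<and> (i - 1, j) \<in> path_positions m Y)"
  using assms
proof (induction m arbitrary: i j rule: less_induct)
  case (less m)
  have "m = 0 \<or> m = 1 \<or> m = 2 \<or> (\<exists>k. m = Suc (Suc (Suc k)))" by presburger
  then consider "m = 0" | "m = 1" | "m = 2" | k where "m = Suc (Suc (Suc k))" by (elim disjE exE)
  then show ?case
  proof cases
    case 1
    then show ?thesis using less.prems by simp
  next
    case 2
    then show ?thesis using less.prems by simp
  next
    case 3
    have Y: "path_positions m Y = Y \<union> diag (shifts 0 Y)" "path_positions (Suc m) Y = path_positions m Y \<union> diag (shifts 1 Y)"
      by (simp_all add: 3 numeral_2_eq_2)
    show ?thesis
    proof (cases "(i, j) \<in> path_positions m Y")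
      case False
      with less.prems(2) Y(2) obtain a b where ab: "i = Suc a" "j = Suc b" "(a, b) \<in> shifts 1 Y"
        by (auto simp: diag_iff)
      then obtain l where l: "l \<le> 1" "l \<le> a" "(a - l, b) \<in> Y" by (auto simp: shifts_iff)
      show ?thesis
      proof (cases l)
        case 0
        then have "(i, j) \<in> diag (shifts 0 Y)" using ab l by (auto simp: diag_iff shifts_iff)
        then show ?thesis using Y by simp
      next
        case (Suc k)
        then have "l = 1" using l by simp
        then have "(Suc (a - 1 + 0), Suc b) \<in> diag (shifts 0 Y)" using l by (intro diagI shiftsI) simp_all
        moreover have "Suc (a - 1 + 0) = i - 1" "0 < i" using \<open>l = 1\<close> l ab by simp_all
        ultimately show ?thesis using Y ab(2) by simp
      qed
    qed simp
  next
    case (4 k)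
    have Y: "path_positions (Suc m) Y = path_positions m Y \<union> diag (shifts 1 (path_positions (Suc k) Y))"
      "path_positions m Y = path_positions (Suc (Suc k)) Y \<union> diag (shifts 1 (path_positions k Y))"
      by (simp_all add: 4)
    show ?thesis
    proof (cases "(i, j) \<in> path_positions m Y")
      case False
      with less.prems(2) Y(1) obtain a b where ab: "i = Suc a" "j = Suc b" "(a, b) \<in> shifts 1 (path_positions (Suc k) Y)"
        by (auto simp: diag_iff)
      then obtain l where l: "l \<le> 1" "l \<le> a" "(a - l, b) \<in> path_positions (Suc k) Y" by (auto simp: shifts_iff)
      have "Suc k mod 3 \<noteq> 2" using less.prems(1) 4 by presburger
      from less.IH[OF _ this l(3)] 4 consider "(a - l, b) \<in> path_positions k Y"
        | "0 < a - l" "(a - l - 1, b) \<in> path_positions k Y" by auto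
      then show ?thesis
      proof cases
        case 1
        then have "(i, j) \<in> diag (shifts 1 (path_positions k Y))"
          using ab l by (auto simp: diag_iff shifts_iff)
        then show ?thesis using Y by simp
      next
        case 2
        then have "(Suc (a - l - 1 + l), Suc b) \<in> diag (shifts 1 (path_positions k Y))"
          using l by (intro diagI shiftsI) simp_all
        moreover have "Suc (a - l - 1 + l) = i - 1" "0 < i" using 2(1) ab by simp_all
        ultimately show ?thesis using Y ab(2) by simp
      qed
    qed simp
  qed
qed

text \<open>The last step in building the path on k + 3 vertices contributes the diagonal of
  \<open>shifts 1 (path_positions k Y)\<close>. Both bounds for \<open>Z\<close> exceed that set by
  at most one step to the right: the first by \<open>path_positions_Suc\<close>, the second because
  its shift is 2 instead of 1. So every choice of \<open>Z\<close> within the bounds is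
  harmless.\<close>

lemma down_closed_cycle_positions:
  assumes Y: "down_closed Y" and k: "Suc k mod 3 \<noteq> 2"
    and Z: "Z \<subseteq> diag (shifts 1 (path_positions (Suc k) Y) \<union> shifts 2 (path_positions k Y))"
  shows "down_closed (path_positions (Suc (Suc (Suc k))) Y \<union> Z)"
proof -
  let ?J = "path_positions (Suc (Suc (Suc k))) Y"
  have J: "down_closed ?J" by (rule down_closed_path_positions[OF Y])
  have sub: "diag (shifts 1 (path_positions k Y)) \<subseteq> ?J" by simp
  have *: "(i, j) \<in> ?J \<or> (0 < i \<and> (i - 1, j) \<in> ?J)" if "(i, j) \<in> Z" for i j
  proof -
    from that Z obtain a b where ab: "i = Suc a" "j = Suc b"
      "(a, b) \<in> shifts 1 (path_positions (Suc k) Y) \<or> (a, b) \<in> shifts 2 (path_positions k Y)"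
      by (auto simp: diag_iff dest!: subsetD)
    have "(a, b) \<in> shifts 1 (path_positions k Y) \<or> 0 < a \<and> (a - 1, b) \<in> shifts 1 (path_positions k Y)"
      using ab(3)
    proof
      assume "(a, b) \<in> shifts 1 (path_positions (Suc k) Y)"
      then obtain l where l: "l \<le> 1" "l \<le> a" "(a - l, b) \<in> path_positions (Suc k) Y" by (auto simp: shifts_iff)
      from path_positions_Suc[OF k l(3)] show ?thesis
      proof
        assume "(a - l, b) \<in> path_positions k Y"
        then show ?thesis using l by (auto simp: shifts_iff)
      next
        assume *: "0 < a - l \<and> (a - l - 1, b) \<in> path_positions k Y"
        then have "(a - l - 1 + l, b) \<in> shifts 1 (path_positions k Y)"
          using l by (intro shiftsI) simp_all
        moreover have "a - l - 1 + l = a - 1" "0 < a" using * by simp_all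
        ultimately show ?thesis by simp
      qed
    next
      assume "(a, b) \<in> shifts 2 (path_positions k Y)"
      then obtain l where l: "l \<le> 2" "l \<le> a" "(a - l, b) \<in> path_positions k Y" by (auto simp: shifts_iff)
      show ?thesis
      proof (cases "l \<le> 1")
        case True
        then show ?thesis using l by (auto simp: shifts_iff)
      next
        case False
        then have "l = 2" using l by simp
        have "(a - l + 1, b) \<in> shifts 1 (path_positions k Y)"
          by (rule shiftsI[OF l(3)]) simp
        moreover have "a - l + 1 = a - 1" "0 < a" using \<open>l = 2\<close> l(2) by simp_all
        ultimately show ?thesis by simp
      qed
    qed
    then have "(i, j) \<in> diag (shifts 1 (path_positions k Y)) \<or> 0 < i \<and> (i - 1, j) \<in> diag (shifts 1 (path_positions k Y))"
    proof
      assume "0 < a \<and> (a - 1, b) \<in> shifts 1 (path_positions k Y)"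
      then have "(Suc (a - 1), Suc b) \<in> diag (shifts 1 (path_positions k Y))" unfolding diag_iff by blast
      then show ?thesis using ab \<open>0 < a \<and> _\<close> by simp
    qed (auto simp: ab diag_iff)
    then show ?thesis using sub by blast
  qed
  show ?thesis
    unfolding down_closed_def
  proof (intro allI impI)
    fix i j assume "(i, j) \<in> ?J \<union> Z"
    then consider "(i, j) \<in> ?J" | "(i, j) \<in> Z" "0 < i" "(i - 1, j) \<in> ?J" using * by blast
    then show "j \<le> i \<and> (\<forall>i'. j \<le> i' \<longrightarrow> i' \<le> i \<longrightarrow> (i', j) \<in> ?J \<union> Z)"
    proof cases
      case 1
      then show ?thesis using down_closedD[OF J 1] by simp
    next
      case 2
      have "j \<le> i - 1 \<and> (\<forall>i'. j \<le> i' \<longrightarrow> i' \<le> i - 1 \<longrightarrow> (i', j) \<in> ?J)"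
        using down_closedD[OF J 2(3)] by simp
      moreover have "i' \<le> i \<Longrightarrow> i' = i \<or> i' \<le> i - 1" for i' by arith
      ultimately show ?thesis using 2(1,2) by (metis UnCI diff_le_self order_trans)
    qed
  qed
qed

section \<open>Graphs\<close>

abbreviation edge_positions :: "'k::field itself \<Rightarrow> 'v set \<Rightarrow> 'v set set \<Rightarrow> (nat \<times> nat) set \<Rightarrow> bool" where
  "edge_positions k V E Y \<equiv> betti_positions k V (\<lambda>s. \<exists>e\<in>E. e \<subseteq> s) Y"

text \<open>The vertex set only fixes the polynomial ring. In the inductions it stays the same: a
  graph shrinks by losing edges, and a removed vertex becomes isolated.\<close>

definition strands_down_closed :: "'k::field itself \<Rightarrow> 'v set \<Rightarrow> 'v set set \<Rightarrow> bool" where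
  "strands_down_closed k V E \<longleftrightarrow> (\<exists>Y. edge_positions k V E Y \<and> down_closed Y)"

lemma upclosed_edges: "upclosed (\<lambda>s. \<exists>e\<in>E. e \<subseteq> s)"
  unfolding upclosed_def by (meson order_trans)

lemma edge_positions_empty: "edge_positions TYPE('k::field) V {} {(0, 0)}"
proof -
  have "mideal V (\<lambda>s. \<exists>e\<in>{}. e \<subseteq> s) = {0 :: ('a, 'k) mpoly}"
    by (auto simp: mideal_def simp flip: keys_eq_empty)
  then show ?thesis using min_res_quotient_0 by simp
qed

lemma pair_edge:
  assumes "simple_graph V E" "e \<in> E"
  obtains u v where "e = {u, v}" "u \<noteq> v" "u \<in> V" "v \<in> V"
proof -
  have "card e = 2" "e \<subseteq> V" using assms by (auto simp: simple_graph_def)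
  then show thesis using that by (auto simp: card_2_iff)
qed

lemma edge_positions_edge:
  assumes sg: "simple_graph V E" and xy: "{x, y} \<in> E" and nb: "neighbours E x \<subseteq> closed_neighbours E y"
    and Y: "edge_positions TYPE('k::field) V (E - {{x, y}}) Y"
    and Z: "edge_positions TYPE('k) V {e \<in> E. e \<inter> closed_neighbours E y = {}} Z"
  shows "edge_positions TYPE('k) V E (Y \<union> diag (shifts (card (neighbours E y - {x})) Z))"
proof -
  let ?A = "neighbours E y - {x}"
  let ?E' = "{e \<in> E. e \<inter> closed_neighbours E y = {}}"
  let ?N = "\<lambda>s. \<exists>e\<in>E - {{x, y}}. e \<subseteq> s"
  let ?N' = "\<lambda>s. (\<exists>e\<in>?E'. e \<subseteq> s) \<or> ?A \<inter> s \<noteq> {}"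
  have edge: "e \<subseteq> V" "card e = 2" if "e \<in> E" for e
    using sg that unfolding simple_graph_def by blast+
  have ne: "u \<noteq> v" if "{u, v} \<in> E" for u v
    using edge(2)[OF that] by (cases "u = v") simp_all
  have V: "x \<in> V" "y \<in> V" "x \<noteq> y" "finite V"
    using edge(1)[OF xy] ne[OF xy] sg by (simp_all add: simple_graph_def)
  have AV: "?A \<subseteq> V"
  proof
    fix a assume "a \<in> ?A"
    then have "{a, y} \<in> E" by (simp add: neighbours_def)
    from edge(1)[OF this] show "a \<in> V" by simp
  qed
  have Ay: "a \<noteq> y" if "a \<in> ?A" for a
    using that ne[of a y] by (simp add: neighbours_def)
  have N': "betti_positions TYPE('k) V ?N' (shifts (card ?A) Z)"
  proof (rule betti_positions_vars[OF _ AV Z upclosed_edges])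
    show "finite ?A" using AV V(4) finite_subset by blast
    show "(\<exists>e\<in>?E'. e \<subseteq> insert v s) = (\<exists>e\<in>?E'. e \<subseteq> s)" if "v \<in> ?A" for v s
    proof -
      have "v \<notin> e" if "e \<in> ?E'" for e using that \<open>v \<in> ?A\<close> by (auto simp: closed_neighbours_def)
      then show ?thesis by (meson subset_insert subset_insertI2)
    qed
  qed
  have N'y: "?N (insert y s)" if "?N' s" for s
    using that
  proof
    assume "\<exists>e\<in>?E'. e \<subseteq> s"
    then obtain e where e: "e \<in> E" "y \<notin> e" "e \<subseteq> s" by (auto simp: closed_neighbours_def)
    then have "e \<noteq> {x, y}" by auto
    show ?thesis by (rule bexI[of _ e]) (use e \<open>e \<noteq> {x, y}\<close> in auto)
  next
    assume "?A \<inter> s \<noteq> {}"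
    then obtain a where a: "a \<in> ?A" "a \<in> s" by blast
    then have "{a, y} \<in> E" "{a, y} \<noteq> {x, y}" by (auto simp: neighbours_def doubleton_eq_iff)
    then show ?thesis using a(2) by (intro bexI[of _ "{a, y}"]) simp_all
  qed
  \<comment> \<open>After division by x y, an edge other than e at x or y leaves its other end,
    which lies in \<open>?A\<close> by the neighbourhood condition. An edge that meets
    \<open>?A\<close> is a multiple of one of its variables, and the remaining edges avoid
    N[y].\<close>
  have N'xy: "?N' s \<longleftrightarrow> ?N (insert x (insert y s))" for s
  proof
    assume "?N' s"
    from upclosedD[OF upclosed_edges N'y[OF this], of "insert x (insert y s)"]
    show "?N (insert x (insert y s))" by auto
  next
    assume "?N (insert x (insert y s))"
    then obtain e where e: "e \<in> E" "e \<noteq> {x, y}" "e \<subseteq> insert x (insert y s)" by blast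
    show "?N' s"
    proof (cases "e \<inter> {x, y} = {}")
      case True
      then have es: "e \<subseteq> s" using e(3) by auto
      show ?thesis
      proof (cases "e \<inter> ?A = {}")
        case True
        then have "e \<inter> closed_neighbours E y = {}"
          using \<open>e \<inter> {x, y} = {}\<close> by (auto simp: closed_neighbours_def)
        then show ?thesis using e(1) es by blast
      qed (use es in blast)
    next
      case False
      obtain u v where uv: "e = {u, v}" "u \<noteq> v" by (rule pair_edge[OF sg e(1)])
      have "\<exists>a\<in>?A. a \<in> e \<and> a \<noteq> x \<and> a \<noteq> y"
      proof (cases "y \<in> e")
        case True
        then have "y = u \<or> y = v" using uv(1) by simp
        then obtain a where a: "e = {a, y}" by (metis insert_commute uv(1))
        then have "a \<noteq> x" using e(2) by auto
        then have "a \<in> ?A" using a e(1) by (simp add: neighbours_def)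
        then show ?thesis using a \<open>a \<noteq> x\<close> Ay by blast
      next
        case False
        then have "x \<in> e" using \<open>e \<inter> {x, y} \<noteq> {}\<close> by simp
        then have "x = u \<or> x = v" using uv(1) by simp
        then obtain a where a: "e = {a, x}" "a \<noteq> x" by (metis insert_commute uv)
        then have "a \<in> closed_neighbours E y" using nb e(1) by (auto simp: neighbours_def)
        moreover have "a \<noteq> y" using False a(1) by auto
        ultimately have "a \<in> ?A" using a(2) by (simp add: closed_neighbours_def)
        then show ?thesis using a \<open>a \<noteq> y\<close> by blast
      qed
      then obtain a where "a \<in> ?A" "a \<in> e" "a \<noteq> x" "a \<noteq> y" by blast
      then show ?thesis using e(3) by auto
    qed
  qed
  have "betti_positions TYPE('k) V (\<lambda>s. ?N s \<or> {x, y} \<subseteq> s)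
      (Y \<union> (\<lambda>(i, j). (Suc i, Suc j)) ` shifts (card ?A) Z)"
    by (rule betti_positions_edge[OF Y upclosed_edges N' N'xy N'y V(1-3)])
  moreover have "(\<lambda>s. ?N s \<or> {x, y} \<subseteq> s) = (\<lambda>s. \<exists>e\<in>E. e \<subseteq> s)"
  proof (rule HOL.ext)
    fix s show "(?N s \<or> {x, y} \<subseteq> s) = (\<exists>e\<in>E. e \<subseteq> s)" using xy by blast
  qed
  ultimately show ?thesis by (simp add: diag_def)
qed

lemma strands_down_closed_edge:
  assumes "simple_graph V E" "{x, y} \<in> E" "neighbours E x \<subseteq> closed_neighbours E y"
    and "strands_down_closed TYPE('k::field) V (E - {{x, y}})"
    and "strands_down_closed TYPE('k) V {e \<in> E. e \<inter> closed_neighbours E y = {}}"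
  shows "strands_down_closed TYPE('k) V E"
proof -
  obtain Y Z where "edge_positions TYPE('k) V (E - {{x, y}}) Y" "down_closed Y"
    "edge_positions TYPE('k) V {e \<in> E. e \<inter> closed_neighbours E y = {}} Z" "down_closed Z"
    using assms(4,5) unfolding strands_down_closed_def by blast
  then show ?thesis
    unfolding strands_down_closed_def using edge_positions_edge[OF assms(1-3)]
    by (blast intro: down_closed_Un down_closed_diag down_closed_shifts)
qed

section \<open>Paths and cycles beside an arbitrary disjoint graph\<close>

definition disjoint_edges :: "'v set \<Rightarrow> 'v set \<Rightarrow> 'v set set \<Rightarrow> bool" where
  "disjoint_edges V0 V F \<longleftrightarrow> (\<forall>f\<in>F. f \<subseteq> V0 \<and> card f = 2 \<and> f \<inter> V = {})"

lemma bex_subset_insert: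
  assumes "\<And>e. e \<in> P \<Longrightarrow> v \<notin> e"
  shows "(\<exists>e\<in>P. e \<subseteq> insert v s) \<longleftrightarrow> (\<exists>e\<in>P. e \<subseteq> s)"
  by (rule bex_cong[OF refl]) (use assms in auto)

text \<open>The vertices are walked through periodically by all natural numbers instead of residues,
  so successors and paths across the starting point are written without reduction modulo n.\<close>

locale cycle_labelling =
  fixes V0 V :: "'v set" and n :: nat and h :: "nat \<Rightarrow> 'v"
  assumes n: "3 \<le> n" and V: "V \<subseteq> V0" "finite V0"
    and hV: "\<And>i. h i \<in> V" and onto: "\<And>v. v \<in> V \<Longrightarrow> \<exists>i. v = h i"
    and h_eq: "\<And>i j. h i = h j \<longleftrightarrow> i mod n = j mod n"
begin

definition E :: "'v set set" where
  "E = {{h i, h (Suc i)} | i. True}"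

text \<open>The parameter \<open>m\<close> counts vertices, so \<open>m \<le> 1\<close> gives no
  edges. The labels of these vertices are distinct as long as \<open>m \<le> n\<close>.\<close>

definition path :: "nat \<Rightarrow> nat \<Rightarrow> 'v set set" where
  "path s m = {{h i, h (Suc i)} | i. s \<le> i \<and> Suc i < s + m}"

abbreviation outside :: "'v set set \<Rightarrow> bool" where
  "outside \<equiv> disjoint_edges V0 V"

lemma h_neq: "i < j \<Longrightarrow> j < i + n \<Longrightarrow> h i \<noteq> h j"
proof
  assume "i < j" "j < i + n" "h i = h j"
  then have "n dvd j - i" using h_eq[of i j] mod_eq_dvd_iff_nat[of i j n] by simp
  with \<open>i < j\<close> have "n \<le> j - i" by (intro dvd_imp_le) auto
  with \<open>j < i + n\<close> \<open>i < j\<close> show False by linarith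
qed

lemma h_neq': "i < s + n \<Longrightarrow> j < s + n \<Longrightarrow> s \<le> i \<Longrightarrow> s \<le> j \<Longrightarrow> h i = h j \<longleftrightarrow> i = j"
  using h_neq[of i j] h_neq[of j i] by (cases i j rule: linorder_cases) auto

lemma h_Suc_neq: "h i \<noteq> h (Suc i)"
  using h_neq[of i "Suc i"] n by simp

lemma h_Suc: "h (Suc i) = h (Suc j) \<longleftrightarrow> h i = h j"
proof -
  have "Suc i mod n = Suc j mod n \<longleftrightarrow> i mod n = j mod n"
  proof
    assume "Suc i mod n = Suc j mod n"
    \<comment> \<open>Adding n - 1 undoes the successor modulo n.\<close>
    then have "(Suc i + (n - 1)) mod n = (Suc j + (n - 1)) mod n" by (metis mod_add_left_eq)
    then show "i mod n = j mod n" using n by simp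
  next
    assume "i mod n = j mod n"
    then show "Suc i mod n = Suc j mod n" by (metis mod_Suc_eq)
  qed
  then show ?thesis by (simp add: h_eq)
qed

lemma h_period: "h (i + n) = h i"
  by (simp add: h_eq)

lemma E_iff: "{u, h (Suc i)} \<in> E \<longleftrightarrow> u = h i \<or> u = h (Suc (Suc i))"
proof
  assume "{u, h (Suc i)} \<in> E"
  then obtain j where "{u, h (Suc i)} = {h j, h (Suc j)}" by (auto simp: E_def)
  then have "u = h j \<and> h (Suc i) = h (Suc j) \<or> u = h (Suc j) \<and> h (Suc i) = h j"
    by (simp add: doubleton_eq_iff)
  then show "u = h i \<or> u = h (Suc (Suc i))" by (metis h_Suc)
next
  assume "u = h i \<or> u = h (Suc (Suc i))"
  then show "{u, h (Suc i)} \<in> E" unfolding E_def by (auto simp: insert_commute)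
qed

lemma h_mod: "h i = h (i mod n)" "h (Suc i) = h (Suc (i mod n))"
proof -
  show "h i = h (i mod n)" by (simp add: h_eq)
  then show "h (Suc i) = h (Suc (i mod n))" by (simp only: h_Suc)
qed

lemma edge_props: "{h i, h (Suc i)} \<subseteq> V0" "card {h i, h (Suc i)} = 2"
  using hV V h_Suc_neq by auto

lemma simple: 
  assumes "outside F" "P \<subseteq> E"
  shows "simple_graph V0 (P \<union> F)"
  unfolding simple_graph_def
proof (intro conjI ballI)
  fix e assume "e \<in> P \<union> F"
  then show "e \<subseteq> V0" "card e = 2"
    using assms edge_props unfolding E_def disjoint_edges_def by blast+
qed (rule V(2))

lemma outside_notin:
  assumes "outside F"
  shows "{u, h i} \<notin> F" "{h i, u} \<notin> F"
proof -
  have "f \<inter> V = {}" if "f \<in> F" for f using assms that by (simp add: disjoint_edges_def)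
  from this[of "{u, h i}"] this[of "{h i, u}"] show "{u, h i} \<notin> F" "{h i, u} \<notin> F"
    using hV[of i] by auto
qed

lemma outside_disjoint: "outside F \<Longrightarrow> f \<in> F \<Longrightarrow> f \<inter> V = {}"
  by (simp add: disjoint_edges_def)

lemma filter_outside:
  assumes "outside F" "C \<subseteq> V"
  shows "{e \<in> P \<union> F. e \<inter> C = {}} = {e \<in> P. e \<inter> C = {}} \<union> F"
proof -
  have "f \<inter> C = {}" if "f \<in> F" for f using outside_disjoint[OF assms(1) that] assms(2) by auto
  then show ?thesis by auto
qed

lemma path_E: "path s m \<subseteq> E"
  by (auto simp: path_def E_def)

lemma path_short: "m \<le> 1 \<Longrightarrow> path s m = {}"
  by (auto simp: path_def)

lemma path_Suc: "path s (Suc (Suc m)) = insert {h (s + m), h (Suc (s + m))} (path s (Suc m))"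
proof -
  have "i = s + m \<or> Suc i < s + Suc m" if "Suc i < s + Suc (Suc m)" for i using that by arith
  then show ?thesis unfolding path_def by auto
qed

lemma path_vertex:
  assumes "e \<in> path s m" shows "\<exists>i. s \<le> i \<and> Suc i < s + m \<and> e = {h i, h (Suc i)}"
  using assms by (auto simp: path_def)

lemma path_mono:
  assumes "s' \<le> s" "s + m \<le> s' + m'" shows "path s m \<subseteq> path s' m'"
proof
  fix e assume "e \<in> path s m"
  then obtain i where "s \<le> i" "Suc i < s + m" "e = {h i, h (Suc i)}" using path_vertex by blast
  then show "e \<in> path s' m'" unfolding path_def
    by (intro CollectI exI[of _ i]) (use assms in simp)
qed

text \<open>Both \<open>k\<close> and the path lie in the window [r, r + n), on which
  \<open>h\<close> is injective. The free choice of \<open>r\<close> allows \<open>k\<close> on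
  either side of the path.\<close>

lemma path_avoids:
  assumes "e \<in> path s m" "k < s \<or> s + m \<le> k" "k < r + n" "r \<le> k" "r \<le> s" "s + m \<le> r + n"
  shows "h k \<notin> e"
proof
  assume "h k \<in> e"
  then obtain i where i: "s \<le> i" "Suc i < s + m" "h k = h i \<or> h k = h (Suc i)"
    using path_vertex[OF assms(1)] by auto
  then have "k = i \<or> k = Suc i"
    using h_neq'[of k r i] h_neq'[of k r "Suc i"] assms by auto
  with i assms(2) show False by auto
qed

text \<open>An end vertex x is a leaf, so its edge to its neighbour y satisfies the neighbourhood
  condition. Deleting the edge drops one vertex from the path, removing N[y] drops three, and N(y) -
  {x} has one element; a path on two vertices loses both, and the set is empty. This is the
  recursion of \<open>path_positions\<close>.\<close>

lemma edge_positions_path: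
  assumes F: "outside F" "edge_positions TYPE('k::field) V0 F Y"
  shows "m \<le> n \<Longrightarrow> edge_positions TYPE('k) V0 (path s m \<union> F) (path_positions m Y)"
  using F(2)
proof (induction m Y rule: path_positions.induct)
  case (3 Y)
  let ?x = "h (Suc s)" and ?y = "h s"
  let ?E = "path s (Suc (Suc 0)) \<union> F"
  have P: "path s (Suc (Suc 0)) = {{?y, ?x}}" using path_Suc[of s 0] path_short[of 1 s] by simp
  have nb: "{u, h i} \<in> ?E \<longleftrightarrow> {u, h i} = {?x, ?y}" for u i
    using outside_notin[OF F(1)] by (auto simp: P insert_commute)
  have nx: "neighbours ?E ?x = {?y}" and ny: "neighbours ?E ?y = {?x}"
    using h_Suc_neq[of s] unfolding neighbours_def nb by (auto simp: doubleton_eq_iff)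
  have "edge_positions TYPE('k) V0 ?E (Y \<union> diag (shifts (card (neighbours ?E ?y - {?x})) Y))"
  proof (rule edge_positions_edge)
    show "simple_graph V0 ?E" by (rule simple[OF F(1) path_E])
    show "{?x, ?y} \<in> ?E" by (simp add: P insert_commute)
    show "neighbours ?E ?x \<subseteq> closed_neighbours ?E ?y" by (simp add: nx closed_neighbours_def)
    have "?E - {{?x, ?y}} = F" using outside_notin[OF F(1)] by (auto simp: P insert_commute)
    then show "edge_positions TYPE('k) V0 (?E - {{?x, ?y}}) Y" using 3 by simp
    have "{e \<in> ?E. e \<inter> closed_neighbours ?E ?y = {}} = F"
      unfolding closed_neighbours_def ny using hV by (subst filter_outside[OF F(1)]) (auto simp: P)
    then show "edge_positions TYPE('k) V0 {e \<in> ?E. e \<inter> closed_neighbours ?E ?y = {}} Y" using 3 by simp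
  qed
  then show ?case by (simp add: ny)
next
  case (4 m Y)
  let ?x = "h (Suc (Suc (s + m)))" and ?y = "h (Suc (s + m))" and ?z = "h (s + m)"
  let ?E = "path s (Suc (Suc (Suc m))) \<union> F"
  have P: "path s (Suc (Suc (Suc m))) = insert {?y, ?x} (path s (Suc (Suc m)))"
    using path_Suc[of s "Suc m"] by simp
  have P': "path s (Suc (Suc m)) = insert {?z, ?y} (path s (Suc m))" by (rule path_Suc)
  have mn: "Suc (Suc (Suc m)) \<le> n" using 4 by simp
  have xP: "?x \<notin> e" if "e \<in> path s (Suc (Suc m))" for e
    by (rule path_avoids[OF that, where r=s]) (use mn in auto)
  have yP: "?y \<notin> e" if "e \<in> path s (Suc m)" for e
    by (rule path_avoids[OF that, where r=s]) (use mn in auto)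
  have xy: "?x \<noteq> ?y" "?x \<noteq> ?z" "?y \<noteq> ?z"
    using mn h_neq'[of _ s] by auto
  have Eh: "{u, h i} \<in> ?E \<longleftrightarrow> {u, h i} \<in> path s (Suc (Suc (Suc m)))" for u i
    using outside_notin[OF F(1)] by auto
  have nx: "neighbours ?E ?x = {?y}"
    using xP xy unfolding neighbours_def Eh unfolding P by (auto simp: doubleton_eq_iff)
  have ny: "neighbours ?E ?y = {?x, ?z}"
    using yP xy unfolding neighbours_def Eh unfolding P P' by (auto simp: doubleton_eq_iff)
  have "edge_positions TYPE('k) V0 ?E (path_positions (Suc (Suc m)) Y \<union>
      diag (shifts (card (neighbours ?E ?y - {?x})) (path_positions m Y)))"
  proof (rule edge_positions_edge)
    show "simple_graph V0 ?E" by (rule simple[OF F(1) path_E])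
    show "{?x, ?y} \<in> ?E" by (simp add: P insert_commute)
    show "neighbours ?E ?x \<subseteq> closed_neighbours ?E ?y" by (simp add: nx closed_neighbours_def)
    have "{?x, ?y} \<notin> path s (Suc (Suc m))" using xP by blast
    then have "?E - {{?x, ?y}} = path s (Suc (Suc m)) \<union> F"
      using outside_notin[OF F(1)] by (auto simp: P insert_commute)
    then show "edge_positions TYPE('k) V0 (?E - {{?x, ?y}}) (path_positions (Suc (Suc m)) Y)" using 4 by simp
    have cn: "closed_neighbours ?E ?y = {?x, ?y, ?z}" by (auto simp: closed_neighbours_def ny)
    have "path s m = {e \<in> path s (Suc m). ?z \<notin> e}"
    proof (cases m)
      case 0
      then show ?thesis by (simp add: path_short)
    next
      case (Suc k)
      have "h (s + m) \<notin> e" if "e \<in> path s m" for e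
        by (rule path_avoids[OF that, where r=s]) (use mn in auto)
      then show ?thesis using path_Suc[of s k] Suc by auto
    qed
    moreover have "e \<inter> {?x, ?y, ?z} = {} \<longleftrightarrow> ?z \<notin> e" if "e \<in> path s (Suc m)" for e
      using xP[of e] yP[of e] that P' by auto
    then have "{e \<in> path s (Suc (Suc (Suc m))). e \<inter> {?x, ?y, ?z} = {}} = {e \<in> path s (Suc m). ?z \<notin> e}"
      unfolding P P' by auto
    ultimately have "{e \<in> ?E. e \<inter> {?x, ?y, ?z} = {}} = path s m \<union> F"
      using hV by (subst filter_outside[OF F(1)]) auto
    then show "edge_positions TYPE('k) V0 {e \<in> ?E. e \<inter> closed_neighbours ?E ?y = {}} (path_positions m Y)"
      using 4 unfolding cn by simp
  qed
  moreover have "neighbours ?E ?y - {?x} = {?z}" using xy by (auto simp: ny)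
  ultimately show ?case by simp
qed (simp_all add: path_short)

text \<open>A triangle has an edge with the neighbourhood condition; a longer cycle is closed up
  from the path on n - 1 vertices that omits h 0. Dividing by one end of that path turns the
  neighbour of this end into a variable, which leaves n - 3 vertices; for the second end, the first
  one is a variable as well, which leaves n - 4.\<close>

lemma strands_down_closed_full_cycle:
  assumes F: "outside F" "strands_down_closed TYPE('k::field) V0 F" and n3: "n mod 3 \<noteq> 2"
  shows "strands_down_closed TYPE('k) V0 (E \<union> F)"
proof -
  obtain Y where Y: "edge_positions TYPE('k) V0 F Y" "down_closed Y" using F(2) by (auto simp: strands_down_closed_def)
  note path = edge_positions_path[OF F(1) Y(1)]
  show ?thesis
  proof (cases "n = 3")
    case True
    let ?E = "E \<union> F"
    have h3: "h 3 = h 0" using h_period[of 0] True by simp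
    have neq: "h 0 \<noteq> h 1" "h 1 \<noteq> h 2" "h 0 \<noteq> h 2" using h_neq'[of _ 0] True by auto
    have nb: "{u, h i} \<in> ?E \<longleftrightarrow> {u, h i} \<in> E" for u i using outside_notin[OF F(1)] by auto
    have n1: "neighbours ?E (h 1) = {h 0, h 2}"
      using E_iff[of _ 0] unfolding neighbours_def nb One_nat_def by (auto simp: numeral_2_eq_2)
    have n0: "neighbours ?E (h 0) = {h 2, h 1}"
      using E_iff[of _ 2] h_period[of 1] unfolding neighbours_def nb h3[symmetric]
      by (auto simp: True numeral_3_eq_3 numeral_2_eq_2)
    have E: "E = {{h 0, h 1}, {h 1, h 2}, {h 2, h 3}}"
    proof (intro equalityI subsetI)
      fix e assume "e \<in> E"
      then obtain i where "e = {h i, h (Suc i)}" by (auto simp: E_def)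
      moreover note h_mod[of i]
      moreover have "i mod n = 0 \<or> i mod n = 1 \<or> i mod n = 2" using True by auto
      ultimately show "e \<in> {{h 0, h 1}, {h 1, h 2}, {h 2, h 3}}"
        by (auto simp: numeral_2_eq_2 numeral_3_eq_3)
    next
      fix e assume "e \<in> {{h 0, h 1}, {h 1, h 2}, {h 2, h 3}}"
      then have "e = {h 0, h (Suc 0)} \<or> e = {h 1, h (Suc 1)} \<or> e = {h 2, h (Suc 2)}"
        by (simp add: numeral_2_eq_2 numeral_3_eq_3)
      then show "e \<in> E" unfolding E_def by blast
    qed
    show ?thesis
    proof (rule strands_down_closed_edge[where x="h 0" and y="h 1"])
      show "simple_graph V0 ?E" by (rule simple[OF F(1)]) simp
      show "{h 0, h 1} \<in> ?E" using E by simp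
      show "neighbours ?E (h 0) \<subseteq> closed_neighbours ?E (h 1)" unfolding closed_neighbours_def n0 n1 by auto
      have "path 1 3 = {{h 1, h 2}, {h 2, h 3}}"
        using path_Suc[of 1 1] path_Suc[of 1 0] path_short[of 1 1]
        by (auto simp: numeral_2_eq_2 numeral_3_eq_3)
      then have "?E - {{h 0, h 1}} = path 1 3 \<union> F"
        using neq outside_notin(1)[OF F(1), of "h 0" 1] by (auto simp: E h3 doubleton_eq_iff)
      then show "strands_down_closed TYPE('k) V0 (?E - {{h 0, h 1}})"
        using path[of 3 1] True down_closed_path_positions[OF Y(2)] by (auto simp: strands_down_closed_def)
      have "{e \<in> ?E. e \<inter> closed_neighbours ?E (h 1) = {}} = F"
        unfolding closed_neighbours_def n1 using hV
        by (subst filter_outside[OF F(1)]) (auto simp: E h3)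
      then show "strands_down_closed TYPE('k) V0 {e \<in> ?E. e \<inter> closed_neighbours ?E (h 1) = {}}" using F(2) by simp
    qed
  next
    case False
    \<comment> \<open>The paths involved then have k + 3, k + 1 and k vertices, as in
      \<open>down_closed_cycle_positions\<close>.\<close>
    define k where "k = n - 4"
    have k: "n = Suc (Suc (Suc (Suc k)))" using n False by (simp add: k_def)
    let ?J = "path 1 (n - 1) \<union> F"
    let ?N = "\<lambda>s. \<exists>e\<in>?J. e \<subseteq> s"
    let ?x = "h 0" and ?a = "h 1" and ?b = "h (n - 1)"
    have Fh: "h i \<notin> f" if "f \<in> F" for f i using F(1) hV[of i] that by (auto simp: disjoint_edges_def)
    have eq: "h i = h j \<longleftrightarrow> i = j" if "i < n" "j < n" for i j using h_neq'[of i 0 j] that by simp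
    have sub_insert: "e \<subseteq> insert v s \<longleftrightarrow> e \<subseteq> s" if "v \<notin> e" for e s and v :: 'v using that by auto
    have xJ: "?x \<notin> e" if "e \<in> ?J" for e
      using that Fh path_avoids[of e 1 "n - 1" 0 0] n by auto
    have N: "edge_positions TYPE('k) V0 ?J (path_positions (n - 1) Y)" by (rule path) simp
    have Nx: "?N (insert ?x s) = ?N s" for s
      by (rule bex_subset_insert[OF xJ])
    let ?Ja = "path 3 (n - 3) \<union> F" and ?Jb = "path 2 (n - 4) \<union> F"
    have "betti_positions TYPE('k) V0 (\<lambda>s. (\<exists>e\<in>?Ja. e \<subseteq> s) \<or> {h 2} \<inter> s \<noteq> {})
      (shifts (card {h 2}) (path_positions (n - 3) Y))"
    proof (rule betti_positions_vars)
      show "edge_positions TYPE('k) V0 ?Ja (path_positions (n - 3) Y)" by (rule path) simp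
      fix v s assume "v \<in> {h 2}"
      then have "v \<notin> e" if "e \<in> ?Ja" for e
        using that Fh path_avoids[of e 3 "n - 3" 2 0] n by auto
      then show "(\<exists>e\<in>?Ja. e \<subseteq> insert v s) = (\<exists>e\<in>?Ja. e \<subseteq> s)"
        by (rule bex_subset_insert)
    qed (use hV V upclosed_edges in auto)
    \<comment> \<open>Division by \<open>?a\<close> turns the edge from h 1 to h 2 into the variable
      of h 2, which absorbs the edge from h 2 to h 3.\<close>
    moreover have "(\<lambda>s. (\<exists>e\<in>?Ja. e \<subseteq> s) \<or> {h 2} \<inter> s \<noteq> {}) = (\<lambda>s. ?N (insert ?a s))"
    proof (rule HOL.ext)
      fix s
      show "((\<exists>e\<in>?Ja. e \<subseteq> s) \<or> {h 2} \<inter> s \<noteq> {}) = ?N (insert ?a s)"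
      proof
        assume "(\<exists>e\<in>?Ja. e \<subseteq> s) \<or> {h 2} \<inter> s \<noteq> {}"
        then show "?N (insert ?a s)"
        proof
          have "path 3 (n - 3) \<subseteq> path 1 (n - 1)" by (rule path_mono) (use k in simp_all)
          then have "?Ja \<subseteq> ?J" by blast
          moreover assume "\<exists>e\<in>?Ja. e \<subseteq> s"
          ultimately show ?thesis by blast
        next
          assume "{h 2} \<inter> s \<noteq> {}"
          then have "{h 1, h (Suc 1)} \<subseteq> insert ?a s" by (simp add: numeral_2_eq_2)
          moreover have "{h 1, h (Suc 1)} \<in> path 1 (n - 1)"
            unfolding path_def by (intro CollectI exI[of _ 1]) (use k in simp)
          ultimately show ?thesis by blast
        qed
      next
        assume "?N (insert ?a s)"
        then obtain e where e: "e \<in> ?J" "e \<subseteq> insert ?a s" by blast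
        show "(\<exists>e\<in>?Ja. e \<subseteq> s) \<or> {h 2} \<inter> s \<noteq> {}"
        proof (cases "e \<in> F")
          case True
          then have "e \<subseteq> s" using sub_insert[of ?a e s] Fh e(2) by simp
          with True show ?thesis by blast
        next
          case False
          then obtain i where i: "1 \<le> i" "Suc i < n" "e = {h i, h (Suc i)}"
            using e(1) path_vertex[of e 1 "n - 1"] n by auto
          have es: "h j \<in> s" if "j = i \<or> j = Suc i" "j \<noteq> 1" for j
          proof -
            have "h j \<in> insert ?a s" "h j \<noteq> ?a" using e(2) i that eq[of j 1] n by auto
            then show ?thesis by simp
          qed
          show ?thesis
          proof (cases "i \<le> 2")
            case True
            then have "h 2 \<in> s" using es[of 2] i(1) by (auto simp: le_Suc_eq numeral_2_eq_2)
            then show ?thesis by simp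
          next
            case False
            then have "e \<in> path 3 (n - 3)" unfolding path_def using i by auto
            moreover have "e \<subseteq> s" using es[of i] es[of "Suc i"] i False by simp
            ultimately show ?thesis by blast
          qed
        qed
      qed
    qed
    ultimately have Na: "betti_positions TYPE('k) V0 (\<lambda>s. ?N (insert ?a s)) (shifts 1 (path_positions (n - 3) Y))"
      by simp
    have "betti_positions TYPE('k) V0 (\<lambda>s. (\<exists>e\<in>?Jb. e \<subseteq> s) \<or> {h 1, h (n - 2)} \<inter> s \<noteq> {})
      (shifts (card {h 1, h (n - 2)}) (path_positions (n - 4) Y))"
    proof (rule betti_positions_vars)
      show "edge_positions TYPE('k) V0 ?Jb (path_positions (n - 4) Y)" by (rule path) simp
      fix v s assume "v \<in> {h 1, h (n - 2)}"
      then have "v \<notin> e" if "e \<in> ?Jb" for e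
        using that Fh path_avoids[of e 2 "n - 4" 1 0] path_avoids[of e 2 "n - 4" "n - 2" 0] k by auto
      then show "(\<exists>e\<in>?Jb. e \<subseteq> insert v s) = (\<exists>e\<in>?Jb. e \<subseteq> s)"
        by (rule bex_subset_insert)
    qed (use hV V upclosed_edges in auto)
    moreover have "card {h 1, h (n - 2)} = 2" using eq[of 1 "n - 2"] k by simp
    \<comment> \<open>Division by \<open>?b\<close> leaves the variable of h (n - 2), and
      \<open>?a\<close> is a variable by the filtration. Together they absorb the edges at both ends
      of the path.\<close>
    moreover have "(\<lambda>s. (\<exists>e\<in>?Jb. e \<subseteq> s) \<or> {h 1, h (n - 2)} \<inter> s \<noteq> {}) = (\<lambda>s. ?N (insert ?b s) \<or> ?a \<in> s)"
    proof (rule HOL.ext)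
      fix s
      show "((\<exists>e\<in>?Jb. e \<subseteq> s) \<or> {h 1, h (n - 2)} \<inter> s \<noteq> {}) = (?N (insert ?b s) \<or> ?a \<in> s)"
      proof
        assume "(\<exists>e\<in>?Jb. e \<subseteq> s) \<or> {h 1, h (n - 2)} \<inter> s \<noteq> {}"
        then consider e where "e \<in> ?Jb" "e \<subseteq> s" | "h 1 \<in> s" | "h (n - 2) \<in> s" by blast
        then show "?N (insert ?b s) \<or> ?a \<in> s"
        proof cases
          case (1 e)
          have "path 2 (n - 4) \<subseteq> path 1 (n - 1)" by (rule path_mono) (use k in simp_all)
          then have "?Jb \<subseteq> ?J" by blast
          then show ?thesis using 1 by blast
        next
          case 3
          then have "{h (n - 2), h (Suc (n - 2))} \<subseteq> insert ?b s" by (simp add: k)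
          moreover have "{h (n - 2), h (Suc (n - 2))} \<in> path 1 (n - 1)"
            unfolding path_def by (intro CollectI exI[of _ "n - 2"]) (use k in simp)
          ultimately show ?thesis by blast
        qed simp
      next
        assume "?N (insert ?b s) \<or> ?a \<in> s"
        then show "(\<exists>e\<in>?Jb. e \<subseteq> s) \<or> {h 1, h (n - 2)} \<inter> s \<noteq> {}"
        proof
          assume "?N (insert ?b s)"
          then obtain e where e: "e \<in> ?J" "e \<subseteq> insert ?b s" by blast
          show ?thesis
          proof (cases "e \<in> F")
            case True
            then have "e \<subseteq> s" using sub_insert[of ?b e s] Fh e(2) by simp
            with True show ?thesis by blast
          next
            case False
            then obtain i where i: "1 \<le> i" "Suc i < n" "e = {h i, h (Suc i)}"
              using e(1) path_vertex[of e 1 "n - 1"] n by auto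
            have es: "h j \<in> s" if "j = i \<or> j = Suc i" "j \<noteq> n - 1" for j
            proof -
              have "h j \<in> insert ?b s" "h j \<noteq> ?b" using e(2) i that eq[of j "n - 1"] n by auto
              then show ?thesis by simp
            qed
            consider "i = 1" | "Suc i = n - 1" | "i = n - 2" | "2 \<le> i" "Suc i < n - 2" | "Suc i = n - 2"
              using i(1,2) by linarith
            then show ?thesis
            proof cases
              case 1
              then have "h 1 \<in> s" using es[of 1] k by simp
              then show ?thesis by simp
            next
              case 2
              then have "h (n - 2) \<in> s" using es[of "n - 2"] k by simp
              then show ?thesis by simp
            next
              case 3
              then have "h (n - 2) \<in> s" using es[of "n - 2"] k by simp
              then show ?thesis by simp
            next
              case 4
              then have "e \<in> path 2 (n - 4)" unfolding path_def using i by auto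
              moreover have "e \<subseteq> s" using es[of i] es[of "Suc i"] i 4 by simp
              ultimately show ?thesis by blast
            next
              case 5
              then have "h (n - 2) \<in> s" using es[of "n - 2"] k by simp
              then show ?thesis by simp
            qed
          qed
        qed simp
      qed
    qed
    ultimately have Nb: "betti_positions TYPE('k) V0 (\<lambda>s. ?N (insert ?b s) \<or> ?a \<in> s)
        (shifts 2 (path_positions (n - 4) Y))"
      by simp
    have neq: "?x \<noteq> ?a" "?x \<noteq> ?b" "?a \<noteq> ?b" using eq k by auto
    from betti_positions_path_to_cycle[OF N upclosed_edges Nx Na Nb _ _ _ neq] hV V
    obtain Z where Z: "Z \<subseteq> diag (shifts 1 (path_positions (n - 3) Y) \<union> shifts 2 (path_positions (n - 4) Y))"
      "betti_positions TYPE('k) V0 (\<lambda>s. ?N s \<or> {?x, ?a} \<subseteq> s \<or> {?x, ?b} \<subseteq> s) (path_positions (n - 1) Y \<union> Z)"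
      unfolding diag_def by blast
    have "E \<union> F = insert {?x, ?a} (insert {?x, ?b} ?J)"
    proof -
      have "e \<in> insert {?x, ?a} (insert {?x, ?b} (path 1 (n - 1)))" if eE: "e \<in> E" for e
      proof -
        obtain i where "e = {h i, h (Suc i)}" using eE unfolding E_def by blast
        then have e: "e = {h (i mod n), h (Suc (i mod n))}" using h_mod[of i] by metis
        have "i mod n < n" using n by simp
        then consider "i mod n = 0" | "i mod n = n - 1" | "1 \<le> i mod n" "Suc (i mod n) < n" by linarith
        then show ?thesis
        proof cases
          case 2
          moreover have "h (Suc (n - 1)) = h 0" using h_period[of 0] n by simp
          ultimately show ?thesis using e by (simp add: insert_commute)
        next
          case 3
          then have "e \<in> path 1 (n - 1)" unfolding path_def using e by auto
          then show ?thesis by simp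
        qed (use e in simp)
      qed
      moreover have "{?x, ?a} \<in> E" unfolding E_def by auto
      moreover have "{?x, ?b} \<in> E"
      proof -
        have "h (Suc (n - 1)) = h 0" using h_period[of 0] n by simp
        then have "{h (n - 1), h (Suc (n - 1))} = {?x, ?b}" by auto
        then show ?thesis unfolding E_def by blast
      qed
      ultimately show ?thesis using path_E[of 1 "n - 1"] by blast
    qed
    then have "edge_positions TYPE('k) V0 (E \<union> F) (path_positions (n - 1) Y \<union> Z)"
      using Z(2) by (simp add: disj_ac)
    moreover have "down_closed (path_positions (n - 1) Y \<union> Z)"
    proof -
      \<comment> \<open>\<open>Suc k\<close> is n - 3 and has the same residue as n.\<close>
      have "Suc k mod 3 \<noteq> 2" using n3 k by presburger
      from down_closed_cycle_positions[OF Y(2) this, of Z] Z(1) show ?thesis by (simp add: k)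
    qed
    ultimately show ?thesis unfolding strands_down_closed_def by blast
  qed
qed

text \<open>A proper induced subgraph of a cycle that still has an edge has a leaf where a run of
  consecutive vertices ends, and the edge at a leaf satisfies the neighbourhood condition. Removing
  the leaf, or the closed neighbourhood of its neighbour, gives a smaller induced subgraph of the
  same cycle.\<close>

lemma strands_down_closed_induced_cycle:
  assumes F: "outside F" "strands_down_closed TYPE('k::field) V0 F" and n3: "n mod 3 \<noteq> 2"
  shows "W \<subseteq> V \<Longrightarrow> strands_down_closed TYPE('k) V0 (induced_edges E W \<union> F)"
proof (induction "card W" arbitrary: W rule: less_induct)
  case less
  have finW: "finite W" using less.prems V by (meson finite_subset)
  show ?case
  proof (cases "W = V \<or> induced_edges E W = {}")
    case True
    moreover have "induced_edges E V = E" using hV by (auto simp: induced_edges_def E_def)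
    ultimately show ?thesis using strands_down_closed_full_cycle[OF F n3] F(2) by auto
  next
    case False
    then obtain i0 where i0: "h i0 \<in> W" "h (Suc i0) \<in> W"
      by (auto simp: induced_edges_def E_def)
    \<comment> \<open>Otherwise the walk that starts at \<open>i0\<close> never leaves
      \<open>W\<close> and passes through the whole cycle.\<close>
    have "\<exists>i. h i \<in> W \<and> h (Suc i) \<in> W \<and> h (Suc (Suc i)) \<notin> W"
    proof (rule ccontr)
      assume *: "\<not> ?thesis"
      have "h (i0 + j) \<in> W \<and> h (Suc (i0 + j)) \<in> W" for j
        by (induction j) (use i0 * in auto)
      \<comment> \<open>The walk only moves forward from \<open>i0\<close>; this offset reaches the
        index i + n i0, which differs from i by full rounds.\<close>
      moreover have "h i = h (i0 + (i + (n - 1) * i0))" for i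
      proof -
        obtain N where N: "n = Suc N" using n by (cases n) auto
        have "i0 + (i + (n - 1) * i0) = i + n * i0" by (simp add: N)
        then show ?thesis by (simp only: h_eq mod_mult_self2)
      qed
      ultimately have "h i \<in> W" for i by metis
      then have "V \<subseteq> W" using onto by blast
      then show False using False less.prems by blast
    qed
    then obtain i where i: "h i \<in> W" "h (Suc i) \<in> W" "h (Suc (Suc i)) \<notin> W" by blast
    let ?E = "induced_edges E W \<union> F" and ?x = "h (Suc i)" and ?y = "h i"
    have Eh: "{u, h j} \<in> ?E \<longleftrightarrow> {u, h j} \<in> E \<and> u \<in> W \<and> h j \<in> W" for u j
      using outside_notin[OF F(1)] by (auto simp: induced_edges_def)
    have nx: "neighbours ?E ?x = {?y}"
      using i unfolding neighbours_def Eh E_iff by auto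
    have yx: "{?x, ?y} \<in> E" using E_iff[of ?y i] by (simp add: insert_commute)
    have nyV: "closed_neighbours ?E ?y \<subseteq> W"
      using i unfolding closed_neighbours_def neighbours_def Eh by auto
    show ?thesis
    proof (rule strands_down_closed_edge[where x="?x" and y="?y"])
      show "simple_graph V0 ?E" by (rule simple[OF F(1)]) (auto simp: induced_edges_def)
      show "{?x, ?y} \<in> ?E" using yx i unfolding Eh by simp
      show "neighbours ?E ?x \<subseteq> closed_neighbours ?E ?y" by (simp add: nx closed_neighbours_def)
      have "?E - {{?x, ?y}} = induced_edges E (W - {?x}) \<union> F"
      proof -
        have "e = {?x, ?y}" if e: "e \<in> E" "e \<subseteq> W" "?x \<in> e" for e
        proof -
          obtain j where j: "e = {h j, h (Suc j)}" using e(1) by (auto simp: E_def)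
          then have "h (Suc i) = h j \<or> h (Suc i) = h (Suc j)" using e(3) by simp
          then obtain u where u: "e = {u, ?x}" using j by (metis insert_commute)
          then show ?thesis using E_iff[of u i] e i by (auto simp: insert_commute)
        qed
        then show ?thesis using outside_notin[OF F(1)] by (auto simp: induced_edges_def)
      qed
      moreover have "card (W - {?x}) < card W" using i finW by (intro psubset_card_mono) auto
      ultimately show "strands_down_closed TYPE('k) V0 (?E - {{?x, ?y}})" using less.hyps[of "W - {?x}"] less.prems by auto
      let ?C = "closed_neighbours ?E ?y"
      have "{e \<in> ?E. e \<inter> ?C = {}} = induced_edges E (W - ?C) \<union> F"
      proof -
        have "?C \<subseteq> V" using nyV less.prems by blast
        moreover have "{e \<in> induced_edges E W. e \<inter> ?C = {}} = induced_edges E (W - ?C)"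
          unfolding induced_edges_def by blast
        ultimately show ?thesis using filter_outside[OF F(1)] by simp
      qed
      moreover have "card (W - ?C) < card W"
        using i finW by (intro psubset_card_mono) (auto simp: closed_neighbours_def)
      ultimately show "strands_down_closed TYPE('k) V0 {e \<in> ?E. e \<inter> ?C = {}}"
        using less.hyps[of "W - ?C"] less.prems by auto
    qed
  qed
qed

end

lemma is_cycle_labelling:
  assumes cyc: "is_cycle n V E" and sg: "simple_graph V E" and V: "V \<subseteq> V0" "finite V0"
  obtains h where "cycle_labelling V0 V n h" "E = cycle_labelling.E h"
proof -
  obtain f where f: "bij_betw f V {..<n}"
    and fE: "\<And>u v. u \<in> V \<Longrightarrow> v \<in> V \<Longrightarrow> {u, v} \<in> E \<longleftrightarrow> {f u, f v} \<in> cycle_edges n"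
    and n: "3 \<le> n"
    using cyc unfolding is_cycle_def graph_isomorphic_def by blast
  define h where "h i = inv_into V f (i mod n)" for i
  have fh: "f (h i) = i mod n" for i
    unfolding h_def by (rule bij_betw_inv_into_right[OF f]) (use n in simp)
  have hV: "h i \<in> V" for i
    unfolding h_def using bij_betw_inv_into[OF f] n by (auto simp: bij_betw_def)
  have hf: "h (f v) = v" if "v \<in> V" for v
  proof -
    have "f v < n" using f that by (auto simp: bij_betw_def)
    then show ?thesis unfolding h_def using bij_betw_inv_into_left[OF f that] by simp
  qed
  have h_reduce: "h (i mod n) = h i" for i by (simp add: h_def)
  interpret cycle_labelling V0 V n h
  proof
    show "\<exists>i. v = h i" if "v \<in> V" for v using hf[OF that] by metis
    show "h i = h j \<longleftrightarrow> i mod n = j mod n" for i j using fh h_reduce by metis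
  qed (use n V hV in auto)
  have "E = cycle_labelling.E h"
  proof (intro equalityI subsetI)
    fix e assume e: "e \<in> E"
    obtain u v where uv: "e = {u, v}" "u \<in> V" "v \<in> V" by (rule pair_edge[OF sg e])
    then have "{f u, f v} \<in> cycle_edges n" using fE e by simp
    then obtain i where i: "{f u, f v} = {i, Suc i mod n}" by (auto simp: cycle_edges_def)
    have "{u, v} = {h (f u), h (f v)}" using hf uv by simp
    also have "\<dots> = h ` {f u, f v}" by simp
    also have "\<dots> = {h i, h (Suc i)}" unfolding i by (simp add: h_reduce)
    finally show "e \<in> cycle_labelling.E h" using uv(1) unfolding E_def by blast
  next
    fix e assume "e \<in> cycle_labelling.E h"
    then obtain i where i: "e = {h i, h (Suc i)}" unfolding E_def by blast
    have "{i mod n, Suc (i mod n) mod n} \<in> cycle_edges n"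
      unfolding cycle_edges_def using n by (intro CollectI exI[of _ "i mod n"]) simp
    then have "{f (h i), f (h (Suc i))} \<in> cycle_edges n" by (simp add: fh mod_Suc_eq)
    then show "e \<in> E" using fE[OF hV hV] i by simp
  qed
  then show thesis using that cycle_labelling_axioms by blast
qed

section \<open>Induction over the class\<close>

definition no_bad_cycle :: "'v set \<Rightarrow> 'v set set \<Rightarrow> bool" where
  "no_bad_cycle V E \<longleftrightarrow> (\<forall>n. n mod 3 = 2 \<longrightarrow> \<not> (\<exists>W\<subseteq>V. is_cycle n W (induced_edges E W)))"

lemma simple_graph_induced:
  "simple_graph V E \<Longrightarrow> W \<subseteq> V \<Longrightarrow> simple_graph W (induced_edges E W)"
  by (auto simp: simple_graph_def induced_edges_def intro: finite_subset)

lemma induced_edges_induced: "W \<subseteq> C \<Longrightarrow> induced_edges (induced_edges E C) W = induced_edges E W"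
  by (auto simp: induced_edges_def)

lemma no_bad_cycle_induced:
  "no_bad_cycle V E \<Longrightarrow> C \<subseteq> V \<Longrightarrow> no_bad_cycle C (induced_edges E C)"
  unfolding no_bad_cycle_def by (metis induced_edges_induced order_trans)

text \<open>An induced cycle of \<open>G - e\<close> through both ends of \<open>e\<close> has length four: the two neighbours of
  \<open>x\<close> on the cycle are also the neighbours of \<open>y\<close> on it.\<close>

lemma no_bad_cycle_delete:
  assumes sg: "simple_graph V E" and bad: "no_bad_cycle V E" and xy: "{x, y} \<in> E"
    and nb: "neighbours E x \<subseteq> closed_neighbours E y"
  shows "no_bad_cycle V (E - {{x, y}})"
  unfolding no_bad_cycle_def
proof (intro allI impI notI)
  fix n :: nat assume n3: "n mod 3 = 2" and "\<exists>W\<subseteq>V. is_cycle n W (induced_edges (E - {{x, y}}) W)"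
  then obtain W where W: "W \<subseteq> V" "is_cycle n W (induced_edges (E - {{x, y}}) W)" by blast
  show False
  proof (cases "{x, y} \<subseteq> W")
    case False
    then have "induced_edges (E - {{x, y}}) W = induced_edges E W" by (auto simp: induced_edges_def)
    then show False using bad n3 W unfolding no_bad_cycle_def by metis
  next
    case True
    let ?F = "induced_edges (E - {{x, y}}) W"
    have sgD: "simple_graph V (E - {{x, y}})" using sg by (auto simp: simple_graph_def)
    have fin: "finite W" using W(1) sg by (auto simp: simple_graph_def intro: finite_subset)
    obtain h where "cycle_labelling W W n h" "?F = cycle_labelling.E h"
      by (rule is_cycle_labelling[OF W(2) simple_graph_induced[OF sgD W(1)] order_refl fin])
    then interpret cycle_labelling W W n h by simp
    have F: "?F = cycle_labelling.E h" by fact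
    have ne: "u \<noteq> v" if "{u, v} \<in> E" for u v
      using sg that unfolding simple_graph_def by (cases "u = v") auto
    obtain i0 where "x = h i0" using onto True by blast
    then have x': "x = h (i0 + n)" by (simp add: h_period)
    \<comment> \<open>One extra round leaves room for two steps back, so that x and its neighbours
      on the cycle are successors of \<open>h i\<close> and \<open>E_iff\<close> applies.\<close>
    define i where "i = i0 + n - 2"
    have "i0 + n = Suc (Suc i)" using n by (simp add: i_def)
    with x' have x: "x = h (Suc (Suc i))" by simp
    \<comment> \<open>A neighbour of x on the cycle is not y, since e is deleted. So it is adjacent
      to y in G, and that edge belongs to the induced cycle because it differs from e.\<close>
    have nbr: "{y, u} \<in> ?F" if u: "{u, x} \<in> ?F" for u
    proof -
      have ux: "{u, x} \<in> E" "u \<in> W" "{u, x} \<noteq> {x, y}" using u by (auto simp: induced_edges_def)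
      then have uy: "u \<noteq> y" by (auto simp: insert_commute)
      have "u \<in> closed_neighbours E y" using ux(1) nb by (auto simp: neighbours_def)
      with uy have "{u, y} \<in> E" by (simp add: closed_neighbours_def neighbours_def)
      moreover have "{u, y} \<noteq> {x, y}" using ne[OF ux(1)] uy by (auto simp: doubleton_eq_iff)
      ultimately show ?thesis using ux(2) True by (simp add: induced_edges_def insert_commute)
    qed
    have "{h (Suc i), x} \<in> cycle_labelling.E h" "{h (Suc (Suc (Suc i))), x} \<in> cycle_labelling.E h"
      by (simp_all add: x E_iff)
    then have "{h (Suc i), x} \<in> ?F" "{h (Suc (Suc (Suc i))), x} \<in> ?F" by (simp_all only: F)
    from this[THEN nbr]
    have "{y, h (Suc i)} \<in> cycle_labelling.E h" "{y, h (Suc (Suc (Suc i)))} \<in> cycle_labelling.E h"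
      by (simp_all only: F)
    then have "y = h i \<or> y = x" "y = x \<or> y = h (Suc (Suc (Suc (Suc i))))"
      unfolding E_iff x by blast+
    then have "y = h i" "y = h (Suc (Suc (Suc (Suc i))))" using ne[OF xy] by auto
    \<comment> \<open>Residue 2 and length at least 3 force length at least 5, whereas y would have
      to sit two steps from x in both directions.\<close>
    moreover have "4 < n" using n n3 by presburger
    ultimately show False using h_neq[of i "Suc (Suc (Suc (Suc i)))"] by simp
  qed
qed

lemma class_G_simple: "class_G V E \<Longrightarrow> simple_graph V E"
  by (cases rule: class_G.cases) auto

lemma components_props:
  assumes "simple_graph V E"
  shows "finite (components V E)" "\<And>C. C \<in> components V E \<Longrightarrow> C \<subseteq> V"
    "\<And>C C'. C \<in> components V E \<Longrightarrow> C' \<in> components V E \<Longrightarrow> C \<noteq> C' \<Longrightarrow> C \<inter> C' = {}"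
    "\<And>e. e \<in> E \<Longrightarrow> \<exists>C\<in>components V E. e \<subseteq> C"
proof -
  let ?R = "(adjacency E)\<^sup>*"
  have sym: "(u, v) \<in> ?R \<longleftrightarrow> (v, u) \<in> ?R" for u v
    using sym_rtrancl[of "adjacency E"] by (auto simp: sym_def adjacency_def insert_commute)
  show "finite (components V E)" using assms by (simp add: components_def simple_graph_def)
  show "C \<subseteq> V" if "C \<in> components V E" for C using that by (auto simp: components_def)
  show "C \<inter> C' = {}" if C: "C \<in> components V E" "C' \<in> components V E" "C \<noteq> C'" for C C'
  proof (rule ccontr)
    assume "C \<inter> C' \<noteq> {}"
    then obtain w where w: "w \<in> C" "w \<in> C'" by blast
    obtain v v' where vv: "C = {u \<in> V. (v, u) \<in> ?R}" "C' = {u \<in> V. (v', u) \<in> ?R}"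
      using C by (auto simp: components_def)
    then have "(v, v') \<in> ?R" using w sym by (metis (mono_tags) mem_Collect_eq rtrancl_trans)
    then have "(v, u) \<in> ?R \<longleftrightarrow> (v', u) \<in> ?R" for u using sym by (meson rtrancl_trans)
    then show False using C(3) vv by simp
  qed
  show "\<exists>C\<in>components V E. e \<subseteq> C" if e: "e \<in> E" for e
  proof -
    obtain u v where uv: "e = {u, v}" "u \<in> V" "v \<in> V" by (rule pair_edge[OF assms e])
    then have "(u, v) \<in> ?R" using e by (auto simp: adjacency_def)
    then have "e \<subseteq> {w \<in> V. (u, w) \<in> ?R}" using uv by auto
    then show ?thesis using uv(2) unfolding components_def by blast
  qed
qed

text \<open>The set \<open>W\<close> builds heredity into the induction: the edge step also needs
  the edges outside N[y], which form an induced subgraph of G - e. The graph \<open>F\<close> is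
  arbitrary so that components can be added one after the other, each with the earlier ones as part
  of \<open>F\<close>.\<close>

lemma strands_down_closed_class_G:
  assumes "class_G V E" "finite V0"
  shows "V \<subseteq> V0 \<Longrightarrow> no_bad_cycle V E \<Longrightarrow> W \<subseteq> V \<Longrightarrow> disjoint_edges V0 V F \<Longrightarrow>
    strands_down_closed TYPE('k::field) V0 F \<Longrightarrow> strands_down_closed TYPE('k) V0 (induced_edges E W \<union> F)"
  using assms(1)
proof (induction arbitrary: W F rule: class_G.induct)
  case (edgeless V)
  then show ?case by (simp add: induced_edges_def)
next
  case (disconnected V E)
  note comp = components_props[OF disconnected.hyps(1)]
  have "strands_down_closed TYPE('k) V0 ((\<Union>C\<in>\<C>. induced_edges E (W \<inter> C)) \<union> F)" if "\<C> \<subseteq> components V E" for \<C>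
    using finite_subset[OF that comp(1)] that
  proof (induction \<C> rule: finite_induct)
    case empty
    then show ?case using disconnected.prems by simp
  next
    case (insert C \<C>)
    let ?F = "(\<Union>C\<in>\<C>. induced_edges E (W \<inter> C)) \<union> F"
    have C: "C \<in> components V E" "C \<subseteq> V" using insert.prems comp(2) by auto
    \<comment> \<open>Distinct components are disjoint, so the edges collected so far stay away from
      \<open>C\<close>.\<close>
    have "disjoint_edges V0 C ?F"
      unfolding disjoint_edges_def
    proof (intro ballI)
      fix f assume "f \<in> ?F"
      then consider D where "D \<in> \<C>" "f \<in> E" "f \<subseteq> D" | "f \<in> F" by (auto simp: induced_edges_def)
      then show "f \<subseteq> V0 \<and> card f = 2 \<and> f \<inter> C = {}"
      proof cases
        case (1 D)
        then have "D \<inter> C = {}" using comp(3)[of D C] C insert by auto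
        then show ?thesis using 1 disconnected.hyps(1) disconnected.prems(1) unfolding simple_graph_def by blast
      next
        case 2
        then show ?thesis using disconnected.prems(4) C(2) unfolding disjoint_edges_def by blast
      qed
    qed
    moreover have "no_bad_cycle C (induced_edges E C)" by (rule no_bad_cycle_induced[OF disconnected.prems(2) C(2)])
    moreover have "C \<subseteq> V0" using C(2) disconnected.prems(1) by blast
    ultimately have "strands_down_closed TYPE('k) V0 (induced_edges (induced_edges E C) (W \<inter> C) \<union> ?F)"
      using disconnected.IH C(1) insert.IH insert.prems by simp
    then show ?case by (simp add: induced_edges_induced Un_assoc)
  qed
  from this[OF order_refl]
  have "strands_down_closed TYPE('k) V0 ((\<Union>C\<in>components V E. induced_edges E (W \<inter> C)) \<union> F)" .
  moreover have "(\<Union>C\<in>components V E. induced_edges E (W \<inter> C)) = induced_edges E W"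
  proof (intro equalityI subsetI)
    fix e assume e: "e \<in> induced_edges E W"
    then have "e \<in> E" by (simp add: induced_edges_def)
    from comp(4)[OF this] obtain C where C: "C \<in> components V E" "e \<subseteq> C" by blast
    from e C(2) have "e \<in> induced_edges E (W \<inter> C)" by (simp add: induced_edges_def)
    with C(1) show "e \<in> (\<Union>C\<in>components V E. induced_edges E (W \<inter> C))" by (rule UN_I)
  qed (auto simp: induced_edges_def)
  ultimately show ?case by simp
next
  case (cycle V E n)
  obtain h where "cycle_labelling V0 V n h" "E = cycle_labelling.E h"
    by (rule is_cycle_labelling[OF cycle.hyps(2,1) cycle.prems(1) assms(2)])
  moreover have "n mod 3 \<noteq> 2"
  proof -
    have "induced_edges E V = E" using cycle.hyps(1) by (auto simp: induced_edges_def simple_graph_def)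
    then show ?thesis using cycle.prems(2) cycle.hyps(2) unfolding no_bad_cycle_def by (metis order_refl)
  qed
  ultimately show ?case using cycle_labelling.strands_down_closed_induced_cycle cycle.prems by metis
next
  case (delete_edge V E x y)
  let ?D = "E - {{x, y}}"
  have bad: "no_bad_cycle V ?D"
    by (rule no_bad_cycle_delete[OF delete_edge.hyps(1) delete_edge.prems(2) delete_edge.hyps(4,5)])
  note IH = delete_edge.IH[OF delete_edge.prems(1) bad _ delete_edge.prems(4,5)]
  note F = delete_edge.prems(4)[unfolded disjoint_edges_def]
  show ?case
  proof (cases "{x, y} \<subseteq> W")
    case False
    then have "induced_edges E W = induced_edges ?D W" by (auto simp: induced_edges_def)
    then show ?thesis using IH[OF delete_edge.prems(3)] by simp
  next
    case True
    let ?E = "induced_edges E W \<union> F"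
    let ?C = "closed_neighbours ?E y"
    have xyV: "x \<in> V" "y \<in> V" using True delete_edge.prems(3) by auto
    have FV: "f \<inter> V = {}" if "f \<in> F" for f using F that by simp
    have nF: "{u, v} \<notin> F" if "v \<in> V" for u v using FV[of "{u, v}"] that by auto
    have Ev: "{u, v} \<in> ?E \<longleftrightarrow> {u, v} \<in> E \<and> u \<in> W \<and> v \<in> W" if "v \<in> V" for u v
      using nF[OF that] by (auto simp: induced_edges_def)
    have CW: "?C \<subseteq> W"
      using True unfolding closed_neighbours_def neighbours_def Ev[OF xyV(2)] by auto
    show ?thesis
    proof (rule strands_down_closed_edge[where x=x and y=y])
      show "simple_graph V0 ?E"
        unfolding simple_graph_def
      proof (intro conjI ballI)
        fix e assume "e \<in> ?E"
        then have "e \<in> E \<or> e \<in> F" by (auto simp: induced_edges_def)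
        moreover have "e \<subseteq> V \<and> card e = 2" if "e \<in> E"
          using delete_edge.hyps(1) that by (simp add: simple_graph_def)
        ultimately show "e \<subseteq> V0" "card e = 2" using F delete_edge.prems(1) by auto
      qed (rule assms(2))
      show "{x, y} \<in> ?E" using delete_edge.hyps(4) True by (simp add: induced_edges_def)
      \<comment> \<open>The neighbourhood condition passes to the induced subgraph because
        \<open>W\<close> contains both \<open>x\<close> and \<open>y\<close>, and \<open>F\<close>
        has no edge at either.\<close>
      show "neighbours ?E x \<subseteq> ?C"
      proof
        fix u assume "u \<in> neighbours ?E x"
        then have u: "{u, x} \<in> E" "u \<in> W" using Ev[OF xyV(1)] by (simp_all add: neighbours_def)
        then have "u \<in> closed_neighbours E y" using delete_edge.hyps(5) by (auto simp: neighbours_def)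
        then have "u = y \<or> {u, y} \<in> ?E"
          using u(2) True Ev[OF xyV(2)] by (auto simp: closed_neighbours_def neighbours_def)
        then show "u \<in> ?C" by (auto simp: closed_neighbours_def neighbours_def)
      qed
      have "?E - {{x, y}} = induced_edges ?D W \<union> F" using nF[OF xyV(2)] by (auto simp: induced_edges_def)
      then show "strands_down_closed TYPE('k) V0 (?E - {{x, y}})" using IH[OF delete_edge.prems(3)] by simp
      \<comment> \<open>Edges that avoid N[y] avoid y, so they differ from the deleted edge and the
        induction hypothesis for G - e covers them.\<close>
      have "{e \<in> ?E. e \<inter> ?C = {}} = induced_edges ?D (W - ?C) \<union> F"
      proof -
        have "f \<inter> ?C = {}" if "f \<in> F" for f using FV[OF that] CW delete_edge.prems(3) by blast
        moreover have "y \<in> ?C" by (simp add: closed_neighbours_def)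
        moreover from this have "e \<noteq> {x, y}" if "e \<inter> ?C = {}" for e using that by auto
        ultimately show ?thesis by (auto simp: induced_edges_def)
      qed
      then show "strands_down_closed TYPE('k) V0 {e \<in> ?E. e \<inter> ?C = {}}"
        using IH[of "W - ?C"] delete_edge.prems(3) by auto
    qed
  qed
qed

theorem theorem3p4:
  fixes V :: "'v set" and E :: "'v set set"
  assumes "class_G' V E"
  shows "strand_connected V (edge_ideal V E :: ('v, 'k::field) mpoly set)"
proof -
  have G: "class_G V E" "no_bad_cycle V E"
    using assms unfolding class_G'_def no_bad_cycle_def by blast+
  have sg: "simple_graph V E" by (rule class_G_simple[OF G(1)])
  \<comment> \<open>The induction starts with an empty disjoint graph, whose only position is that
    of R itself.\<close>
  have "down_closed {(0, 0)}" by (auto simp: down_closed_def)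
  then have "strands_down_closed TYPE('k) V ({} :: 'v set set)"
    using edge_positions_empty unfolding strands_down_closed_def by blast
  then have "strands_down_closed TYPE('k) V (induced_edges E V \<union> {})"
    by (intro strands_down_closed_class_G[OF G(1) _ order_refl G(2) order_refl])
      (use sg in \<open>auto simp: simple_graph_def disjoint_edges_def\<close>)
  moreover have "induced_edges E V = E" using sg by (auto simp: induced_edges_def simple_graph_def)
  ultimately obtain Y where Y: "min_res_quotient V (edge_ideal V E :: ('v, 'k) mpoly set) Y" "down_closed Y"
    unfolding strands_down_closed_def edge_ideal_eq_mideal[OF sg] by auto
  show ?thesis
    unfolding strand_connected_def strand_eq(1)[OF Y(1)]
  proof (intro allI impI)
    fix j
    let ?S = "{i. (i, j) \<in> Y}"
    assume ne: "?S \<noteq> {}"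
    have "?S \<subseteq> fst ` Y" by force
    then have fin: "finite ?S" using strand_eq(2)[OF Y(1)] by (meson finite_imageI finite_subset)
    show "?S = {Min ?S..Max ?S}"
    proof (intro equalityI subsetI)
      fix i assume "i \<in> {Min ?S..Max ?S}"
      moreover have "j \<le> Min ?S" using Min_in[OF fin ne] down_closedD(1)[OF Y(2)] by blast
      moreover have "(Max ?S, j) \<in> Y" using Max_in[OF fin ne] by blast
      ultimately show "i \<in> ?S" using down_closedD(2)[OF Y(2), of "Max ?S" j i] by simp
    qed (use fin in auto)
  qed
qed

end
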